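(* Let $\alpha$ be a quadratic irrational, $\beta\in\mathbb{R}$ and $\lambda\in(0,1/4)$. As $N\to\infty$, the number of integers $b\in\mathfrak{B}$ with $b\le N$ and $\|b\alpha-\beta\|\le N^{-\lambda}$ is asymptotic to $2B(N)/N^{\lambda}$, where $B(N)=\#\{b\in\mathfrak{B}: b\le N\}$.
   Context: $\mathfrak{B}$ is the set of odd positive integers that are sums of two coprime squares (equivalently, odd positive integers with no prime factor $\equiv3\pmod4$). $\|x\|$ denotes the distance from $x$ to the nearest integer. *)

theory Defs
  imports Complex_Main "HOL-Library.Landau_Symbols"
begin

definition coprime_square_sums :: "nat set" where
  "coprime_square_sums =
     {b. odd b \<and> (\<exists>x y :: nat. coprime x y \<and> b = x\<^sup>2 + y\<^sup>2)}"

definition coprime_square_sums_count :: "real \<Rightarrow> nat" where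
  "coprime_square_sums_count N = card {b \<in> coprime_square_sums. real b \<le> N}"

definition quadratic_irrational :: "real \<Rightarrow> bool" where
  "quadratic_irrational \<alpha> \<longleftrightarrow>
     \<alpha> \<notin> \<rat> \<and>
     (\<exists>a b c :: int. a \<noteq> 0 \<and> of_int a * \<alpha>\<^sup>2 + of_int b * \<alpha> + of_int c = 0)"

definition nearest_int_dist :: "real \<Rightarrow> real" where
  "nearest_int_dist x = \<bar>x - of_int (round x)\<bar>"

end

theory Submission
  imports Defs "HOL-Analysis.Analysis" "HOL-Number_Theory.Number_Theory"
    "HOL-Computational_Algebra.Squarefree" "HOL-Library.Discrete_Functions"
    "HOL-Real_Asymp.Real_Asymp"
begin

text \<open>
  Write \<open>e(x) = exp(2 \<pi> i x)\<close>. Approximating the indicator function of an arc of length \<open>2 N\<^sup>-\<^sup>\<lambda>\<close> by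
  trigonometric polynomials of degree \<open>H = N\<^sup>\<theta>\<close> with \<open>\<lambda> < \<theta> < 1/4\<close> reduces the claim to a power saving
  for \<open>\<Sum>\<^sub>b \<Sum>\<^sub>h c\<^sub>h e(h b \<alpha>)\<close>, where \<open>h \<le> H\<close> and \<open>\<bar>c\<^sub>h\<bar> \<le> 1\<close>, together with the weak lower bound
  \<open>B(N) \<ge> N powr (1 - \<epsilon>)\<close>.

  Call a prime bad if it is 3 modulo 4. The set consists of the \<open>n \<equiv> 1\<close> modulo 4 without bad prime factor, and an
  \<open>n \<equiv> 1\<close> modulo 4 with a bad prime factor has one that is at most \<open>\<surd>n\<close>. In the inclusion-exclusion formula
  over squarefree products of bad primes the terms \<open>d < Y = N\<^sup>1\<^sup>/\<^sup>4\<close> are estimated individually;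
  the remaining ones combine to a bilinear form in \<open>n = u m\<close> with \<open>Y \<le> u \<le> \<surd>N\<close>. By Cauchy's inequality over
  \<open>m\<close>, keeping the sum over \<open>h\<close> inside, the bilinear form is controlled by \<open>\<Sum>\<^sub>l 1 / \<parallel>l \<alpha>\<parallel>\<close> over
  \<open>l \<lless> H u\<close>, which is small because \<open>\<parallel>l \<alpha>\<parallel> \<ggreater> 1/l\<close>. The saving requires \<open>H < u\<close> and \<open>H\<^sup>2 u < N\<close>;
  on the whole range of \<open>u\<close> this means \<open>\<theta> < 1/4\<close>.
\<close>

section \<open>Exponential sums and badly approximable numbers\<close>

text \<open>The exponent 1/4 is where several constraints meet. Up to factors N^eps, Cauchy's
  inequality bounds a block u ~ U by sqrt(N) times the square root of a row sum of a Gram matrix,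
  and that row sum is H (N/U + H U): for fixed h and u the products h'u' run through integers up to
  H U, each hit at most N^eps times by the divisor bound. It is below N if H < U and H^2 U < N. The
  small divisors cost H^2 Y^2, which for Y = N^(1/4) again asks for H < N^(1/4). The variables u and
  m remain coupled, through u m <= N and through a comparison of least bad primes. Both couplings
  have the form a(u) < b(m), and a binary digit argument removes each of them at the cost of a
  logarithm, whatever a and b are. As every error term saves a power of N, B(N) is only needed up to
  N^eps; a second moment of the number of representations gives this without an asymptotic formula
  for B.\<close>

lemma nearest_int_dist_le: "nearest_int_dist x \<le> \<bar>x - of_int k\<bar>"
  unfolding nearest_int_dist_def using round_diff_minimal[of x k] by (simp add: abs_minus_commute)

lemma nearest_int_dist_nonneg [simp]: "0 \<le> nearest_int_dist x"
  by (simp add: nearest_int_dist_def)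

lemma nearest_int_dist_le_half: "nearest_int_dist x \<le> 1 / 2"
  unfolding nearest_int_dist_def using of_int_round_abs_le[of x] by (simp add: abs_minus_commute)

lemma nearest_int_dist_attained: obtains k :: int where "nearest_int_dist x = \<bar>x - of_int k\<bar>"
  by (auto simp: nearest_int_dist_def)

lemma nearest_int_dist_minus [simp]: "nearest_int_dist (- x) = nearest_int_dist x"
proof -
  have "nearest_int_dist (- y) \<le> nearest_int_dist y" for y
  proof -
    obtain k :: int where "nearest_int_dist y = \<bar>y - of_int k\<bar>" by (rule nearest_int_dist_attained)
    then show ?thesis using nearest_int_dist_le[of "-y" "-k"] by simp
  qed
  from this[of x] this[of "-x"] show ?thesis by simp
qed

lemma nearest_int_dist_triangle: "nearest_int_dist x \<le> nearest_int_dist (x - y) + nearest_int_dist y"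
proof -
  obtain k l :: int where "nearest_int_dist (x - y) = \<bar>x - y - of_int k\<bar>" "nearest_int_dist y = \<bar>y - of_int l\<bar>"
    by (metis nearest_int_dist_attained)
  then show ?thesis using nearest_int_dist_le[of x "k + l"] by simp
qed

text \<open>Jordan's inequality: sine is concave on [0, pi/2] and therefore lies above its
  chord.\<close>

lemma sin_pi_ge:
  fixes x :: real
  assumes "0 \<le> x" "x \<le> 1 / 2"
  shows "2 * x \<le> sin (pi * x)"
proof -
  have "convex_on {0..pi/2} (\<lambda>y. - sin y :: real)"
  proof (rule f''_ge0_imp_convex[where f' = "\<lambda>y. - cos y" and f'' = sin])
    show "convex {0..pi/2}" by simp
  next
    fix y :: real assume "y \<in> {0..pi/2}"
    show "((\<lambda>y. - sin y) has_real_derivative - cos y) (at y)"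
      by (auto intro!: derivative_eq_intros)
    show "((\<lambda>y. - cos y) has_real_derivative sin y) (at y)"
      by (auto intro!: derivative_eq_intros)
    show "0 \<le> sin y" using \<open>y \<in> _\<close> by (intro sin_ge_zero) auto
  qed
  from convex_onD[OF this, of "2 * x" 0 "pi / 2"] assms
  show ?thesis by (simp add: mult.commute)
qed

definition expi :: "real \<Rightarrow> complex" where "expi x = cis (2 * pi * x)"

lemma norm_expi [simp]: "norm (expi x) = 1"
  by (simp add: expi_def)

lemma expi_add: "expi (x + y) = expi x * expi y"
  by (simp add: expi_def cis_mult algebra_simps)

lemma expi_minus: "expi (- x) = cnj (expi x)"
  by (simp add: expi_def cis_cnj)

lemma expi_0 [simp]: "expi 0 = 1"
  by (simp add: expi_def)

lemma expi_power: "expi x ^ n = expi (real n * x)"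
  unfolding expi_def Complex.DeMoivre by (simp add: algebra_simps)

lemma expi_of_int [simp]: "expi (of_int k) = 1"
  by (simp add: expi_def cis_multiple_2pi)

text \<open>If d is the signed distance of x to the nearest integer, the chord |1 - e(d)| has length
  2 |sin(pi d)|, and Jordan's inequality applies because |d| <= 1/2.\<close>

lemma norm_expi_minus_1_ge: "4 * nearest_int_dist x \<le> norm (1 - expi x)"
proof -
  define d where "d = x - of_int (round x)"
  have nd: "nearest_int_dist x = \<bar>d\<bar>" "\<bar>d\<bar> \<le> 1 / 2"
    using nearest_int_dist_le_half[of x] by (auto simp: d_def nearest_int_dist_def)
  have "expi x = expi d"
    unfolding d_def using expi_add[of "x - of_int (round x)" "of_int (round x)"] by simp
  have "norm (1 - expi d) ^ 2 = (1 - cos (2 * (pi * d)))^2 + (sin (2 * (pi * d)))^2"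
    unfolding expi_def cmod_power2 by (simp add: mult.assoc)
  also have "\<dots> = (2 * sin (pi * \<bar>d\<bar>))^2"
    using sin_cos_squared_add[of "2 * (pi * d)"] cos_double_sin[of "pi * d"]
    by (cases "d \<ge> 0") (simp_all add: power2_eq_square algebra_simps)
  finally have "norm (1 - expi d) = \<bar>2 * sin (pi * \<bar>d\<bar>)\<bar>"
    by (metis abs_norm_cancel power2_eq_iff_nonneg real_sqrt_abs)
  moreover have "2 * \<bar>d\<bar> \<le> sin (pi * \<bar>d\<bar>)" using nd by (intro sin_pi_ge) auto
  ultimately show ?thesis using nd \<open>expi x = expi d\<close> by simp
qed

text \<open>Multiplying the geometric sum by 1 - e(x) leaves at most 2 in absolute value.\<close>

lemma norm_sum_expi_le:
  assumes "nearest_int_dist x > 0"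
  shows "norm (\<Sum>m<M. expi (real m * x)) \<le> 1 / (2 * nearest_int_dist x)"
proof -
  have "norm (1 - expi x) * norm (\<Sum>m<M. expi (real m * x)) = norm (1 - expi x ^ M)"
    by (simp add: norm_mult[symmetric] expi_power[symmetric] one_diff_power_eq)
  also have "\<dots> \<le> 2"
    using norm_triangle_ineq4[of 1 "expi x ^ M"] by (simp add: norm_power)
  finally have "norm (1 - expi x) * norm (\<Sum>m<M. expi (real m * x)) \<le> 2" .
  moreover have "4 * nearest_int_dist x * norm (\<Sum>m<M. expi (real m * x)) 
      \<le> norm (1 - expi x) * norm (\<Sum>m<M. expi (real m * x))"
    by (intro mult_right_mono norm_expi_minus_1_ge) auto
  ultimately show ?thesis using assms by (simp add: field_simps)
qed

text \<open>Liouville's argument. Let f be the quadratic polynomial of alpha and r = p/l the best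
  fraction with denominator l. Then l^2 f(r) is a nonzero integer, while f(r) is r - alpha times a
  linear cofactor that stays bounded for r near alpha.\<close>

lemma quadratic_irrational_badly_approximable:
  assumes "quadratic_irrational \<alpha>"
  obtains c where "0 < c" "\<And>l :: nat. l > 0 \<Longrightarrow> c / real l \<le> nearest_int_dist (real l * \<alpha>)"
proof -
  obtain a b c :: int where irr: "\<alpha> \<notin> \<rat>" and "a \<noteq> 0"
    and root: "of_int a * \<alpha>\<^sup>2 + of_int b * \<alpha> + of_int c = 0"
    using assms by (auto simp: quadratic_irrational_def)
  \<comment> \<open>\<open>K\<close> bounds the cofactor a (r + alpha) + b once |r - alpha| <= 1;
    the final summand 1 makes it positive in all cases.\<close>
  define K where "K = \<bar>of_int a\<bar> * (2 * \<bar>\<alpha>\<bar> + 1) + \<bar>of_int b\<bar> + (1::real)"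
  have "K \<ge> 1" by (simp add: K_def)
  show ?thesis
  proof (rule that[of "1 / K"])
    show "0 < 1 / K" using \<open>K \<ge> 1\<close> by simp
    fix l :: nat assume "l > 0"
    obtain p :: int where p: "nearest_int_dist (real l * \<alpha>) = \<bar>real l * \<alpha> - of_int p\<bar>"
      by (rule nearest_int_dist_attained)
    define r where "r = of_int p / real l"
    have "r \<in> \<rat>" by (simp add: r_def)
    have fac: "of_int a * r\<^sup>2 + of_int b * r + of_int c = (r - \<alpha>) * (of_int a * (r + \<alpha>) + of_int b)"
      using root by (simp add: power2_eq_square algebra_simps)
    \<comment> \<open>A rational root r would either equal alpha or be its conjugate, and alpha + r
      = - b / a would make alpha rational.\<close>
    have "of_int a * r\<^sup>2 + of_int b * r + of_int c \<noteq> 0"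
    proof
      assume "of_int a * r\<^sup>2 + of_int b * r + of_int c = 0"
      then have "r - \<alpha> = 0 \<or> of_int a * (r + \<alpha>) + of_int b = 0"
        unfolding fac by simp
      then have "r = \<alpha> \<or> \<alpha> = - r - of_int b / of_int a"
        using \<open>a \<noteq> 0\<close> by (auto simp: field_simps)
      then show False using irr \<open>r \<in> \<rat>\<close> by (auto intro!: Rats_diff Rats_minus_iff[THEN iffD2])
    qed
    moreover have int: "(of_int a * r\<^sup>2 + of_int b * r + of_int c) * (real l)\<^sup>2 = of_int (a * p\<^sup>2 + b * p * int l + c * (int l)\<^sup>2)"
      using \<open>l > 0\<close> by (simp add: r_def field_simps power2_eq_square)
    ultimately have "a * p\<^sup>2 + b * p * int l + c * (int l)\<^sup>2 \<noteq> 0"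
      using \<open>l > 0\<close> by (metis mult_eq_0_iff of_int_0 of_nat_0_eq_iff not_gr0 power_eq_0_iff)
    then have "1 \<le> \<bar>a * p\<^sup>2 + b * p * int l + c * (int l)\<^sup>2\<bar>" by linarith
    then have "1 \<le> \<bar>real_of_int (a * p\<^sup>2 + b * p * int l + c * (int l)\<^sup>2)\<bar>" by linarith
    then have one: "1 \<le> \<bar>r - \<alpha>\<bar> * \<bar>of_int a * (r + \<alpha>) + of_int b\<bar> * (real l)\<^sup>2"
      unfolding int[symmetric] fac by (simp add: abs_mult)
    have rl: "\<bar>r - \<alpha>\<bar> * real l = nearest_int_dist (real l * \<alpha>)"
    proof -
      have "\<bar>r - \<alpha>\<bar> * real l = \<bar>(r - \<alpha>) * real l\<bar>" by (simp add: abs_mult)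
      also have "(r - \<alpha>) * real l = - (real l * \<alpha> - of_int p)" using \<open>l > 0\<close> by (simp add: r_def field_simps)
      finally show ?thesis using p by simp
    qed
    have "\<bar>r - \<alpha>\<bar> \<le> \<bar>r - \<alpha>\<bar> * real l" using \<open>l > 0\<close> by (simp add: mult_le_cancel_left1)
    also have "\<dots> \<le> 1" unfolding rl using nearest_int_dist_le_half[of "real l * \<alpha>"] by simp
    finally have "\<bar>r + \<alpha>\<bar> \<le> 2 * \<bar>\<alpha>\<bar> + 1" by linarith
    then have "\<bar>of_int a * (r + \<alpha>)\<bar> \<le> \<bar>of_int a\<bar> * (2 * \<bar>\<alpha>\<bar> + 1)"
      unfolding abs_mult by (intro mult_left_mono) auto
    then have "\<bar>of_int a * (r + \<alpha>) + of_int b\<bar> \<le> K" unfolding K_def by linarith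
    then have "\<bar>r - \<alpha>\<bar> * \<bar>of_int a * (r + \<alpha>) + of_int b\<bar> * (real l)\<^sup>2 \<le> \<bar>r - \<alpha>\<bar> * K * (real l)\<^sup>2"
      by (intro mult_right_mono mult_left_mono) auto
    also have "\<dots> = nearest_int_dist (real l * \<alpha>) * K * real l"
      unfolding rl[symmetric] by (simp add: power2_eq_square)
    finally show "1 / K / real l \<le> nearest_int_dist (real l * \<alpha>)"
      using one \<open>K \<ge> 1\<close> \<open>l > 0\<close> by (simp add: field_simps)
  qed
qed

text \<open>The multiples \<open>l \<alpha>\<close> with \<open>l \<le> L\<close> lie in distinct intervals \<open>[j/Q, (j+1)/Q)\<close> modulo 1, all with \<open>j \<ge> 1\<close>.\<close>

lemma sum_inverse_frac_le:
  assumes c: "0 < c" "\<And>l :: nat. l > 0 \<Longrightarrow> c / real l \<le> nearest_int_dist (real l * \<alpha>)"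
    and Q: "real L \<le> c * real Q"
  shows "(\<Sum>l=1..L. 1 / frac (real l * \<alpha>)) \<le> real Q * (\<Sum>j=1..Q. 1 / real j)"
proof (cases "L = 0")
  case True
  then show ?thesis by (simp add: sum_nonneg)
next
  case False
  then have "Q > 0" using Q c(1) by (cases "Q = 0") auto
  \<comment> \<open>\<open>J l\<close> is the index of the interval of length 1/Q that contains the
    fractional part of l alpha.\<close>
  define J where "J l = nat \<lfloor>frac (real l * \<alpha>) * real Q\<rfloor>" for l :: nat
  have nid_frac: "nearest_int_dist x \<le> frac x" for x
    using nearest_int_dist_le[of x "\<lfloor>x\<rfloor>"] frac_ge_0[of x] by (simp add: frac_def)
  have ge1: "1 \<le> frac (real l * \<alpha>) * real Q" if "l \<in> {1..L}" for l
  proof -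
    have "c / real L \<le> c / real l" using that c by (intro divide_left_mono) auto
    also have "\<dots> \<le> frac (real l * \<alpha>)" using c(2)[of l] nid_frac[of "real l * \<alpha>"] that by simp
    finally have "c / real L * real Q \<le> frac (real l * \<alpha>) * real Q" by (intro mult_right_mono) auto
    moreover have "1 \<le> c / real L * real Q" using Q False by (simp add: field_simps)
    ultimately show ?thesis by linarith
  qed
  have J_le: "real (J l) \<le> frac (real l * \<alpha>) * real Q" for l
    unfolding J_def using frac_ge_0[of "real l * \<alpha>"] by (simp add: )
  have J_gt: "frac (real l * \<alpha>) * real Q < real (J l) + 1" for l
    unfolding J_def using frac_ge_0[of "real l * \<alpha>"] by (simp add: )
  have J_in: "J l \<in> {1..Q}" if "l \<in> {1..L}" for l
  proof -
    have "1 \<le> J l" unfolding J_def using ge1[OF that] by (simp add: le_nat_iff le_floor_iff)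
    moreover have "frac (real l * \<alpha>) * real Q \<le> 1 * real Q"
      using frac_lt_1[of "real l * \<alpha>"] by (intro mult_right_mono) auto
    then have "real (J l) \<le> real Q" using J_le[of l] by linarith
    ultimately show ?thesis by simp
  qed
  \<comment> \<open>Two multiples in one interval would put (l - l') alpha within less than 1/Q of
    an integer, whereas its distance is at least c/L >= 1/Q.\<close>
  have less: False if "l \<in> {1..L}" "l' \<in> {1..L}" "J l = J l'" "l' < l" for l l'
  proof -
    have "\<bar>frac (real l * \<alpha>) * real Q - frac (real l' * \<alpha>) * real Q\<bar> < 1"
      using J_le[of l] J_gt[of l] J_le[of l'] J_gt[of l'] that(3) by linarith
    then have *: "\<bar>frac (real l * \<alpha>) - frac (real l' * \<alpha>)\<bar> * real Q < 1"
      by (simp add: left_diff_distrib[symmetric] abs_mult)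
    have "nearest_int_dist (real (l - l') * \<alpha>) \<le> \<bar>real (l - l') * \<alpha> - of_int (\<lfloor>real l * \<alpha>\<rfloor> - \<lfloor>real l' * \<alpha>\<rfloor>)\<bar>"
      by (rule nearest_int_dist_le)
    also have "\<dots> = \<bar>frac (real l * \<alpha>) - frac (real l' * \<alpha>)\<bar>"
      using that by (simp add: frac_def algebra_simps of_nat_diff)
    finally have "nearest_int_dist (real (l - l') * \<alpha>) * real Q < 1"
      using * by (meson mult_right_mono of_nat_0_le_iff order_le_less_trans)
    moreover have "c / real L \<le> c / real (l - l')" using that c by (intro divide_left_mono) auto
    then have "c / real L \<le> nearest_int_dist (real (l - l') * \<alpha>)" using c(2)[of "l - l'"] that by simp
    then have "c / real L * real Q \<le> nearest_int_dist (real (l - l') * \<alpha>) * real Q" by (intro mult_right_mono) auto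
    moreover have "1 \<le> c / real L * real Q" using Q False by (simp add: field_simps)
    ultimately show False by linarith
  qed
  have inj: "inj_on J {1..L}"
    by (rule inj_onI) (metis less nat_neq_iff)
  have "(\<Sum>l=1..L. 1 / frac (real l * \<alpha>)) \<le> (\<Sum>l=1..L. real Q * (1 / real (J l)))"
  proof (rule sum_mono)
    fix l assume l: "l \<in> {1..L}"
    have "0 < frac (real l * \<alpha>)" using ge1[OF l] frac_ge_0[of "real l * \<alpha>"] by (cases "frac (real l * \<alpha>) = 0") auto
    moreover have "J l > 0" using J_in[OF l] by simp
    ultimately show "1 / frac (real l * \<alpha>) \<le> real Q * (1 / real (J l))"
      using J_le[of l] by (simp add: field_simps)
  qed
  also have "\<dots> = real Q * (\<Sum>l\<in>{1..L}. 1 / real (J l))" by (simp add: sum_distrib_left)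
  also have "(\<Sum>l\<in>{1..L}. 1 / real (J l)) = (\<Sum>j\<in>J ` {1..L}. 1 / real j)"
    using inj by (simp add: sum.reindex)
  also have "\<dots> \<le> (\<Sum>j=1..Q. 1 / real j)" using J_in by (intro sum_mono2) auto
  finally show ?thesis by (simp add: mult_left_mono)
qed

text \<open>The distance to the nearest integer is the fractional part of either l alpha or - l
  alpha, and - alpha satisfies the same approximation hypothesis; the one-sided bound is used for
  both.\<close>

lemma sum_inverse_nearest_int_dist_le:
  assumes c: "0 < c" "\<And>l :: nat. l > 0 \<Longrightarrow> c / real l \<le> nearest_int_dist (real l * \<alpha>)"
    and Q: "real L \<le> c * real Q"
  shows "(\<Sum>l=1..L. 1 / nearest_int_dist (real l * \<alpha>)) \<le> 2 * real Q * (\<Sum>j=1..Q. 1 / real j)"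
proof -
  have "(\<Sum>l=1..L. 1 / nearest_int_dist (real l * \<alpha>))
      \<le> (\<Sum>l=1..L. 1 / frac (real l * \<alpha>) + 1 / frac (real l * (- \<alpha>)))"
  proof (rule sum_mono)
    fix l assume "l \<in> {1..L}"
    define x where "x = real l * \<alpha>"
    obtain k :: int where k: "nearest_int_dist x = \<bar>x - of_int k\<bar>" by (rule nearest_int_dist_attained)
    have pos: "nearest_int_dist x > 0" using c(2)[of l] \<open>l \<in> _\<close> c(1)
      by (metis atLeastAtMost_iff divide_pos_pos less_le_trans of_nat_0_less_iff x_def zero_less_one)
    have "frac x \<le> nearest_int_dist x \<or> frac (- x) \<le> nearest_int_dist x"
    proof (cases "of_int k \<le> x")
      case True
      then have "k \<le> \<lfloor>x\<rfloor>" by (simp add: le_floor_iff)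
      then show ?thesis using k True by (auto simp: frac_def)
    next
      case False
      then have "- k \<le> \<lfloor>- x\<rfloor>" by (simp add: le_floor_iff)
      then have "- real_of_int k \<le> of_int \<lfloor>- x\<rfloor>" by linarith
      then show ?thesis using k False by (auto simp: frac_def)
    qed
    moreover have "frac x > 0" "frac (- x) > 0"
    proof -
      have "x \<notin> \<int>"
      proof
        assume "x \<in> \<int>"
        then obtain z where "x = of_int z" by (auto elim: Ints_cases)
        then show False using pos nearest_int_dist_le[of x z] by simp
      qed
      then show "frac x > 0" "frac (- x) > 0" by (simp_all add: frac_gt_0_iff)
    qed
    ultimately have "1 / nearest_int_dist x \<le> 1 / frac x + 1 / frac (- x)"
      using pos by (smt (verit) divide_left_mono divide_nonneg_pos mult_pos_pos)
    then show "1 / nearest_int_dist (real l * \<alpha>) \<le> 1 / frac (real l * \<alpha>) + 1 / frac (real l * (- \<alpha>))"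
      by (simp add: x_def)
  qed
  also have "\<dots> \<le> real Q * (\<Sum>j=1..Q. 1 / real j) + real Q * (\<Sum>j=1..Q. 1 / real j)"
    unfolding sum.distrib using c Q by (intro add_mono sum_inverse_frac_le[where c = c]) simp_all
  finally show ?thesis by simp
qed

section \<open>The divisor bound\<close>

lemma card_divisors_prime_power_mult_le:
  fixes p m a :: nat
  assumes "prime p" "m > 0"
  shows "card {d. d dvd p ^ a * m} \<le> (a + 1) * card {d. d dvd m}"
proof -
  have "{d. d dvd p ^ a * m} \<subseteq> (\<lambda>(i, e). p ^ i * e) ` ({..a} \<times> {d. d dvd m})"
  proof
    fix d assume "d \<in> {d. d dvd p ^ a * m}"
    then obtain b c where "d = b * c" "b dvd p ^ a" "c dvd m"
      using division_decomp by blast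
    then show "d \<in> (\<lambda>(i, e). p ^ i * e) ` ({..a} \<times> {d. d dvd m})"
      using \<open>prime p\<close> by (auto simp: divides_primepow_nat)
  qed
  then have "card {d. d dvd p ^ a * m} \<le> card ({..a} \<times> {d. d dvd m})"
    using assms by (intro surj_card_le) auto
  then show ?thesis by (simp add: card_cartesian_product)
qed

text \<open>The quotient d(n) / n^eps is a product of local factors (a + 1) / p^(eps a). Such a
  factor is at most 1 for p >= \<open>K\<close> and at most \<open>A\<close> for every p, so only
  the boundedly many primes below \<open>K\<close> contribute to the constant.\<close>

lemma divisor_bound:
  fixes \<epsilon> :: real
  assumes "\<epsilon> > 0"
  obtains C where "C > 0" "\<And>n :: nat. n > 0 \<Longrightarrow> real (card {d. d dvd n}) \<le> C * real n powr \<epsilon>"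
proof -
  \<comment> \<open>\<open>K\<close> is the point from which p^eps >= 2, so that p^(eps a) >= 2^a >=
    a + 1. For smaller p the only input is 2^(eps a) >= 1 + eps a ln 2, and \<open>A\<close> is
    chosen so that \<open>A\<close> times this lower bound is at least a + 1.\<close>
  define A where "A = 1 + 1 / (\<epsilon> * ln 2)"
  define K where "K = 2 powr (1 / \<epsilon>)"
  have "A \<ge> 1" using assms by (simp add: A_def)
  have big: "real a + 1 \<le> real p powr (\<epsilon> * real a)" if "K \<le> real p" for p a :: nat
  proof -
    have "2 = K powr \<epsilon>" using assms by (simp add: K_def powr_powr)
    also have "\<dots> \<le> real p powr \<epsilon>" using that assms by (intro powr_mono2) (auto simp: K_def)
    finally have "2 powr real a \<le> (real p powr \<epsilon>) powr real a" by (intro powr_mono2) auto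
    moreover have "real a + 1 \<le> 2 ^ a" 
      using less_exp[of a] by (metis Suc_eq_plus1 Suc_leI of_nat_1 of_nat_add of_nat_le_iff of_nat_numeral of_nat_power)
    ultimately show ?thesis by (simp add: powr_powr powr_realpow)
  qed
  have small: "real a + 1 \<le> A * real p powr (\<epsilon> * real a)" if "2 \<le> p" for p a :: nat
  proof -
    have "1 + \<epsilon> * real a * ln 2 \<le> exp (\<epsilon> * real a * ln 2)" by (rule exp_ge_add_one_self)
    also have "\<dots> = 2 powr (\<epsilon> * real a)" by (simp add: powr_def)
    also have "\<dots> \<le> real p powr (\<epsilon> * real a)" using that assms by (intro powr_mono2) auto
    finally have "A * (1 + \<epsilon> * real a * ln 2) \<le> A * real p powr (\<epsilon> * real a)"
      using \<open>A \<ge> 1\<close> by (intro mult_left_mono) auto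
    moreover have "real a + 1 \<le> A * (1 + \<epsilon> * real a * ln 2)"
      using assms by (simp add: A_def field_simps)
    ultimately show ?thesis by linarith
  qed
  have main: "real (card {d. d dvd n}) \<le> A ^ card {p \<in> prime_factors n. real p < K} * real n powr \<epsilon>"
    if "n > 0" for n :: nat
    using that
  proof (induction n rule: less_induct)
    case (less n)
    show ?case
    proof (cases "n = 1")
      case True
      then show ?thesis using \<open>A \<ge> 1\<close> by simp
    next
      case False
      then obtain p where p: "prime p" "p dvd n" using prime_factor_nat by blast
      define a where "a = multiplicity p n"
      obtain m where m: "n = p ^ a * m" "\<not> p dvd m"
        unfolding a_def using multiplicity_decompose'[of n p] p less.prems by (metis not_prime_unit not_gr0)
      have "a > 0" unfolding a_def using p less.prems by (simp add: prime_multiplicity_gt_zero_iff)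
      have "m > 0" using m less.prems by (cases "m = 0") auto
      have "p \<ge> 2" using p prime_ge_2_nat by blast
      have "1 < p ^ a" using \<open>a > 0\<close> \<open>p \<ge> 2\<close> by (intro one_less_power) auto
      then have "m < n" using m \<open>m > 0\<close> by simp
      note IH = less.IH[OF this \<open>m > 0\<close>]
      have pf: "prime_factors n = insert p (prime_factors m)"
        unfolding m(1) using p \<open>a > 0\<close> \<open>m > 0\<close> \<open>p \<ge> 2\<close>
        by (auto simp: prime_factors_dvd prime_dvd_mult_iff prime_dvd_power_iff dest: primes_dvd_imp_eq)
      have pm: "p \<notin> prime_factors m" using m by auto
      have npow: "real n powr \<epsilon> = real p powr (\<epsilon> * real a) * real m powr \<epsilon>"
        unfolding m(1) using \<open>p \<ge> 2\<close> 
        by (simp add: powr_mult powr_powr powr_realpow[symmetric] mult.commute)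
      have "real (card {d. d dvd n}) \<le> real ((a + 1) * card {d. d dvd m})"
        unfolding m(1) of_nat_le_iff by (rule card_divisors_prime_power_mult_le[OF p(1) \<open>m > 0\<close>])
      also have "\<dots> = (real a + 1) * real (card {d. d dvd m})"
        by (simp add: algebra_simps)
      also have "\<dots> \<le> (real a + 1) * (A ^ card {p \<in> prime_factors m. real p < K} * real m powr \<epsilon>)"
        using IH by (intro mult_left_mono) auto
      also have "\<dots> \<le> A ^ card {p \<in> prime_factors n. real p < K} * real n powr \<epsilon>"
      proof (cases "real p < K")
        case True
        then have "{p \<in> prime_factors n. real p < K} = insert p {p \<in> prime_factors m. real p < K}"
          unfolding pf by auto
        then have "card {p \<in> prime_factors n. real p < K} = Suc (card {p \<in> prime_factors m. real p < K})"
          using pm by simp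
        moreover have "(real a + 1) * (A ^ card {p \<in> prime_factors m. real p < K} * real m powr \<epsilon>)
           \<le> A * real p powr (\<epsilon> * real a) * (A ^ card {p \<in> prime_factors m. real p < K} * real m powr \<epsilon>)"
          using small[OF \<open>p \<ge> 2\<close>, of a] \<open>A \<ge> 1\<close> by (intro mult_right_mono) auto
        ultimately show ?thesis unfolding npow by (simp add: algebra_simps)
      next
        case False
        then have "{p \<in> prime_factors n. real p < K} = {p \<in> prime_factors m. real p < K}"
          unfolding pf by auto
        moreover have "(real a + 1) * (A ^ card {p \<in> prime_factors m. real p < K} * real m powr \<epsilon>)
           \<le> real p powr (\<epsilon> * real a) * (A ^ card {p \<in> prime_factors m. real p < K} * real m powr \<epsilon>)"
          using big[of p a] False \<open>A \<ge> 1\<close> by (intro mult_right_mono) auto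
        ultimately show ?thesis unfolding npow by (simp add: algebra_simps)
      qed
      finally show ?thesis .
    qed
  qed
  show ?thesis
  proof (rule that[of "A ^ nat \<lceil>K\<rceil>"])
    show "A ^ nat \<lceil>K\<rceil> > 0" using \<open>A \<ge> 1\<close> by simp
    fix n :: nat assume "n > 0"
    have "{p \<in> prime_factors n. real p < K} \<subseteq> {..<nat \<lceil>K\<rceil>}" by (auto simp: less_ceiling_iff zless_nat_eq_int_zless)
    then have "card {p \<in> prime_factors n. real p < K} \<le> nat \<lceil>K\<rceil>"
      using card_mono[of "{..<nat \<lceil>K\<rceil>}"] by simp
    then have "A ^ card {p \<in> prime_factors n. real p < K} \<le> A ^ nat \<lceil>K\<rceil>"
      using \<open>A \<ge> 1\<close> by (intro power_increasing)
    then show "real (card {d. d dvd n}) \<le> A ^ nat \<lceil>K\<rceil> * real n powr \<epsilon>"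
      using main[OF \<open>n > 0\<close>] by (meson mult_right_mono order_trans powr_ge_zero)
  qed
qed

section \<open>Primitive sums of two squares\<close>

text \<open>Euler's criterion: the exponent (p - 1) / 2 is even or odd according to p modulo 4, and
  1 differs from -1 modulo p as p > 2.\<close>

lemma QuadRes_minus_one_iff:
  assumes "prime p" "p > 2"
  shows "QuadRes (int p) (- 1) \<longleftrightarrow> p mod 4 = 1"
proof -
  have "odd p" using assms by (simp add: prime_odd_nat)
  have nd: "\<not> [- 1 = 0] (mod int p)"
    using assms by (auto simp: cong_0_iff zdvd_not_zless)
  have "[Legendre (- 1) (int p) = (- 1) ^ ((p - 1) div 2)] (mod int p)"
    using euler_criterion[of p "- 1"] assms by simp
  then have *: "[(if QuadRes (int p) (- 1) then 1 else - 1) = (- 1) ^ ((p - 1) div 2)] (mod int p)"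
    using nd by (simp add: Legendre_def)
  have ne: "\<not> [1 = - 1] (mod int p)" "\<not> [- 1 = 1] (mod int p)"
    using assms by (auto simp: cong_iff_dvd_diff zdvd_not_zless)
  have "p mod 4 = 1 \<or> p mod 4 = 3" using \<open>odd p\<close> by presburger
  then show ?thesis
  proof
    assume p: "p mod 4 = 1"
    then have "even ((p - 1) div 2)" by presburger
    then show ?thesis using * ne p by (auto split: if_splits)
  next
    assume p: "p mod 4 = 3"
    then have "odd ((p - 1) div 2)" by presburger
    then show ?thesis using * ne p by (auto split: if_splits)
  qed
qed

text \<open>Thue's pigeonhole argument. With t^2 = -1 modulo p, two of the (k + 1)^2 > p pairs (a,
  b) in [0, k]^2 agree in a - t b modulo p. Their difference (x, y) satisfies p | x^2 + y^2, a
  positive number below 2 p.\<close>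

lemma prime_sum_two_squares:
  assumes "prime p" "p mod 4 = 1"
  obtains a b :: int where "int p = a\<^sup>2 + b\<^sup>2"
proof -
  have "p > 2" using assms prime_ge_2_nat[of p] by (cases "p = 2") auto
  then obtain t where "[t\<^sup>2 = - 1] (mod int p)"
    using QuadRes_minus_one_iff[of p] assms by (auto simp: QuadRes_def)
  then have t: "int p dvd t\<^sup>2 + 1" by (simp add: cong_iff_dvd_diff)
  define k where "k = nat \<lfloor>sqrt (real p)\<rfloor>"
  have k1: "k\<^sup>2 \<le> p"
  proof -
    have "real k \<le> sqrt (real p)" by (simp add: k_def)
    then have "(real k)\<^sup>2 \<le> (sqrt (real p))\<^sup>2" by (intro power_mono) auto
    then show ?thesis by (simp flip: of_nat_power)
  qed
  have k2: "p < (k + 1)\<^sup>2"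
  proof -
    have "sqrt (real p) < real (k + 1)" by (simp add: k_def) linarith
    then have "(sqrt (real p))\<^sup>2 < (real (k + 1))\<^sup>2" by (intro power_strict_mono) auto
    then have "real p < real ((k + 1)\<^sup>2)" by simp
    then show ?thesis by (simp only: of_nat_less_iff)
  qed
  \<comment> \<open>A prime is not a square; the resulting strict inequality k^2 < p is what
    excludes x^2 + y^2 = 2 p.\<close>
  have "k\<^sup>2 \<noteq> p" 
  proof
    assume "k\<^sup>2 = p"
    then have "prime (k ^ 2)" using assms by simp
    then show False by (simp add: prime_power_iff)
  qed
  define f where "f = (\<lambda>(a, b). (a - t * b) mod int p)"
  have "f ` ({0..int k} \<times> {0..int k}) \<subseteq> {0..<int p}"
    using \<open>p > 2\<close> by (auto simp: f_def)
  then have "card (f ` ({0..int k} \<times> {0..int k})) \<le> card {0..<int p}"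
    by (intro card_mono) auto
  also have "\<dots> < card ({0..int k} \<times> {0..int k})"
    using k2 by (simp add: power2_eq_square nat_add_distrib)
  finally have "\<not> inj_on f ({0..int k} \<times> {0..int k})"
    by (rule pigeonhole)
  then obtain a b a' b' where ab: "a \<in> {0..int k}" "b \<in> {0..int k}" "a' \<in> {0..int k}" "b' \<in> {0..int k}"
    "f (a, b) = f (a', b')" "(a, b) \<noteq> (a', b')"
    by (auto simp: inj_on_def)
  define x y where "x = a - a'" and "y = b - b'"
  have "int p dvd x - t * y"
    using ab(5) unfolding f_def x_def y_def by (simp add: mod_eq_dvd_iff algebra_simps)
  then have "int p dvd (x - t * y) * (x + t * y) + (t\<^sup>2 + 1) * y\<^sup>2" using t by simp
  also have "(x - t * y) * (x + t * y) + (t\<^sup>2 + 1) * y\<^sup>2 = x\<^sup>2 + y\<^sup>2" by (simp add: power2_eq_square algebra_simps)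
  finally obtain q where q: "x\<^sup>2 + y\<^sup>2 = int p * q" by (auto elim: dvdE)
  have "\<bar>x\<bar> \<le> int k" "\<bar>y\<bar> \<le> int k" using ab by (auto simp: x_def y_def)
  then have "x\<^sup>2 \<le> (int k)\<^sup>2" "y\<^sup>2 \<le> (int k)\<^sup>2" by (simp_all add: abs_le_square_iff[symmetric])
  moreover have "(int k)\<^sup>2 < int p" using k1 \<open>k\<^sup>2 \<noteq> p\<close> by (metis le_neq_implies_less of_nat_less_iff of_nat_power)
  ultimately have "int p * q < int p * 2" using q by linarith
  then have "q < 2" using \<open>p > 2\<close> by simp
  have "x \<noteq> 0 \<or> y \<noteq> 0" using ab(6) by (auto simp: x_def y_def)
  then have "x\<^sup>2 + y\<^sup>2 > 0" by (metis sum_power2_gt_zero_iff)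
  then have "0 < int p * q" using q by simp
  then have "0 < q" using \<open>p > 2\<close> by (simp add: zero_less_mult_iff)
  with \<open>q < 2\<close> q show ?thesis using that[of x y] by simp
qed

text \<open>The two pairs are the products of the Gaussian integer x + i y with a + i b and a - i b.
  A prime dividing both components of one product divides x p and y p, hence is p. If both products
  failed to be primitive, adding components would give p | 2 x a and p | 2 y a, although p divides
  neither 2 nor a.\<close>

lemma coprime_brahmagupta:
  fixes x y a b p :: int
  assumes "prime p" "odd p" "p = a\<^sup>2 + b\<^sup>2" "coprime x y"
  shows "coprime (x * a - y * b) (x * b + y * a) \<or> coprime (x * a + y * b) (x * b - y * a)"
proof -
  have dv: "p dvd x * a' - y * b' \<and> p dvd x * b' + y * a'"
    if "\<not> coprime (x * a' - y * b') (x * b' + y * a')" "p = a'\<^sup>2 + b'\<^sup>2" for a' b'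
  proof -
    let ?g = "gcd (x * a' - y * b') (x * b' + y * a')"
    have "?g \<noteq> 0"
    proof
      assume "?g = 0"
      then have z: "x * a' - y * b' = 0" "x * b' + y * a' = 0" by auto
      have "a' * (x * a' - y * b') + b' * (x * b' + y * a') = x * p"
        "a' * (x * b' + y * a') - b' * (x * a' - y * b') = y * p"
        unfolding that(2) by (simp_all add: power2_eq_square algebra_simps)
      then have "x = 0" "y = 0" using z \<open>prime p\<close> by auto
      then show False using \<open>coprime x y\<close> by simp
    qed
    moreover have "\<not> is_unit ?g" using that(1) unfolding is_unit_gcd .
    ultimately obtain q where q: "prime q" "q dvd ?g"
      using prime_divisor_exists by blast
    note q' = dvd_trans[OF q(2) gcd_dvd1] dvd_trans[OF q(2) gcd_dvd2]
    \<comment> \<open>Multiplying by the conjugate of a' + i b' recovers p times x + i y.\<close>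
    have "a' * (x * a' - y * b') + b' * (x * b' + y * a') = x * p"
      "a' * (x * b' + y * a') - b' * (x * a' - y * b') = y * p"
      unfolding that(2) by (simp_all add: power2_eq_square algebra_simps)
    then have "q dvd x * p" "q dvd y * p"
      using dvd_add[OF dvd_mult[OF q'(1), of a'] dvd_mult[OF q'(2), of b']]
        dvd_diff[OF dvd_mult[OF q'(2), of a'] dvd_mult[OF q'(1), of b']] by simp_all
    moreover have "\<not> (q dvd x \<and> q dvd y)" 
      using coprime_common_divisor[OF \<open>coprime x y\<close>] not_prime_unit q(1) by blast
    ultimately have "q dvd p" using q(1) by (auto simp: prime_dvd_mult_iff)
    then have "q = p" using primes_dvd_imp_eq[OF q(1) \<open>prime p\<close>] by blast
    then show ?thesis using q' by simp
  qed
  show ?thesis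
  proof (rule ccontr)
    assume neg: "\<not> ?thesis"
    then have 1: "p dvd x * a - y * b" "p dvd x * b + y * a" using dv[of a b, OF _ assms(3)] by blast+
    have "\<not> coprime (x * a - y * (- b)) (x * (- b) + y * a)"
    proof
      assume "coprime (x * a - y * (- b)) (x * (- b) + y * a)"
      moreover have "x * (- b) + y * a = - (x * b - y * a)" "x * a - y * (- b) = x * a + y * b" by simp_all
      ultimately show False using neg by (simp only: coprime_minus_right_iff) simp
    qed
    then have 2: "p dvd x * a + y * b" "p dvd x * (- b) + y * a" using dv[of a "-b"] by (simp_all add: assms(3)[symmetric])
    have "p dvd 2 * x * a" using dvd_add[OF 1(1) 2(1)] by (simp add: algebra_simps)
    moreover have "p dvd 2 * y * a" using dvd_add[OF 1(2) 2(2)] by (simp add: algebra_simps)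
    moreover have "\<not> p dvd 2" using primes_dvd_imp_eq[of p 2] assms(1,2) by auto
    \<comment> \<open>If p divided a, it would divide b as well, and then p^2 would divide a^2 + b^2
      = p.\<close>
    moreover have "\<not> p dvd a"
    proof
      assume "p dvd a"
      moreover from this have "p dvd p - a\<^sup>2" by (simp add: power2_eq_square)
      then have "p dvd b\<^sup>2" using assms(3) by simp
      then have "p dvd b" using \<open>prime p\<close> prime_dvd_power by blast
      ultimately have "p * p dvd a\<^sup>2 + b\<^sup>2" by (simp add: power2_eq_square mult_dvd_mono)
      then have "p * p dvd p * 1" using assms(3) by simp
      then have "p dvd 1" using \<open>prime p\<close>
        by (subst (asm) dvd_times_left_cancel_iff) auto
      then show False using \<open>prime p\<close> not_prime_unit by blast
    qed
    ultimately have "p dvd x" "p dvd y" using \<open>prime p\<close> by (auto simp: prime_dvd_mult_iff)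
    then show False 
      using coprime_common_divisor[OF \<open>coprime x y\<close>] not_prime_unit \<open>prime p\<close> by blast
  qed
qed

text \<open>Induction that removes one prime factor; of the two Gaussian products with a
  representation of that prime, one is primitive.\<close>

lemma coprime_two_squares_exist:
  fixes n :: nat
  assumes "n > 0" "\<And>p. prime p \<Longrightarrow> p dvd n \<Longrightarrow> p mod 4 = 1"
  shows "\<exists>x y :: int. coprime x y \<and> int n = x\<^sup>2 + y\<^sup>2"
  using assms
proof (induction n rule: less_induct)
  case (less n)
  show ?case
  proof (cases "n = 1")
    case True
    then show ?thesis by (intro exI[of _ 1] exI[of _ 0]) auto
  next
    case False
    then obtain p where p: "prime p" "p dvd n" using prime_factor_nat by blast
    then obtain m where m: "n = p * m" by (auto elim: dvdE)
    have p4: "p mod 4 = 1" using less.prems p by blast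
    have "m > 0" "m < n" using m less.prems p prime_gt_1_nat[of p] by (auto intro: gr0I)
    then obtain x y :: int where xy: "coprime x y" "int m = x\<^sup>2 + y\<^sup>2"
      using less.IH[of m] less.prems m by auto
    obtain a b where ab: "int p = a\<^sup>2 + b\<^sup>2" using prime_sum_two_squares[OF p(1) p4] by blast
    have "odd (int p)" using p4 by presburger
    then have "coprime (x * a - y * b) (x * b + y * a) \<or> coprime (x * a + y * b) (x * b - y * a)"
      by (intro coprime_brahmagupta[OF _ _ ab xy(1)]) (use p in simp_all)
    moreover have "int n = (x * a - y * b)\<^sup>2 + (x * b + y * a)\<^sup>2" "int n = (x * a + y * b)\<^sup>2 + (x * b - y * a)\<^sup>2"
      unfolding m of_nat_mult ab xy by (simp_all add: power2_eq_square algebra_simps)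
    ultimately show ?thesis by blast
  qed
qed

text \<open>Turns the set into a sifted set. If a prime p = 3 modulo 4 divided x^2 + y^2 with x, y
  coprime, then x / y would be a square root of -1 modulo p.\<close>

lemma mem_coprime_square_sums_iff:
  "n \<in> coprime_square_sums \<longleftrightarrow> odd n \<and> (\<forall>p. prime p \<longrightarrow> p dvd n \<longrightarrow> p mod 4 \<noteq> 3)"
proof safe
  assume "n \<in> coprime_square_sums"
  then obtain x y where xy: "odd n" "coprime x y" "n = x\<^sup>2 + y\<^sup>2" by (auto simp: coprime_square_sums_def)
  show "even n \<Longrightarrow> False" using xy by simp
  fix p assume p: "prime p" "p dvd n" "p mod 4 = 3"
  have "p > 2" using p prime_ge_2_nat[of p] by (cases "p = 2") auto
  have "\<not> p dvd y"
  proof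
    assume "p dvd y"
    then have "p dvd x\<^sup>2" using p(2) unfolding xy(3) by (simp add: power2_eq_square dvd_add_left_iff)
    then have "p dvd x" using p(1) prime_dvd_power by blast
    then show False using \<open>p dvd y\<close> xy p(1) by (metis coprime_common_divisor not_prime_unit)
  qed
  then have "coprime (int y) (int p)" using p(1) by (simp add: prime_imp_coprime coprime_commute)
  then obtain z where z: "[int y * z = 1] (mod int p)" using cong_solve_coprime_int by blast
  have "[(int x * z)\<^sup>2 + 1 = (int x * z)\<^sup>2 + (int y * z)\<^sup>2] (mod int p)"
    using cong_pow[OF z, of 2] by (intro cong_add cong_refl) (simp add: cong_sym)
  also have "(int x * z)\<^sup>2 + (int y * z)\<^sup>2 = int n * z\<^sup>2" unfolding xy(3) by (simp add: power_mult_distrib algebra_simps)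
  also have "[int n * z\<^sup>2 = 0] (mod int p)" using p(2) by (simp add: cong_0_iff)
  finally have "[(int x * z)\<^sup>2 = - 1] (mod int p)" by (simp add: cong_iff_dvd_diff)
  then have "QuadRes (int p) (- 1)" by (auto simp: QuadRes_def)
  then show False using QuadRes_minus_one_iff[of p] p \<open>p > 2\<close> by simp
next
  assume n: "odd n" "\<forall>p. prime p \<longrightarrow> p dvd n \<longrightarrow> p mod 4 \<noteq> 3"
  have "p mod 4 = 1" if "prime p" "p dvd n" for p
  proof -
    have "odd p" using that n(1) by auto
    then have "p mod 4 = 1 \<or> p mod 4 = 3" by presburger
    then show ?thesis using n(2) that by auto
  qed
  then obtain x y :: int where xy: "coprime x y" "int n = x\<^sup>2 + y\<^sup>2"
    using coprime_two_squares_exist[of n] n(1) by (auto simp: odd_pos)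
  have "int n = int ((nat \<bar>x\<bar>)\<^sup>2 + (nat \<bar>y\<bar>)\<^sup>2)" unfolding xy by simp
  then have "n = (nat \<bar>x\<bar>)\<^sup>2 + (nat \<bar>y\<bar>)\<^sup>2" by (simp only: of_nat_eq_iff)
  moreover have "coprime (nat \<bar>x\<bar>) (nat \<bar>y\<bar>)" using xy(1) by simp
  ultimately show "n \<in> coprime_square_sums" using n(1) unfolding coprime_square_sums_def by blast
qed

lemma coprime_square_sums_mod_4: "n \<in> coprime_square_sums \<Longrightarrow> n mod 4 = 1"
proof -
  assume "n \<in> coprime_square_sums"
  then obtain x y where n: "odd n" "n = x\<^sup>2 + y\<^sup>2" by (auto simp: coprime_square_sums_def)
  have sq: "z\<^sup>2 mod 4 = (if even z then 0 else 1)" for z :: nat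
  proof (cases "even z")
    case True
    then show ?thesis by (auto elim!: evenE simp: power2_eq_square)
  next
    case False
    then obtain k where "z = 2 * k + 1" by (auto elim: oddE)
    then have "z\<^sup>2 = 4 * (k * k + k) + 1" by (simp add: power2_eq_square)
    then show ?thesis using False by (simp only: if_False) presburger
  qed
  have "even x \<noteq> even y" using n by auto
  then show ?thesis unfolding n(2) mod_add_eq[of "x\<^sup>2" 4, symmetric] sq by auto
qed

section \<open>Lower bound for the counting function by a second moment\<close>

lemma sum_odd_inverse_squares_le: "(\<Sum>k=1..r. 1 / (real (2 * k + 1))\<^sup>2) \<le> 1 / 4"
proof -
  have "(\<Sum>k=1..r. 1 / (real (2 * k + 1))\<^sup>2) \<le> 1 / 4 - 1 / (4 * (real r + 1))"
  proof (induction r)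
    case (Suc r)
    \<comment> \<open>With k = r + 1 this is (2 k + 1)^2 >= 4 k (k + 1), which makes the sum
      telescope.\<close>
    have "1 / (real (2 * Suc r + 1))\<^sup>2 \<le> 1 / (4 * (real r + 1) * (real r + 2))"
    proof (rule divide_left_mono)
      show "4 * (real r + 1) * (real r + 2) \<le> (real (2 * Suc r + 1))\<^sup>2"
        by (simp add: power2_eq_square algebra_simps)
    qed auto
    also have "\<dots> = 1 / (4 * (real r + 1)) - 1 / (4 * (real r + 2))"
      by (simp add: divide_simps)
    finally show ?case using Suc by (simp add: add.commute)
  qed simp
  also have "\<dots> \<le> 1 / 4" by simp
  finally show ?thesis .
qed

text \<open>Union bound over the common divisor, which is odd: for g = 2 k + 1 >= 3 at most 2 r^2 /
  g^2 of the r^2 pairs are lost. The bound 1/4 for the sum of 1 / g^2 leaves at least half of the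
  pairs.\<close>

lemma card_coprime_even_odd_pairs_ge:
  "real r ^ 2 / 2 \<le> real (card {(x, y). x \<in> {1..2*r} \<and> y \<in> {1..2*r} \<and> even x \<and> odd y \<and> coprime x y})"
proof -
  define A where "A = (\<lambda>(i, j). (2 * i, 2 * j - 1)) ` ({1..r} \<times> {1..r})"
  define good where "good = {(x, y). x \<in> {1..2*r} \<and> y \<in> {1..2*r} \<and> even x \<and> odd y \<and> coprime x y}"
  \<comment> \<open>The second component runs over all multiples of 2 k + 1 up to 2 r, not only the
    odd ones; the factor 2 lost here is affordable.\<close>
  define Bad where "Bad k = (\<lambda>(i, j). (2 * (2 * k + 1) * i, (2 * k + 1) * j)) ` 
     ({1..r div (2 * k + 1)} \<times> {1..2 * r div (2 * k + 1)})" for k :: nat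
  have "inj_on (\<lambda>(i::nat, j::nat). (2 * i, 2 * j - 1)) ({1..r} \<times> {1..r})"
    by (auto simp: inj_on_def)
  then have cardA: "card A = r * r" unfolding A_def by (simp add: card_image)
  have "A \<subseteq> good \<union> (\<Union>k\<in>{1..r}. Bad k)"
  proof
    fix z assume "z \<in> A"
    then obtain i j where ij: "z = (2 * i, 2 * j - 1)" "i \<in> {1..r}" "j \<in> {1..r}" by (auto simp: A_def)
    show "z \<in> good \<union> (\<Union>k\<in>{1..r}. Bad k)"
    proof (cases "coprime (2 * i) (2 * j - 1)")
      case True
      then show ?thesis using ij by (auto simp: good_def)
    next
      case False
      define g where "g = gcd (2 * i) (2 * j - 1)"
      have g: "g dvd 2 * i" "g dvd 2 * j - 1" by (auto simp: g_def)
      have "odd (2 * j - 1)" using ij by auto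
      then have "odd g" using g(2) dvd_trans by blast
      moreover have "g \<noteq> 1" using False unfolding g_def coprime_iff_gcd_eq_1 .
      moreover obtain k where k: "g = 2 * k + 1" using \<open>odd g\<close> by (auto elim: oddE)
      ultimately have k1: "k \<ge> 1" by (cases k) auto
      have "coprime g 2" using \<open>odd g\<close> by simp
      then have "g dvd i" using g(1) coprime_dvd_mult_right_iff by blast
      then obtain a where a: "i = g * a" by (auto elim: dvdE)
      obtain b where b: "2 * j - 1 = g * b" using g(2) by (auto elim: dvdE)
      have "a \<ge> 1" using a ij by (cases a) auto
      have "b \<ge> 1" using b \<open>odd (2 * j - 1)\<close> by (cases b) auto
      have "a \<le> r div g" using a ij k by (simp add: less_eq_div_iff_mult_less_eq mult.commute)
      moreover have "b \<le> 2 * r div g"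
      proof -
        have "g * b \<le> 2 * r" using b ij by auto
        then show ?thesis using k by (simp add: less_eq_div_iff_mult_less_eq mult.commute)
      qed
      moreover have "k \<le> r"
      proof -
        have "g \<le> i" using a ij by auto
        then show ?thesis using k ij by auto
      qed
      ultimately have "z \<in> Bad k"
        unfolding Bad_def using \<open>a \<ge> 1\<close> \<open>b \<ge> 1\<close> ij(1) a b k by (auto intro!: image_eqI[of _ _ "(a, b)"])
      then show ?thesis using k1 \<open>k \<le> r\<close> by auto
    qed
  qed
  moreover have fin: "finite good" by (rule finite_subset[of _ "{1..2*r} \<times> {1..2*r}"]) (auto simp: good_def)
  moreover have finB: "finite (Bad k)" for k by (simp add: Bad_def)
  ultimately have "card A \<le> card (good \<union> (\<Union>k\<in>{1..r}. Bad k))" by (intro card_mono) auto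
  also have "\<dots> \<le> card good + card (\<Union>k\<in>{1..r}. Bad k)" by (rule card_Un_le)
  also have "\<dots> \<le> card good + (\<Sum>k=1..r. card (Bad k))" by (intro add_left_mono card_UN_le) auto
  finally have "real (r * r) \<le> real (card good) + (\<Sum>k=1..r. real (card (Bad k)))"
    unfolding cardA by (metis of_nat_add of_nat_le_iff of_nat_sum)
  also have "(\<Sum>k=1..r. real (card (Bad k))) \<le> (\<Sum>k=1..r. 2 * real r ^ 2 * (1 / (real (2 * k + 1))\<^sup>2))"
  proof (rule sum_mono)
    fix k
    have "card (Bad k) \<le> card ({1..r div (2 * k + 1)} \<times> {1..2 * r div (2 * k + 1)})"
      unfolding Bad_def by (rule card_image_le) auto
    also have "\<dots> = (r div (2 * k + 1)) * (2 * r div (2 * k + 1))" by (simp add: card_cartesian_product)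
    finally have "real (card (Bad k)) \<le> real (r div (2 * k + 1)) * real (2 * r div (2 * k + 1))"
      by (metis of_nat_le_iff of_nat_mult)
    also have "\<dots> \<le> (real r / real (2 * k + 1)) * (real (2 * r) / real (2 * k + 1))"
      by (intro mult_mono of_nat_div_le_of_nat) auto
    finally show "real (card (Bad k)) \<le> 2 * real r ^ 2 * (1 / (real (2 * k + 1))\<^sup>2)"
      by (simp add: power2_eq_square mult_ac)
  qed
  also have "\<dots> = 2 * real r ^ 2 * (\<Sum>k=1..r. 1 / (real (2 * k + 1))\<^sup>2)" by (simp only: sum_distrib_left)
  also have "\<dots> \<le> 2 * real r ^ 2 * (1 / 4)"
    by (intro mult_left_mono sum_odd_inverse_squares_le) auto
  finally show ?thesis by (simp add: good_def power2_eq_square)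
qed

text \<open>As (v - y) (v + y) = m, the divisor v + y of m determines v - y and hence the
  pair.\<close>

lemma card_difference_of_squares_le:
  fixes m :: nat
  assumes "m > 0"
  shows "finite {(y, v). v\<^sup>2 = y\<^sup>2 + m}" "card {(y, v). v\<^sup>2 = y\<^sup>2 + m} \<le> card {d. d dvd m}"
proof -
  have fac: "y < v \<and> (v - y) * (v + y) = m" if "v\<^sup>2 = y\<^sup>2 + m" for y v :: nat
  proof -
    have "y\<^sup>2 < v\<^sup>2" using that assms by simp
    then have "y < v" by (simp add: power2_less_imp_less)
    then obtain e where "v = y + e" by (metis less_imp_add_positive)
    then show ?thesis using that \<open>y < v\<close> by (simp add: power2_eq_square algebra_simps)
  qed
  let ?f = "\<lambda>(y, v). v + y"
  have inj: "inj_on ?f {(y, v). v\<^sup>2 = y\<^sup>2 + m}"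
  proof (rule inj_onI, clarify)
    fix y v y' v' :: nat
    assume a: "v\<^sup>2 = y\<^sup>2 + m" "v'\<^sup>2 = y'\<^sup>2 + m" "v + y = v' + y'"
    have "(v - y) * (v + y) = (v' - y') * (v + y)" using fac[OF a(1)] fac[OF a(2)] a(3) by simp
    then have "v - y = v' - y'" using fac[OF a(1)] by auto
    then show "y = y' \<and> v = v'" using a(3) fac[OF a(1)] fac[OF a(2)] by linarith
  qed
  have sub: "?f ` {(y, v). v\<^sup>2 = y\<^sup>2 + m} \<subseteq> {d. d dvd m}"
    using fac by fastforce
  have fin: "finite {d. d dvd m}" using assms by simp
  show "finite {(y, v). v\<^sup>2 = y\<^sup>2 + m}"
    using inj sub fin by (meson finite_imageD finite_subset)
  show "card {(y, v). v\<^sup>2 = y\<^sup>2 + m} \<le> card {d. d dvd m}"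
    using card_inj_on_le[OF inj sub fin] .
qed

text \<open>Second moment: coincidences \<open>x\<^sup>2 + y\<^sup>2 = u\<^sup>2 + v\<^sup>2\<close> with \<open>x \<noteq> u\<close> correspond to factorisations of
  \<open>x\<^sup>2 - u\<^sup>2\<close>.\<close>

lemma coprime_square_sums_count_ge_aux:
  fixes r D :: nat
  assumes D: "\<And>m. m > 0 \<Longrightarrow> m \<le> 4 * r\<^sup>2 \<Longrightarrow> card {d. d dvd m} \<le> D" and "r > 0"
  shows "real r ^ 2 / (4 * (real D + 1)) \<le> real (card {b \<in> coprime_square_sums. b \<le> 8 * r\<^sup>2})"
proof -
  define good where "good = {(x, y). x \<in> {1..2*r} \<and> y \<in> {1..2*r} \<and> even x \<and> odd y \<and> coprime x y}"
  define f :: "nat \<times> nat \<Rightarrow> nat" where "f = (\<lambda>(x, y). x\<^sup>2 + y\<^sup>2)"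
  define X where "X = (\<lambda>i. 2 * i) ` {1..r}"
  have fin: "finite good" by (rule finite_subset[of _ "{1..2*r} \<times> {1..2*r}"]) (auto simp: good_def)
  \<comment> \<open>\<open>c n\<close> counts the representations of n by good pairs: its sum is
    large, its sum of squares is small, so many n are represented.\<close>
  define c where "c n = card {z \<in> good. f z = n}" for n
  have sumc: "(\<Sum>n\<in>f ` good. c n) = card good"
    unfolding c_def using sum.image_gen[OF fin, of "\<lambda>_. 1::nat" f] by simp
  define FF where "FF x u = {(y, v). y \<in> {1..2*r} \<and> odd y \<and> v \<in> {1..2*r} \<and> odd v \<and> x\<^sup>2 + y\<^sup>2 = u\<^sup>2 + v\<^sup>2}" for x u
  have finFF: "finite (FF x u)" for x u
    by (rule finite_subset[of _ "{1..2*r} \<times> {1..2*r}"]) (auto simp: FF_def)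
  \<comment> \<open>The sum of squares counts pairs of representations of one number, here sorted by
    their even components x and u. If x = u, then y = v is one of r odd numbers; otherwise the
    difference of v^2 and y^2 is fixed and nonzero, which leaves at most \<open>D\<close>
    possibilities.\<close>
  have sumc2: "(\<Sum>n\<in>f ` good. c n ^ 2) \<le> r * r * (D + 1)"
  proof -
    have "(\<Sum>n\<in>f ` good. c n ^ 2) = (\<Sum>n\<in>f ` good. \<Sum>z\<in>{z \<in> good. f z = n}. c (f z))"
      by (intro sum.cong refl) (simp add: c_def power2_eq_square)
    also have "\<dots> = (\<Sum>z\<in>good. c (f z))" using sum.image_gen[OF fin, of "\<lambda>z. c (f z)" f] by simp
    also have "\<dots> = card (SIGMA z:good. {z' \<in> good. f z' = f z})"
      using fin by (simp add: c_def)
    also have "\<dots> \<le> card (\<Union>(x, u)\<in>X \<times> X. (\<lambda>(y, v). ((x, y), (u, v))) ` 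
        FF x u)"
    proof (rule card_mono)
      show "finite (\<Union>(x, u)\<in>X \<times> X. (\<lambda>(y, v). ((x, y), (u, v))) ` 
        FF x u)"
        unfolding case_prod_unfold by (intro finite_UN_I finite_imageI finFF) (simp add: X_def)
      show "(SIGMA z:good. {z' \<in> good. f z' = f z}) \<subseteq> (\<Union>(x, u)\<in>X \<times> X. (\<lambda>(y, v). ((x, y), (u, v))) ` 
        FF x u)"
      proof clarify
        fix x y u v assume a: "(x, y) \<in> good" "(u, v) \<in> good" "f (u, v) = f (x, y)"
        have ex: "x \<in> X" if "even x" "x \<in> {1..2*r}" for x
          using that unfolding X_def by (intro image_eqI[of _ _ "x div 2"]) auto
        have "(x, u) \<in> X \<times> X" using a ex by (auto simp: good_def)
        then show "((x, y), u, v) \<in> (\<Union>(x, u)\<in>X \<times> X. (\<lambda>(y, v). ((x, y), (u, v))) ` 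
        FF x u)"
          using a by (intro UN_I[of "(x, u)"]) (auto simp: good_def f_def FF_def)
      qed
    qed
    also have "\<dots> \<le> (\<Sum>(x, u)\<in>X \<times> X. card ((\<lambda>(y, v). ((x, y), (u, v))) ` 
        FF x u))"
      unfolding case_prod_unfold by (rule card_UN_le) (simp add: X_def)
    also have "\<dots> \<le> (\<Sum>(x, u)\<in>X \<times> X. if x = u then r else D)"
    proof (rule sum_mono, clarify)
      fix x u assume xu: "x \<in> X" "u \<in> X"
      define F where "F = FF x u"
      have finF: "finite F" by (simp add: F_def finFF)
      have le: "x \<le> 2 * r" "u \<le> 2 * r" using xu by (auto simp: X_def)
      have sq: "x\<^sup>2 \<le> 4 * r\<^sup>2" "u\<^sup>2 \<le> 4 * r\<^sup>2"
        using power_mono[OF le(1), of 2] power_mono[OF le(2), of 2] by (simp_all add: power_mult_distrib)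
      consider "x = u" | "x < u" | "u < x" by linarith
      then have "card F \<le> (if x = u then r else D)"
      proof cases
        case 1
        then have "F \<subseteq> (\<lambda>i. (2 * i - 1, 2 * i - 1)) ` {1..r}"
        proof (intro subsetI, clarify)
          fix y v assume "(y, v) \<in> F"
          then have yv: "y = v" "odd v" "v \<le> 2 * r" using 1 by (auto simp: F_def FF_def)
          then obtain i where "v = 2 * i + 1" by (auto elim: oddE)
          then show "(y, v) \<in> (\<lambda>i. (2 * i - 1, 2 * i - 1)) ` {1..r}"
            using yv by (auto intro!: image_eqI[of _ _ "i + 1"])
        qed
        then have "card F \<le> card {1..r}" by (intro surj_card_le) auto
        then show ?thesis using 1 by simp
      next
        case 2
        then have pos: "u\<^sup>2 - x\<^sup>2 > 0" by (simp add: power_strict_mono)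
        have "F \<subseteq> (\<lambda>(v, y). (y, v)) ` {(v, y). y\<^sup>2 = v\<^sup>2 + (u\<^sup>2 - x\<^sup>2)}"
          using 2 power_strict_mono[OF 2, of 2] by (fastforce simp: F_def FF_def)
        then have "card F \<le> card {(v, y). y\<^sup>2 = v\<^sup>2 + (u\<^sup>2 - x\<^sup>2)}"
          by (intro surj_card_le card_difference_of_squares_le(1)[OF pos])
        also have "\<dots> \<le> D"
          using card_difference_of_squares_le(2)[OF pos] D[OF pos] sq by (meson diff_le_self le_trans)
        finally show ?thesis using 2 by simp
      next
        case 3
        then have pos: "x\<^sup>2 - u\<^sup>2 > 0" by (simp add: power_strict_mono)
        have "F \<subseteq> {(y, v). v\<^sup>2 = y\<^sup>2 + (x\<^sup>2 - u\<^sup>2)}"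
          using 3 power_strict_mono[OF 3, of 2] by (fastforce simp: F_def FF_def)
        then have "card F \<le> card {(y, v). v\<^sup>2 = y\<^sup>2 + (x\<^sup>2 - u\<^sup>2)}"
          by (intro card_mono card_difference_of_squares_le(1)[OF pos])
        also have "\<dots> \<le> D"
          using card_difference_of_squares_le(2)[OF pos] D[OF pos] sq by (meson diff_le_self le_trans)
        finally show ?thesis using 3 by simp
      qed
      then show "card ((\<lambda>(y, v). ((x, y), u, v)) ` 
        FF x u) \<le> (if x = u then r else D)"
        unfolding F_def[symmetric] using card_image_le[OF finF, of "\<lambda>(y, v). ((x, y), u, v)"] by linarith
    qed
    also have "\<dots> = (\<Sum>x\<in>X. \<Sum>u\<in>X. if x = u then r else D)" by (simp add: sum.cartesian_product)
    also have "\<dots> \<le> (\<Sum>x\<in>X. \<Sum>u\<in>X. (if x = u then r else 0) + D)" by (intro sum_mono) auto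
    also have "\<dots> = r * r * (D + 1)"
    proof -
      have "card X = r" "finite X" by (auto simp: X_def card_image inj_on_def)
      then show ?thesis by (simp add: sum.distrib algebra_simps)
    qed
    finally show ?thesis .
  qed
  have "f ` good \<subseteq> {b \<in> coprime_square_sums. b \<le> 8 * r\<^sup>2}"
  proof (intro subsetI, clarify)
    fix x y assume xy: "(x, y) \<in> good"
    have "x \<le> 2 * r" "y \<le> 2 * r" using xy by (auto simp: good_def)
    then have "x\<^sup>2 \<le> (2 * r)\<^sup>2" "y\<^sup>2 \<le> (2 * r)\<^sup>2" by (simp_all only: power_mono zero_le)
    then have "f (x, y) \<le> 8 * r\<^sup>2" by (simp add: f_def power_mult_distrib)
    moreover have "f (x, y) \<in> coprime_square_sums"
      using xy by (auto simp: good_def f_def coprime_square_sums_def)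
    ultimately show "f (x, y) \<in> coprime_square_sums \<and> f (x, y) \<le> 8 * r\<^sup>2" by simp
  qed
  then have le: "card (f ` good) \<le> card {b \<in> coprime_square_sums. b \<le> 8 * r\<^sup>2}"
    by (intro card_mono) auto
  \<comment> \<open>Cauchy's inequality compares the first moment with the second moment and the
    number of represented values.\<close>
  have "(real r ^ 2 / 2)\<^sup>2 \<le> (real (card good))\<^sup>2"
    using card_coprime_even_odd_pairs_ge[of r] by (intro power_mono) (auto simp: good_def)
  also have "\<dots> = (\<Sum>n\<in>f ` good. real (c n))\<^sup>2" unfolding sumc[symmetric] by simp
  also have "\<dots> \<le> (\<Sum>n\<in>f ` good. (real (c n))\<^sup>2) * real (card (f ` good))"
    by (rule sum_squared_le_sum_of_squares)
  also have "\<dots> = real (\<Sum>n\<in>f ` good. c n ^ 2) * real (card (f ` good))" by simp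
  also have "\<dots> \<le> real (r * r * (D + 1)) * real (card {b \<in> coprime_square_sums. b \<le> 8 * r\<^sup>2})"
    using sumc2 le by (intro mult_mono) (simp_all only: of_nat_le_iff of_nat_0_le_iff)
  finally have "real r ^ 2 * (real r ^ 2 / 4) \<le> real r ^ 2 * ((real D + 1) * real (card {b \<in> coprime_square_sums. b \<le> 8 * r\<^sup>2}))"
    by (simp add: power2_eq_square algebra_simps)
  then have "real r ^ 2 / 4 \<le> (real D + 1) * real (card {b \<in> coprime_square_sums. b \<le> 8 * r\<^sup>2})"
    using \<open>r > 0\<close> by (subst (asm) mult_le_cancel_left_pos) auto
  then show ?thesis by (simp add: field_simps)
qed

lemma coprime_square_sums_count_ge:
  fixes \<epsilon> :: real
  assumes "\<epsilon> > 0"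
  obtains c where "c > 0" 
    "\<And>N :: nat. N \<ge> 8 \<Longrightarrow> c * real N powr (1 - \<epsilon>) \<le> real (card {b \<in> coprime_square_sums. b \<le> N})"
proof -
  obtain C where C: "C > 0" "\<And>n :: nat. n > 0 \<Longrightarrow> real (card {d. d dvd n}) \<le> C * real n powr \<epsilon>"
    using divisor_bound[OF assms] by blast
  show ?thesis
  \<comment> \<open>128 = 4 * 32: the 4 belongs to the second moment bound and r^2 >= N / 32. The
    summand 1 in C + 1 absorbs that of D + 1.\<close>
  proof (rule that[of "1 / (128 * (C + 1))"])
    show "0 < 1 / (128 * (C + 1))" using C(1) by simp
    fix N :: nat assume N: "N \<ge> 8"
    \<comment> \<open>Chosen so that 8 r^2 <= N. From N >= 8 on the root is at least 1, so that
      rounding down loses at most a factor 2.\<close>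
    define r where "r = nat \<lfloor>sqrt (real N / 8)\<rfloor>"
    define D where "D = nat \<lfloor>C * real N powr \<epsilon>\<rfloor>"
    have s1: "sqrt (real N / 8) \<ge> 1" using N by simp
    then have "real r \<le> sqrt (real N / 8)" "r \<ge> 1" "real r > sqrt (real N / 8) - 1"
      by (auto simp: r_def le_nat_iff le_floor_iff)
    then have r2: "real r \<ge> sqrt (real N / 8) / 2" "r > 0" by auto
    have "real r ^ 2 \<le> (sqrt (real N / 8))\<^sup>2" using \<open>real r \<le> _\<close> by (intro power_mono) auto
    then have "real (8 * r\<^sup>2) \<le> real N" by simp
    then have rN: "8 * r\<^sup>2 \<le> N" by (simp only: of_nat_le_iff)
    have "(sqrt (real N / 8) / 2) ^ 2 \<le> real r ^ 2" using r2(1) by (intro power_mono) auto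
    then have rN': "real N / 32 \<le> real r ^ 2" by (simp add: power_divide)
    have D': "real D \<le> C * real N powr \<epsilon>" using C by (simp add: D_def)
    have "card {d. d dvd m} \<le> D" if "m > 0" "m \<le> 4 * r\<^sup>2" for m
    proof -
      have "m \<le> N" using that rN by linarith
      then have "C * real m powr \<epsilon> \<le> C * real N powr \<epsilon>"
        using C assms by (intro mult_left_mono powr_mono2) auto
      then show ?thesis unfolding D_def using C(2)[OF that(1)] by (simp add: le_nat_iff le_floor_iff)
    qed
    from coprime_square_sums_count_ge_aux[OF this r2(2)]
    have "real r ^ 2 / (4 * (real D + 1)) \<le> real (card {b \<in> coprime_square_sums. b \<le> 8 * r\<^sup>2})" .
    also have "\<dots> \<le> real (card {b \<in> coprime_square_sums. b \<le> N})"
      using rN unfolding of_nat_le_iff by (intro card_mono) auto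
    finally have 1: "real r ^ 2 / (4 * (real D + 1)) \<le> real (card {b \<in> coprime_square_sums. b \<le> N})" .
    have "1 \<le> real N powr \<epsilon>" using N assms by (intro ge_one_powr_ge_zero) auto
    then have "real D + 1 \<le> (C + 1) * real N powr \<epsilon>" using D' by (simp add: algebra_simps)
    then have "real N / 32 / (4 * ((C + 1) * real N powr \<epsilon>)) \<le> real r ^ 2 / (4 * (real D + 1))"
      using rN' by (intro frac_le) auto
    also have "real N / 32 / (4 * ((C + 1) * real N powr \<epsilon>)) = 1 / (128 * (C + 1)) * real N powr (1 - \<epsilon>)"
      using N by (simp add: powr_diff)
    finally show "1 / (128 * (C + 1)) * real N powr (1 - \<epsilon>) \<le> real (card {b \<in> coprime_square_sums. b \<le> N})"
      using 1 by linarith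
  qed
qed

section \<open>Trigonometric approximation of arcs\<close>

lemma geometric_power_coeffs:
  obtains c :: "nat \<Rightarrow> real" where "\<And>s. 0 \<le> c s"
    "\<And>z :: complex. (\<Sum>j<R. z ^ j) ^ k = (\<Sum>s\<le>k*R. of_real (c s) * z ^ s)"
proof -
  have "\<exists>c. (\<forall>s. 0 \<le> c s) \<and> (\<forall>z :: complex. (\<Sum>j<R. z ^ j) ^ k = (\<Sum>s\<le>k*R. of_real (c s) * z ^ s))"
  proof (induction k)
    case 0
    show ?case by (rule exI[of _ "\<lambda>_. 1"]) simp
  next
    case (Suc k)
    then obtain c where c: "\<And>s. 0 \<le> c s"
      "\<And>z :: complex. (\<Sum>j<R. z ^ j) ^ k = (\<Sum>s\<le>k*R. of_real (c s) * z ^ s)" by blast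
    define A where "A = {..<R} \<times> {..k*R}"
    define c' where "c' t = (\<Sum>p\<in>{p \<in> A. fst p + snd p = t}. c (snd p))" for t
    have "(\<Sum>j<R. z ^ j) ^ Suc k = (\<Sum>t\<le>Suc k * R. of_real (c' t) * z ^ t)" for z :: complex
    proof -
      have "(\<Sum>j<R. z ^ j) ^ Suc k = (\<Sum>p\<in>A. of_real (c (snd p)) * z ^ (fst p + snd p))"
        unfolding A_def power_Suc c(2) 
        by (simp add: sum_product sum.cartesian_product case_prod_unfold power_add mult_ac)
      also have "\<dots> = (\<Sum>t\<le>Suc k * R. \<Sum>p\<in>{p \<in> A. fst p + snd p = t}. of_real (c (snd p)) * z ^ (fst p + snd p))"
        by (rule sum.group[symmetric]) (auto simp: A_def)
      also have "\<dots> = (\<Sum>t\<le>Suc k * R. of_real (c' t) * z ^ t)"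
        unfolding c'_def of_real_sum sum_distrib_right by (intro sum.cong) auto
      finally show ?thesis .
    qed
    moreover have "0 \<le> c' t" for t unfolding c'_def by (intro sum_nonneg c(1))
    ultimately show ?case by blast
  qed
  then show ?thesis using that by blast
qed

text \<open>A normalised power of the Fejer kernel; the power \<open>k\<close> makes the tail smaller than any prescribed negative
  power of \<open>R\<close> at distance slightly more than \<open>1/R\<close> from the integers.\<close>

lemma fejer_power_kernel:
  fixes R k :: nat
  assumes "R \<ge> 1"
  obtains J :: "real \<Rightarrow> real" and j :: "int \<Rightarrow> complex"
  where "\<And>x. complex_of_real (J x) = (\<Sum>h\<in>{- int (k*R)..int (k*R)}. j h * expi (of_int h * x))"
    and "\<And>x. 0 \<le> J x" and "j 0 = 1" and "\<And>h. norm (j h) \<le> 1"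
    and "\<And>x \<eta>. 0 < \<eta> \<Longrightarrow> \<eta> \<le> nearest_int_dist x \<Longrightarrow> J x \<le> (real (k * R) + 1) / (2 * \<eta> * real R) ^ (2 * k)"
proof -
  define S where "S = k * R"
  obtain c :: "nat \<Rightarrow> real" where c: "\<And>s. 0 \<le> c s"
    "\<And>z :: complex. (\<Sum>j<R. z ^ j) ^ k = (\<Sum>s\<le>S. of_real (c s) * z ^ s)"
    unfolding S_def using geometric_power_coeffs by blast
  define P where "P x = (\<Sum>j<R. expi x ^ j)" for x
  \<comment> \<open>The constant Fourier coefficient of |P|^(2 k); dividing by it gives
    \<open>J\<close> mean value 1.\<close>
  define M where "M = (\<Sum>s\<le>S. (c s)\<^sup>2)"
  have "complex_of_real (real R ^ k) = complex_of_real (\<Sum>s\<le>S. c s)"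
    using c(2)[of 1] by simp
  then have "real R ^ k = (\<Sum>s\<le>S. c s)" by (simp only: of_real_eq_iff)
  \<comment> \<open>Evaluation at z = 1 gives the sum R^k of the S + 1 coefficients, and Cauchy's
    inequality turns it into a lower bound for \<open>M\<close>, hence into an upper bound for the
    normalised tail.\<close>
  then have "(real R ^ k)\<^sup>2 \<le> M * real (S + 1)"
    unfolding M_def using sum_squared_le_sum_of_squares[of c "{..S}"] by simp
  then have M1: "real R ^ (2 * k) \<le> M * (real S + 1)" by (simp add: power_mult[symmetric] mult.commute add.commute)
  have "1 \<le> real R ^ (2 * k)" using assms by (simp add: one_le_power)
  then have "0 < M * (real S + 1)" using M1 by linarith
  then have M0: "M > 0" by (simp add: zero_less_mult_iff)
  define J where "J x = norm (P x) ^ (2 * k) / M" for x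
  define A where "A = {..S} \<times> {..S}"
  define F where "F h = {p \<in> A. int (fst p) - int (snd p) = h}" for h
  have finF: "finite (F h)" for h by (simp add: F_def A_def)
  define j where "j h = complex_of_real ((\<Sum>p\<in>F h. c (fst p) * c (snd p)) / M)" for h
  show ?thesis
  proof (rule that)
    fix x
    have "complex_of_real (J x) = (P x) ^ k * cnj ((P x) ^ k) / of_real M"
      unfolding J_def complex_norm_square[symmetric] by (simp add: norm_power power_mult[symmetric] mult.commute)
    also have "(P x) ^ k * cnj ((P x) ^ k) = (\<Sum>p\<in>A. of_real (c (fst p)) * of_real (c (snd p)) * expi (of_int (int (fst p) - int (snd p)) * x))"
      unfolding P_def c(2) A_def cnj_sum sum_product sum.cartesian_product case_prod_unfold
    proof (intro sum.cong refl)
      fix p :: "nat \<times> nat"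
      have "expi x ^ fst p * cnj (expi x ^ snd p) = expi (of_int (int (fst p) - int (snd p)) * x)"
        unfolding complex_cnj_power expi_minus[symmetric] expi_power expi_add[symmetric] by (simp add: algebra_simps)
      then show "of_real (c (fst p)) * expi x ^ fst p * cnj (of_real (c (snd p)) * expi x ^ snd p) =
        of_real (c (fst p)) * of_real (c (snd p)) * expi (of_int (int (fst p) - int (snd p)) * x)"
        by (simp add: mult_ac)
    qed
    also have "\<dots> = (\<Sum>h\<in>{- int S..int S}. \<Sum>p\<in>F h. of_real (c (fst p)) * of_real (c (snd p)) * expi (of_int (int (fst p) - int (snd p)) * x))"
      unfolding F_def by (rule sum.group[symmetric]) (auto simp: A_def)
    also have "\<dots> = (\<Sum>h\<in>{- int S..int S}. of_real (\<Sum>p\<in>F h. c (fst p) * c (snd p)) * expi (of_int h * x))"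
      unfolding of_real_sum sum_distrib_right by (intro sum.cong) (auto simp: F_def)
    also have "\<dots> / of_real M = (\<Sum>h\<in>{- int S..int S}. j h * expi (of_int h * x))"
      by (subst sum_divide_distrib) (simp add: j_def del: of_real_sum)
    finally show "complex_of_real (J x) = (\<Sum>h\<in>{- int (k*R)..int (k*R)}. j h * expi (of_int h * x))"
      unfolding S_def .
  next
    show "0 \<le> J x" for x using M0 by (simp add: J_def)
  next
    have "(\<Sum>p\<in>F 0. c (fst p) * c (snd p)) = M"
      unfolding M_def power2_eq_square
      by (rule sum.reindex_bij_witness[of _ "\<lambda>s. (s, s)" fst]) (auto simp: F_def A_def)
    then show "j 0 = 1" using M0 by (simp add: j_def)
  next
    fix h
    \<comment> \<open>For a fixed difference h either component determines the pair. Hence both sums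
      of squares are at most \<open>M\<close>, and by the arithmetic-geometric mean inequality no
      Fourier coefficient exceeds the constant one.\<close>
    have inj: "inj_on fst (F h)" "inj_on snd (F h)"
      by (auto simp: inj_on_def F_def prod_eq_iff)
    have "(\<Sum>p\<in>F h. (c (fst p))\<^sup>2) = (\<Sum>s\<in>fst ` F h. (c s)\<^sup>2)" using inj by (simp add: sum.reindex)
    also have "\<dots> \<le> M" unfolding M_def by (intro sum_mono2) (auto simp: F_def A_def)
    finally have 1: "(\<Sum>p\<in>F h. (c (fst p))\<^sup>2) \<le> M" .
    have "(\<Sum>p\<in>F h. (c (snd p))\<^sup>2) = (\<Sum>s\<in>snd ` F h. (c s)\<^sup>2)" using inj by (simp add: sum.reindex)
    also have "\<dots> \<le> M" unfolding M_def by (intro sum_mono2) (auto simp: F_def A_def)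
    finally have 2: "(\<Sum>p\<in>F h. (c (snd p))\<^sup>2) \<le> M" .
    have "(\<Sum>p\<in>F h. c (fst p) * c (snd p)) \<le> (\<Sum>p\<in>F h. (c (fst p))\<^sup>2 / 2 + (c (snd p))\<^sup>2 / 2)"
    proof (rule sum_mono)
      fix p
      have "0 \<le> (c (fst p) - c (snd p))\<^sup>2" by simp
      then show "c (fst p) * c (snd p) \<le> (c (fst p))\<^sup>2 / 2 + (c (snd p))\<^sup>2 / 2"
        by (simp add: power2_eq_square algebra_simps)
    qed
    also have "\<dots> \<le> M" using 1 2 by (simp add: sum.distrib sum_divide_distrib[symmetric])
    finally have "(\<Sum>p\<in>F h. c (fst p) * c (snd p)) / M \<le> 1" using M0 by simp
    moreover have "0 \<le> (\<Sum>p\<in>F h. c (fst p) * c (snd p)) / M"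
      using M0 c(1) by (intro divide_nonneg_pos sum_nonneg mult_nonneg_nonneg) auto
    ultimately show "norm (j h) \<le> 1" unfolding j_def norm_of_real by simp
  next
    fix x \<eta> :: real assume \<eta>: "0 < \<eta>" "\<eta> \<le> nearest_int_dist x"
    have "norm (P x) \<le> 1 / (2 * nearest_int_dist x)"
      unfolding P_def expi_power using \<eta> by (intro norm_sum_expi_le) auto
    also have "\<dots> \<le> 1 / (2 * \<eta>)" using \<eta> by (intro divide_left_mono) auto
    finally have "norm (P x) ^ (2 * k) \<le> (1 / (2 * \<eta>)) ^ (2 * k)" by (intro power_mono) auto
    moreover have "1 / M \<le> (real S + 1) / real R ^ (2 * k)"
      using M1 M0 assms by (simp add: field_simps)
    ultimately have "norm (P x) ^ (2 * k) * (1 / M) \<le> (1 / (2 * \<eta>)) ^ (2 * k) * ((real S + 1) / real R ^ (2 * k))"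
      using M0 \<eta> by (intro mult_mono) auto
    then show "J x \<le> (real (k * R) + 1) / (2 * \<eta> * real R) ^ (2 * k)"
      unfolding J_def S_def by (simp add: power_mult_distrib power_divide)
  qed
qed

text \<open>A full period of the powers of a Q-th root of unity other than 1.\<close>

lemma sum_expi_complete_residues:
  fixes Q :: nat and h a :: int
  assumes "\<not> int Q dvd h" "Q > 0"
  shows "(\<Sum>q\<in>{a..<a + int Q}. expi (- (of_int h * (of_int q / real Q)))) = 0"
proof -
  define z where "z = expi (- (of_int h / real Q))"
  have "z ^ Q = 1"
    unfolding z_def expi_power using \<open>Q > 0\<close> expi_of_int[of "- h"] by simp
  have "nearest_int_dist (- (of_int h / real Q)) \<noteq> 0"
  proof
    assume "nearest_int_dist (- (of_int h / real Q)) = 0"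
    then obtain l :: int where "\<bar>of_int h / real Q - of_int l\<bar> = 0"
      by (metis nearest_int_dist_attained nearest_int_dist_minus)
    then have "real_of_int h = of_int (l * int Q)" using \<open>Q > 0\<close> by (simp add: field_simps)
    then have "h = l * int Q" by (simp only: of_int_eq_iff)
    then show False using assms by simp
  qed
  then have "0 < nearest_int_dist (- (of_int h / real Q))"
    using nearest_int_dist_nonneg order_less_le by metis
  then have "z \<noteq> 1" using norm_expi_minus_1_ge[of "- (of_int h / real Q)"] by (auto simp: z_def)
  have "(1 - z) * (\<Sum>i<Q. z ^ i) = 1 - z ^ Q" by (simp add: one_diff_power_eq)
  then have 0: "(\<Sum>i<Q. z ^ i) = 0" using \<open>z ^ Q = 1\<close> \<open>z \<noteq> 1\<close> by simp
  have "(\<Sum>q\<in>{a..<a + int Q}. expi (- (of_int h * (of_int q / real Q))))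
      = (\<Sum>i<Q. expi (- (of_int h * (of_int (a + int i) / real Q))))"
    by (rule sum.reindex_bij_witness[of _ "\<lambda>i. a + int i" "\<lambda>q. nat (q - a)"]) auto
  also have "\<dots> = (\<Sum>i<Q. expi (- (of_int h * (of_int a / real Q))) * z ^ i)"
    unfolding z_def expi_power expi_add[symmetric]
    by (intro sum.cong refl) (simp add: algebra_simps add_divide_distrib)
  also have "\<dots> = 0" using 0 by (simp add: sum_distrib_left[symmetric])
  finally show ?thesis .
qed

text \<open>Averaging the kernel over the points \<open>q/Q\<close> of the arc replaces convolution with its indicator function;
  the average over all residues \<open>q\<close> modulo \<open>Q\<close> is exactly 1 because the degree is less than \<open>Q\<close>.\<close>

lemma trigonometric_approximation:
  fixes R k :: nat and w \<eta> :: real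
  assumes "R \<ge> 1" "0 < \<eta>" "0 \<le> w" "w < 1 / 2"
  defines "\<tau> \<equiv> (real (k * R) + 1) / (2 * \<eta> * real R) ^ (2 * k)"
  obtains T :: "real \<Rightarrow> real" and t :: "int \<Rightarrow> complex" and t0 :: real
  where "\<And>x. complex_of_real (T x) = (\<Sum>h\<in>{- int (k*R)..int (k*R)}. t h * expi (of_int h * x))"
    and "\<And>x. 0 \<le> T x" "\<And>x. T x \<le> 1"
    and "\<And>x. w + \<eta> \<le> nearest_int_dist x \<Longrightarrow> T x \<le> \<tau>"
    and "\<And>x. nearest_int_dist x + \<eta> \<le> w \<Longrightarrow> 1 - \<tau> \<le> T x"
    and "t 0 = of_real t0" "0 < t0" "\<bar>t0 - 2 * w\<bar> \<le> \<eta>" "\<And>h. norm (t h) \<le> t0"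
proof -
  define S where "S = k * R"
  obtain J :: "real \<Rightarrow> real" and j :: "int \<Rightarrow> complex" where
    J: "\<And>x. complex_of_real (J x) = (\<Sum>h\<in>{- int S..int S}. j h * expi (of_int h * x))"
    and J0: "\<And>x. 0 \<le> J x" and j0: "j 0 = 1" and j1: "\<And>h. norm (j h) \<le> 1"
    and J\<tau>': "\<And>x \<eta>. 0 < \<eta> \<Longrightarrow> \<eta> \<le> nearest_int_dist x \<Longrightarrow> J x \<le> (real S + 1) / (2 * \<eta> * real R) ^ (2 * k)"
    by (rule fejer_power_kernel[OF assms(1), of k, folded S_def]) (rule that)
  have J\<tau>: "J x \<le> \<tau>" if "\<eta> \<le> nearest_int_dist x" for x
    unfolding \<tau>_def S_def[symmetric] using J\<tau>'[OF assms(2) that] .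
  have \<tau>0: "0 \<le> \<tau>" using assms by (simp add: \<tau>_def)
  \<comment> \<open>Three demands on \<open>Q\<close>: it exceeds the degree, so that no nonzero
    frequency is a multiple of it; 1/Q is below eta, so that the number of sample points is accurate
    enough; and the arc fits into one period.\<close>
  obtain Q :: nat where Q: "real S + 1 / \<eta> + 1 / (1 - 2 * w) < real Q"
    using reals_Archimedean2 by blast
  have "0 < 1 / \<eta>" "0 < 1 / (1 - 2 * w)" using assms by auto
  then have Q1: "S < Q" "1 / \<eta> < real Q" "1 / (1 - 2 * w) < real Q" using Q by linarith+
  then have "Q > 0" by simp
  define w' where "w' = \<lfloor>w * real Q\<rfloor>"
  have w'0: "0 \<le> w'" using assms by (simp add: w'_def)
  have w'1: "of_int w' \<le> w * real Q" "w * real Q < of_int w' + 1" by (auto simp: w'_def)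
  have "1 < (1 - 2 * w) * real Q" using Q1(3) assms by (simp add: field_simps)
  then have "2 * of_int w' + 1 < real Q" using w'1 by (simp add: algebra_simps)
  then have w'2: "2 * w' + 1 < int Q" by linarith
  define A where "A = {- w'..w'}"
  \<comment> \<open>A complete residue system that starts at the left end of the arc, so that it
    contains \<open>A\<close>.\<close>
  define C where "C = {- w'..<- w' + int Q}"
  have AC: "A \<subseteq> C" "finite C" using w'2 by (auto simp: A_def C_def)
  have cardA: "real (card A) = 2 * of_int w' + 1" using w'0 by (simp add: A_def)
  have cardC: "card C = Q" by (simp add: C_def)
  define t0 where "t0 = (2 * of_int w' + 1) / real Q"
  define T where "T x = (\<Sum>q\<in>A. J (x - of_int q / real Q)) / real Q" for x
  define t where "t h = j h * (\<Sum>q\<in>A. expi (- (of_int h * (of_int q / real Q)))) / of_nat Q" for h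
  have shift: "complex_of_real (\<Sum>q\<in>X. J (x - of_int q / real Q)) =
      (\<Sum>h\<in>{- int S..int S}. j h * (\<Sum>q\<in>X. expi (- (of_int h * (of_int q / real Q)))) * expi (of_int h * x))" for X x
  proof -
    have "complex_of_real (\<Sum>q\<in>X. J (x - of_int q / real Q)) =
      (\<Sum>q\<in>X. \<Sum>h\<in>{- int S..int S}. j h * expi (of_int h * (x - of_int q / real Q)))"
      by (simp only: of_real_sum J)
    also have "\<dots> = (\<Sum>h\<in>{- int S..int S}. \<Sum>q\<in>X. j h * expi (of_int h * (x - of_int q / real Q)))"
      by (rule sum.swap)
    also have "\<dots> = (\<Sum>h\<in>{- int S..int S}. j h * (\<Sum>q\<in>X. expi (- (of_int h * (of_int q / real Q)))) * expi (of_int h * x))"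
    proof (intro sum.cong refl)
      fix h
      have "expi (of_int h * (x - of_int q / real Q)) = expi (- (of_int h * (of_int q / real Q))) * expi (of_int h * x)" for q
        unfolding expi_add[symmetric] by (simp add: algebra_simps)
      then show "(\<Sum>q\<in>X. j h * expi (of_int h * (x - of_int q / real Q))) =
          j h * (\<Sum>q\<in>X. expi (- (of_int h * (of_int q / real Q)))) * expi (of_int h * x)"
        by (simp add: sum_distrib_left sum_distrib_right mult.assoc)
    qed
    finally show ?thesis .
  qed
  have full: "(\<Sum>q\<in>C. J (x - of_int q / real Q)) = real Q" for x
  proof -
    have "complex_of_real (\<Sum>q\<in>C. J (x - of_int q / real Q)) = (\<Sum>h\<in>{- int S..int S}. if h = 0 then of_nat Q else 0)"
      unfolding shift
    proof (intro sum.cong refl)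
      fix h assume h: "h \<in> {- int S..int S}"
      show "j h * (\<Sum>q\<in>C. expi (- (of_int h * (of_int q / real Q)))) * expi (of_int h * x) = (if h = 0 then of_nat Q else 0)"
      proof (cases "h = 0")
        case True
        then show ?thesis using j0 cardC by simp
      next
        case False
        then have "\<not> int Q dvd h" using h Q1(1) by (auto dest!: zdvd_imp_le[of _ "\<bar>h\<bar>", simplified])
        then show ?thesis using sum_expi_complete_residues[of Q h "- w'"] \<open>Q > 0\<close> False by (simp add: C_def)
      qed
    qed
    also have "\<dots> = complex_of_real (real Q)" by simp
    finally show ?thesis by (simp only: of_real_eq_iff)
  qed
  show ?thesis
  proof (rule that[of T t t0])
    show "complex_of_real (T x) = (\<Sum>h\<in>{- int (k*R)..int (k*R)}. t h * expi (of_int h * x))" for x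
      unfolding T_def of_real_divide shift t_def S_def[symmetric]
      by (simp add: sum_divide_distrib)
    show "0 \<le> T x" for x unfolding T_def by (intro divide_nonneg_nonneg sum_nonneg J0) auto
    have "(\<Sum>q\<in>A. J (x - of_int q / real Q)) \<le> (\<Sum>q\<in>C. J (x - of_int q / real Q))" for x
      by (intro sum_mono2 AC J0)
    then show "T x \<le> 1" for x unfolding T_def full using \<open>Q > 0\<close> by simp
  next
    fix x assume x: "w + \<eta> \<le> nearest_int_dist x"
    have "(\<Sum>q\<in>A. J (x - of_int q / real Q)) \<le> (\<Sum>q\<in>A. \<tau>)"
    proof (intro sum_mono J\<tau>)
      fix q assume "q \<in> A"
      then have "\<bar>of_int q\<bar> \<le> w * real Q" using w'1 unfolding A_def by auto
      then have "\<bar>of_int q / real Q\<bar> \<le> w" using \<open>Q > 0\<close> by (simp add: abs_divide field_simps)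
      then have "nearest_int_dist (of_int q / real Q) \<le> w"
        using nearest_int_dist_le[of "of_int q / real Q" 0] by simp
      then show "\<eta> \<le> nearest_int_dist (x - of_int q / real Q)"
        using nearest_int_dist_triangle[of x "of_int q / real Q"] x by linarith
    qed
    also have "\<dots> = real (card A) * \<tau>" by simp
    also have "\<dots> \<le> real Q * \<tau>" using cardC AC card_mono[of C A] \<tau>0 by (intro mult_right_mono) auto
    finally show "T x \<le> \<tau>" unfolding T_def using \<open>Q > 0\<close> by (simp add: field_simps)
  next
    fix x assume x: "nearest_int_dist x + \<eta> \<le> w"
    \<comment> \<open>By \<open>full\<close>, 1 - T x is the average over the points outside the
      arc. They have distance at least w from the integers, hence at least eta from x, where the
      kernel is small.\<close>
    have "(\<Sum>q\<in>C - A. J (x - of_int q / real Q)) \<le> (\<Sum>q\<in>C - A. \<tau>)"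
    proof (intro sum_mono J\<tau>)
      fix q assume "q \<in> C - A"
      then have q: "w' + 1 \<le> q" "q \<le> int Q - w' - 1" by (auto simp: A_def C_def)
      have "w \<le> nearest_int_dist (of_int q / real Q)"
      proof -
        obtain l :: int where l: "nearest_int_dist (of_int q / real Q) = \<bar>of_int q / real Q - of_int l\<bar>"
          by (rule nearest_int_dist_attained)
        also have "of_int q / real Q - of_int l = of_int (q - l * int Q) / real Q"
          using \<open>Q > 0\<close> by (simp add: field_simps)
        also have "\<bar>of_int (q - l * int Q) / real Q\<bar> = \<bar>of_int (q - l * int Q)\<bar> / real Q"
          unfolding abs_divide by simp
        finally have eq: "nearest_int_dist (of_int q / real Q) = \<bar>of_int (q - l * int Q)\<bar> / real Q" .
        have "w' + 1 \<le> \<bar>q - l * int Q\<bar>"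
        proof (cases "l \<le> 0")
          case True
          then have "l * int Q \<le> 0" by (simp add: mult_nonpos_nonneg)
          then show ?thesis using q by linarith
        next
          case False
          then have "1 * int Q \<le> l * int Q" by (intro mult_right_mono) auto
          then show ?thesis using q by linarith
        qed
        then have "of_int w' + 1 \<le> \<bar>real_of_int (q - l * int Q)\<bar>" by linarith
        then have "w * real Q \<le> \<bar>real_of_int (q - l * int Q)\<bar>" using w'1 by linarith
        then show ?thesis unfolding eq using \<open>Q > 0\<close> by (simp add: field_simps)
      qed
      then show "\<eta> \<le> nearest_int_dist (x - of_int q / real Q)"
        using nearest_int_dist_triangle[of "of_int q / real Q" x] x nearest_int_dist_minus[of "of_int q / real Q - x"]
        by simp
    qed
    also have "\<dots> = real (card (C - A)) * \<tau>" by simp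
    also have "\<dots> \<le> real Q * \<tau>" using cardC AC card_mono[of C "C - A"] \<tau>0 by (intro mult_right_mono) auto
    finally have "(\<Sum>q\<in>C - A. J (x - of_int q / real Q)) \<le> real Q * \<tau>" .
    moreover have "(\<Sum>q\<in>C. J (x - of_int q / real Q)) = (\<Sum>q\<in>C - A. J (x - of_int q / real Q)) + (\<Sum>q\<in>A. J (x - of_int q / real Q))"
      using AC by (intro sum.subset_diff)
    ultimately have "real Q - real Q * \<tau> \<le> (\<Sum>q\<in>A. J (x - of_int q / real Q))" unfolding full by linarith
    then show "1 - \<tau> \<le> T x" unfolding T_def using \<open>Q > 0\<close> by (simp add: field_simps)
  next
    show "t 0 = of_real t0" unfolding t0_def cardA[symmetric] t_def using j0 by simp
    show "0 < t0" using w'0 \<open>Q > 0\<close> by (simp add: t0_def)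
    have "\<bar>2 * of_int w' + 1 - 2 * w * real Q\<bar> \<le> 1" using w'1 by linarith
    then have "\<bar>2 * of_int w' + 1 - 2 * w * real Q\<bar> / real Q \<le> 1 / real Q" by (intro divide_right_mono) auto
    moreover have "t0 - 2 * w = (2 * of_int w' + 1 - 2 * w * real Q) / real Q"
      using \<open>Q > 0\<close> by (simp add: t0_def field_simps)
    then have "\<bar>t0 - 2 * w\<bar> = \<bar>2 * of_int w' + 1 - 2 * w * real Q\<bar> / real Q"
      by (simp only: abs_divide abs_of_nat)
    moreover have "1 / real Q \<le> \<eta>" using Q1(2) assms(2) \<open>Q > 0\<close> by (simp add: field_simps)
    ultimately show "\<bar>t0 - 2 * w\<bar> \<le> \<eta>" by linarith
    show "norm (t h) \<le> t0" for h
    proof -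
      have "norm (\<Sum>q\<in>A. expi (- (of_int h * (of_int q / real Q)))) \<le> (\<Sum>q\<in>A. 1)"
        by (intro sum_norm_le) simp
      then have "norm (\<Sum>q\<in>A. expi (- (of_int h * (of_int q / real Q)))) \<le> real (card A)" by simp
      then have "norm (j h) * norm (\<Sum>q\<in>A. expi (- (of_int h * (of_int q / real Q)))) \<le> 1 * real (card A)"
        using j1[of h] by (intro mult_mono) auto
      then show ?thesis unfolding t_def t0_def norm_divide norm_mult cardA by (simp add: divide_right_mono)
    qed
  qed
qed

text \<open>The indicator function of the arc is compared with trigonometric polynomials for arcs
  longer and shorter by eta. All their coefficients are bounded by the constant one, so the
  exponential sums enter multiplied by the length of the arc: G has to be small against
  \<open>card F\<close>, not against the expected count.\<close>

lemma equidistribution_from_exponential_sums: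
  fixes R k :: nat and \<eta> \<Delta> G :: real and x :: "nat \<Rightarrow> real"
  assumes "R \<ge> 1" "0 < \<eta>" "\<eta> \<le> \<Delta>" "\<Delta> + \<eta> < 1 / 2" "finite F"
    and G: "\<And>c :: nat \<Rightarrow> complex. (\<And>h. norm (c h) \<le> 1) \<Longrightarrow>
      norm (\<Sum>h=1..k*R. c h * (\<Sum>n\<in>F. expi (real h * x n))) \<le> G"
  defines "\<tau> \<equiv> (real (k * R) + 1) / (2 * \<eta> * real R) ^ (2 * k)"
  shows "\<bar>real (card {n \<in> F. nearest_int_dist (x n) \<le> \<Delta>}) - 2 * \<Delta> * real (card F)\<bar>
    \<le> (3 * \<eta> + \<tau>) * real (card F) + 2 * (2 * \<Delta> + 3 * \<eta>) * G"
proof -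
  define S where "S = k * R"
  have Gpos: "0 \<le> G" using G[of "\<lambda>_. 0"] by simp
  have \<tau>0: "0 \<le> \<tau>" using assms by (simp add: \<tau>_def)
  have sumT: "\<bar>(\<Sum>n\<in>F. T (x n)) - t0 * real (card F)\<bar> \<le> 2 * t0 * G"
    if T: "\<And>x. complex_of_real (T x) = (\<Sum>h\<in>{- int S..int S}. t h * expi (of_int h * x))"
      and t0: "t 0 = of_real t0" "0 < t0" "\<And>h. norm (t h) \<le> t0" for T t t0
  proof -
    define E where "E h = (\<Sum>n\<in>F. expi (of_int h * x n))" for h :: int
    have split: "{- int S..int S} = insert 0 (int ` {1..S} \<union> (\<lambda>h. - int h) ` {1..S})"
    proof
      show "{- int S..int S} \<subseteq> insert 0 (int ` {1..S} \<union> (\<lambda>h. - int h) ` {1..S})"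
      proof
        fix h assume h: "h \<in> {- int S..int S}"
        consider "h = 0" | "h > 0" | "h < 0" by linarith
        then show "h \<in> insert 0 (int ` {1..S} \<union> (\<lambda>h. - int h) ` {1..S})"
        proof cases
          case 2
          then have "h = int (nat h)" "nat h \<in> {1..S}" using h by auto
          then show ?thesis by blast
        next
          case 3
          then have "h = - int (nat (- h))" "nat (- h) \<in> {1..S}" using h by auto
          then show ?thesis by blast
        qed auto
      qed
    qed auto
    have "complex_of_real (\<Sum>n\<in>F. T (x n)) = (\<Sum>h\<in>{- int S..int S}. t h * E h)"
      unfolding of_real_sum T E_def sum_distrib_left by (rule sum.swap)
    also have "\<dots> = t 0 * E 0 + ((\<Sum>h\<in>int ` {1..S}. t h * E h) + (\<Sum>h\<in>(\<lambda>h. - int h) ` {1..S}. t h * E h))"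
      unfolding split by (subst sum.insert, force, force, subst sum.union_disjoint) auto
    also have "(\<Sum>h\<in>int ` {1..S}. t h * E h) = (\<Sum>h=1..S. t (int h) * E (int h))"
      by (subst sum.reindex) (auto simp: inj_on_def)
    also have "(\<Sum>h\<in>(\<lambda>h. - int h) ` {1..S}. t h * E h) = (\<Sum>h=1..S. t (- int h) * E (- int h))"
      by (subst sum.reindex) (auto simp: inj_on_def)
    also have "t 0 * E 0 = complex_of_real (t0 * real (card F))" by (simp add: t0 E_def)
    finally have eq: "complex_of_real ((\<Sum>n\<in>F. T (x n)) - t0 * real (card F)) =
        (\<Sum>h=1..S. t (int h) * E (int h)) + (\<Sum>h=1..S. t (- int h) * E (- int h))"
      by (simp only: of_real_diff add_diff_cancel_left')
    \<comment> \<open>Division by \<open>t0\<close> produces coefficients of modulus at most 1, to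
      which \<open>G\<close> applies; negative frequencies follow by conjugation.\<close>
    have bd: "norm (\<Sum>h=1..S. f h * E (int h)) \<le> t0 * G" if f: "\<And>h. norm (f h) \<le> t0" for f :: "nat \<Rightarrow> complex"
    proof -
      have "norm (\<Sum>h=1..k*R. (f h / of_real t0) * (\<Sum>n\<in>F. expi (real h * x n))) \<le> G"
        using f t0(2) by (intro G) (simp add: norm_divide)
      also have "(\<Sum>h=1..k*R. (f h / of_real t0) * (\<Sum>n\<in>F. expi (real h * x n))) = (\<Sum>h=1..S. f h * E (int h)) / of_real t0"
        unfolding S_def E_def sum_divide_distrib by simp
      finally show ?thesis using t0(2) by (simp add: norm_divide field_simps)
    qed
    have 1: "norm (\<Sum>h=1..S. t (int h) * E (int h)) \<le> t0 * G" by (intro bd t0(3))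
    have "norm (\<Sum>h=1..S. cnj (t (- int h)) * E (int h)) \<le> t0 * G" by (intro bd) (simp add: t0(3))
    moreover have "(\<Sum>h=1..S. t (- int h) * E (- int h)) = cnj (\<Sum>h=1..S. cnj (t (- int h)) * E (int h))"
      by (simp add: E_def expi_minus)
    ultimately have 2: "norm (\<Sum>h=1..S. t (- int h) * E (- int h)) \<le> t0 * G" by (simp only: complex_mod_cnj)
    have "\<bar>(\<Sum>n\<in>F. T (x n)) - t0 * real (card F)\<bar> = norm (complex_of_real ((\<Sum>n\<in>F. T (x n)) - t0 * real (card F)))"
      by (simp only: norm_of_real)
    also have "\<dots> \<le> t0 * G + t0 * G" unfolding eq using 1 2 by (rule norm_triangle_mono)
    finally show ?thesis by (simp add: algebra_simps)
  qed
  have count: "real (card {n \<in> F. nearest_int_dist (x n) \<le> \<Delta>}) = (\<Sum>n\<in>F. if nearest_int_dist (x n) \<le> \<Delta> then 1 else 0)"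
    using \<open>finite F\<close> by (simp add: sum.If_cases Int_def)
  have upper: "real (card {n \<in> F. nearest_int_dist (x n) \<le> \<Delta>}) - 2 * \<Delta> * real (card F)
     \<le> (3 * \<eta> + \<tau>) * real (card F) + 2 * (2 * \<Delta> + 3 * \<eta>) * G"
  proof -
    \<comment> \<open>Majorant up to tau: the half-length is enlarged by eta, so T is at least 1 -
      tau on the original arc.\<close>
    obtain T t t0 where T: "\<And>x. complex_of_real (T x) = (\<Sum>h\<in>{- int S..int S}. t h * expi (of_int h * x))"
      and T0: "\<And>x. 0 \<le> T x" "\<And>x. T x \<le> 1"
      and T1: "\<And>x. \<Delta> + \<eta> + \<eta> \<le> nearest_int_dist x \<Longrightarrow> T x \<le> \<tau>"
        "\<And>x. nearest_int_dist x + \<eta> \<le> \<Delta> + \<eta> \<Longrightarrow> 1 - \<tau> \<le> T x"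
      and t0: "t 0 = of_real t0" "0 < t0" "\<bar>t0 - 2 * (\<Delta> + \<eta>)\<bar> \<le> \<eta>" "\<And>h. norm (t h) \<le> t0"
      by (rule trigonometric_approximation[of R \<eta> "\<Delta> + \<eta>" k, folded \<tau>_def, folded S_def]) (use assms in linarith, use assms in linarith, use assms in linarith, use assms in linarith, rule that)
    have "real (card {n \<in> F. nearest_int_dist (x n) \<le> \<Delta>}) \<le> (\<Sum>n\<in>F. T (x n) + \<tau>)"
      unfolding count using T0 T1 \<tau>0 by (intro sum_mono) (smt (verit))
    also have "\<dots> = (\<Sum>n\<in>F. T (x n)) + \<tau> * real (card F)" by (simp add: sum.distrib)
    also have "\<dots> \<le> t0 * real (card F) + 2 * t0 * G + \<tau> * real (card F)" using sumT[OF T t0(1,2,4)] by linarith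
    also have "\<dots> \<le> (2 * \<Delta> + 3 * \<eta>) * real (card F) + 2 * (2 * \<Delta> + 3 * \<eta>) * G + \<tau> * real (card F)"
      using t0(3) Gpos by (intro add_mono mult_right_mono mult_left_mono) auto
    finally show ?thesis by (simp add: algebra_simps)
  qed
  have lower: "- ((3 * \<eta> + \<tau>) * real (card F) + 2 * (2 * \<Delta> + 3 * \<eta>) * G)
     \<le> real (card {n \<in> F. nearest_int_dist (x n) \<le> \<Delta>}) - 2 * \<Delta> * real (card F)"
  proof -
    \<comment> \<open>Minorant up to tau: the half-length is reduced by eta, so T is at most tau off
      the original arc.\<close>
    obtain T t t0 where T: "\<And>x. complex_of_real (T x) = (\<Sum>h\<in>{- int S..int S}. t h * expi (of_int h * x))"
      and T0: "\<And>x. 0 \<le> T x" "\<And>x. T x \<le> 1"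
      and T1: "\<And>x. \<Delta> - \<eta> + \<eta> \<le> nearest_int_dist x \<Longrightarrow> T x \<le> \<tau>"
        "\<And>x. nearest_int_dist x + \<eta> \<le> \<Delta> - \<eta> \<Longrightarrow> 1 - \<tau> \<le> T x"
      and t0: "t 0 = of_real t0" "0 < t0" "\<bar>t0 - 2 * (\<Delta> - \<eta>)\<bar> \<le> \<eta>" "\<And>h. norm (t h) \<le> t0"
      by (rule trigonometric_approximation[of R \<eta> "\<Delta> - \<eta>" k, folded \<tau>_def, folded S_def]) (use assms in linarith, use assms in linarith, use assms in linarith, use assms in linarith, rule that)
    have "(\<Sum>n\<in>F. T (x n)) \<le> (\<Sum>n\<in>F. (if nearest_int_dist (x n) \<le> \<Delta> then 1 else 0) + \<tau>)"
      using T0 T1 \<tau>0 by (intro sum_mono) (smt (verit))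
    then have "(\<Sum>n\<in>F. T (x n)) \<le> real (card {n \<in> F. nearest_int_dist (x n) \<le> \<Delta>}) + \<tau> * real (card F)"
      unfolding count sum.distrib by (simp add: mult.commute)
    moreover have "t0 * real (card F) - 2 * t0 * G \<le> (\<Sum>n\<in>F. T (x n))" using sumT[OF T t0(1,2,4)] by linarith
    moreover have "(2 * \<Delta> - 3 * \<eta>) * real (card F) \<le> t0 * real (card F)" using t0(3) by (intro mult_right_mono) auto
    moreover have "2 * t0 * G \<le> 2 * (2 * \<Delta> + 3 * \<eta>) * G"
      using t0(3) Gpos assms(2) by (intro mult_right_mono mult_left_mono) auto
    ultimately show ?thesis by (simp add: algebra_simps)
  qed
  from upper lower show ?thesis by linarith
qed

section \<open>Bilinear forms\<close>

lemma L2_set_power2: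
  "(L2_set f A)\<^sup>2 = (\<Sum>i\<in>A. (f i)\<^sup>2)"
  by (simp add: L2_set_def sum_nonneg)

text \<open>Split both index sets by the top binary digit of \<open>a\<close> and \<open>b\<close>: the two diagonal blocks are
  handled by induction, one off-diagonal block is complete and the other one is empty.\<close>

lemma triangular_truncation:
  fixes K :: "'a \<Rightarrow> 'b \<Rightarrow> complex" and x :: "'a \<Rightarrow> complex" and y :: "'b \<Rightarrow> complex"
    and a :: "'a \<Rightarrow> nat" and b :: "'b \<Rightarrow> nat"
  assumes "C \<ge> 0"
    and bound: "\<And>x y. norm (\<Sum>u\<in>U. \<Sum>m\<in>M. x u * y m * K u m) \<le> C * L2_set (norm \<circ> x) U * L2_set (norm \<circ> y) M"
    and "\<And>u. u \<in> U \<Longrightarrow> x u \<noteq> 0 \<Longrightarrow> a u < 2 ^ J" "\<And>m. m \<in> M \<Longrightarrow> y m \<noteq> 0 \<Longrightarrow> b m < 2 ^ J"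
  shows "norm (\<Sum>u\<in>U. \<Sum>m\<in>M. x u * y m * (if a u < b m then K u m else 0))
    \<le> real J * C * L2_set (norm \<circ> x) U * L2_set (norm \<circ> y) M"
  using assms(3,4)
proof (induction J arbitrary: x y a b)
  case 0
  \<comment> \<open>Values below 2^0 are 0, and 0 < 0 fails.\<close>
  have z: "x u * y m * (if a u < b m then K u m else 0) = 0" if "u \<in> U" "m \<in> M" for u m
    using 0(1)[of u] 0(2)[of m] that by (cases "x u = 0"; cases "y m = 0") auto
  have "(\<Sum>u\<in>U. \<Sum>m\<in>M. x u * y m * (if a u < b m then K u m else 0)) = 0"
    by (intro sum.neutral ballI z)
  then show ?case by simp
next
  case (Suc J)
  \<comment> \<open>Restriction sets entries to zero and keeps \<open>U\<close> and
    \<open>M\<close>; this is why the size hypotheses concern only the supports.\<close>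
  define x0 where "x0 u = (if a u < 2 ^ J then x u else 0)" for u
  define x1 where "x1 u = (if a u < 2 ^ J then 0 else x u)" for u
  define y0 where "y0 m = (if b m < 2 ^ J then y m else 0)" for m
  define y1 where "y1 m = (if b m < 2 ^ J then 0 else y m)" for m
  let ?n = "\<lambda>x. L2_set (norm \<circ> x) U" and ?k = "\<lambda>y. L2_set (norm \<circ> y) M"
  \<comment> \<open>The block of \<open>x1\<close> and \<open>y0\<close> is missing because there a
    u >= 2^J > b m; in the block of \<open>x0\<close> and \<open>y1\<close> the comparison always
    holds. Subtracting 2^J on both sides preserves the comparison in the upper diagonal
    block.\<close>
  have split: "x u * y m * (if a u < b m then K u m else 0) =
      x0 u * y0 m * (if a u < b m then K u m else 0)
      + x1 u * y1 m * (if a u - 2 ^ J < b m - 2 ^ J then K u m else 0) + x0 u * y1 m * K u m" for u m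
    unfolding x0_def x1_def y0_def y1_def
    by (cases "a u < 2 ^ J"; cases "b m < 2 ^ J"; simp; linarith)
  have "norm (\<Sum>u\<in>U. \<Sum>m\<in>M. x u * y m * (if a u < b m then K u m else 0))
     \<le> norm (\<Sum>u\<in>U. \<Sum>m\<in>M. x0 u * y0 m * (if a u < b m then K u m else 0))
     + norm (\<Sum>u\<in>U. \<Sum>m\<in>M. x1 u * y1 m * (if a u - 2 ^ J < b m - 2 ^ J then K u m else 0))
     + norm (\<Sum>u\<in>U. \<Sum>m\<in>M. x0 u * y1 m * K u m)"
    unfolding split sum.distrib by (rule norm_triangle_mono[OF norm_triangle_ineq order_refl])
  also have "\<dots> \<le> real J * C * ?n x0 * ?k y0 + real J * C * ?n x1 * ?k y1 + C * ?n x0 * ?k y1"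
  proof (intro add_mono)
    show "norm (\<Sum>u\<in>U. \<Sum>m\<in>M. x0 u * y0 m * (if a u < b m then K u m else 0)) \<le> real J * C * ?n x0 * ?k y0"
      by (rule Suc.IH) (auto simp: x0_def y0_def split: if_splits)
    show "norm (\<Sum>u\<in>U. \<Sum>m\<in>M. x1 u * y1 m * (if a u - 2 ^ J < b m - 2 ^ J then K u m else 0)) \<le> real J * C * ?n x1 * ?k y1"
    proof (rule Suc.IH)
      show "a u - 2 ^ J < 2 ^ J" if "u \<in> U" "x1 u \<noteq> 0" for u
        using that Suc.prems(1)[of u] by (auto simp: x1_def split: if_splits)
      show "b m - 2 ^ J < 2 ^ J" if "m \<in> M" "y1 m \<noteq> 0" for m
        using that Suc.prems(2)[of m] by (auto simp: y1_def split: if_splits)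
    qed
  qed (rule bound)
  also have "\<dots> = real J * C * (?n x0 * ?k y0 + ?n x1 * ?k y1) + C * (?n x0 * ?k y1)"
    by (simp add: algebra_simps)
  also have "\<dots> \<le> real J * C * (?n x * ?k y) + C * (?n x * ?k y)"
  proof -
    \<comment> \<open>The pieces are orthogonal, so by Cauchy's inequality in the plane the two
      diagonal blocks together cost no more than one. Each digit thus adds only a single
      \<open>C\<close>.\<close>
    have nx: "(?n x)\<^sup>2 = (?n x0)\<^sup>2 + (?n x1)\<^sup>2"
      unfolding L2_set_power2 sum.distrib[symmetric] by (intro sum.cong) (auto simp: x0_def x1_def)
    have ny: "(?k y)\<^sup>2 = (?k y0)\<^sup>2 + (?k y1)\<^sup>2"
      unfolding L2_set_power2 sum.distrib[symmetric] by (intro sum.cong) (auto simp: y0_def y1_def)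
    have pos: "0 \<le> ?n x" "0 \<le> ?n x0" "0 \<le> ?n x1" "0 \<le> ?k y" "0 \<le> ?k y0" "0 \<le> ?k y1"
      by (auto simp: L2_set_nonneg)
    have "?n x0 \<le> ?n x" by (rule power2_le_imp_le) (use nx pos in auto)
    moreover have "?k y1 \<le> ?k y" by (rule power2_le_imp_le) (use ny pos in auto)
    ultimately have "?n x0 * ?k y1 \<le> ?n x * ?k y" using pos by (intro mult_mono)
    moreover have "?n x0 * ?k y0 + ?n x1 * ?k y1 \<le> ?n x * ?k y"
    proof (rule power2_le_imp_le)
      have "0 \<le> (?n x0 * ?k y1 - ?n x1 * ?k y0)\<^sup>2" by simp
      then show "(?n x0 * ?k y0 + ?n x1 * ?k y1)\<^sup>2 \<le> (?n x * ?k y)\<^sup>2"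
        unfolding power_mult_distrib nx ny by (simp add: power2_eq_square algebra_simps)
    qed (use pos in auto)
    ultimately show ?thesis using \<open>C \<ge> 0\<close> by (intro add_mono mult_left_mono) auto
  qed
  also have "\<dots> = real (Suc J) * C * ?n x * ?k y" by (simp add: algebra_simps)
  finally show ?case .
qed

text \<open>Cauchy's inequality over m leaves a quadratic form in x whose matrix is the Gram matrix
  of the rows of K. By |x u x u'| <= (|x u|^2 + |x u'|^2) / 2 and symmetry, it is bounded by the
  largest absolute row sum (Schur's test).\<close>

lemma bilinear_form_bound:
  fixes K :: "'a \<Rightarrow> 'b \<Rightarrow> complex"
  assumes "finite U" "finite M"
    and row: "\<And>u. u \<in> U \<Longrightarrow> (\<Sum>u'\<in>U. norm (\<Sum>m\<in>M. K u m * cnj (K u' m))) \<le> B" and "B \<ge> 0"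
  shows "norm (\<Sum>u\<in>U. \<Sum>m\<in>M. x u * y m * K u m) \<le> sqrt B * L2_set (norm \<circ> x) U * L2_set (norm \<circ> y) M"
proof -
  define g where "g u u' = norm (\<Sum>m\<in>M. K u m * cnj (K u' m))" for u u'
  have gsym: "g u u' = g u' u" for u u'
  proof -
    have "g u u' = norm (cnj (\<Sum>m\<in>M. K u m * cnj (K u' m)))" unfolding g_def by (simp only: complex_mod_cnj)
    also have "cnj (\<Sum>m\<in>M. K u m * cnj (K u' m)) = (\<Sum>m\<in>M. K u' m * cnj (K u m))"
      by (simp add: mult.commute)
    finally show ?thesis by (simp add: g_def)
  qed
  define S where "S m = (\<Sum>u\<in>U. x u * K u m)" for m
  have "complex_of_real (\<Sum>m\<in>M. (norm (S m))\<^sup>2) = (\<Sum>m\<in>M. S m * cnj (S m))"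
    by (simp only: of_real_sum complex_norm_square)
  also have "\<dots> = (\<Sum>m\<in>M. \<Sum>u\<in>U. \<Sum>u'\<in>U. x u * cnj (x u') * (K u m * cnj (K u' m)))"
    unfolding S_def by (simp add: sum_product algebra_simps)
  also have "\<dots> = (\<Sum>u\<in>U. \<Sum>u'\<in>U. \<Sum>m\<in>M. x u * cnj (x u') * (K u m * cnj (K u' m)))"
    by (subst sum.swap, rule sum.cong[OF refl], rule sum.swap)
  also have "\<dots> = (\<Sum>u\<in>U. \<Sum>u'\<in>U. x u * cnj (x u') * (\<Sum>m\<in>M. K u m * cnj (K u' m)))"
    by (simp add: sum_distrib_left)
  finally have eq: "complex_of_real (\<Sum>m\<in>M. (norm (S m))\<^sup>2) = \<dots>" .
  have "(\<Sum>m\<in>M. (norm (S m))\<^sup>2) = norm (complex_of_real (\<Sum>m\<in>M. (norm (S m))\<^sup>2))"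
    unfolding norm_of_real by (simp add: sum_nonneg)
  also have "\<dots> \<le> (\<Sum>u\<in>U. \<Sum>u'\<in>U. norm (x u) * norm (x u') * g u u')"
    unfolding eq g_def by (intro sum_norm_le) (simp add: norm_mult)
  also have "\<dots> \<le> (\<Sum>u\<in>U. \<Sum>u'\<in>U. ((norm (x u))\<^sup>2 / 2 + (norm (x u'))\<^sup>2 / 2) * g u u')"
  proof (intro sum_mono mult_right_mono)
    fix u u'
    have "0 \<le> (norm (x u) - norm (x u'))\<^sup>2" by simp
    then show "norm (x u) * norm (x u') \<le> (norm (x u))\<^sup>2 / 2 + (norm (x u'))\<^sup>2 / 2"
      by (simp add: power2_eq_square algebra_simps)
    show "0 \<le> g u u'" by (simp add: g_def)
  qed
  also have "\<dots> = (\<Sum>u\<in>U. \<Sum>u'\<in>U. (norm (x u))\<^sup>2 / 2 * g u u') + (\<Sum>u\<in>U. \<Sum>u'\<in>U. (norm (x u'))\<^sup>2 / 2 * g u u')"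
    by (simp add: sum.distrib distrib_right)
  also have "(\<Sum>u\<in>U. \<Sum>u'\<in>U. (norm (x u'))\<^sup>2 / 2 * g u u') = (\<Sum>u\<in>U. \<Sum>u'\<in>U. (norm (x u))\<^sup>2 / 2 * g u u')"
    by (subst sum.swap) (simp add: gsym)
  also have "(\<Sum>u\<in>U. \<Sum>u'\<in>U. (norm (x u))\<^sup>2 / 2 * g u u') = (\<Sum>u\<in>U. (norm (x u))\<^sup>2 / 2 * (\<Sum>u'\<in>U. g u u'))"
    by (simp add: sum_distrib_left)
  also have "\<dots> + \<dots> = (\<Sum>u\<in>U. (norm (x u))\<^sup>2 * (\<Sum>u'\<in>U. g u u'))"
    by (simp add: sum.distrib[symmetric] field_simps)
  also have "\<dots> \<le> (\<Sum>u\<in>U. (norm (x u))\<^sup>2 * B)"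
    by (intro sum_mono mult_left_mono) (use row in \<open>auto simp: g_def\<close>)
  also have "\<dots> = B * (L2_set (norm \<circ> x) U)\<^sup>2"
    by (simp add: L2_set_power2 sum_distrib_left mult.commute)
  finally have "(\<Sum>m\<in>M. (norm (S m))\<^sup>2) \<le> B * (L2_set (norm \<circ> x) U)\<^sup>2" .
  then have L: "L2_set (norm \<circ> S) M \<le> sqrt B * L2_set (norm \<circ> x) U"
    unfolding L2_set_def[of _ M] by (intro real_le_lsqrt) (auto simp: sum_nonneg power_mult_distrib \<open>B \<ge> 0\<close> L2_set_nonneg)
  have "(\<Sum>u\<in>U. \<Sum>m\<in>M. x u * y m * K u m) = (\<Sum>m\<in>M. y m * S m)"
    unfolding S_def by (subst sum.swap) (simp add: sum_distrib_left mult_ac)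
  then have "norm (\<Sum>u\<in>U. \<Sum>m\<in>M. x u * y m * K u m) \<le> (\<Sum>m\<in>M. \<bar>(norm \<circ> y) m\<bar> * \<bar>(norm \<circ> S) m\<bar>)"
    by (simp only:) (intro sum_norm_le, simp add: norm_mult)
  also have "\<dots> \<le> L2_set (norm \<circ> y) M * L2_set (norm \<circ> S) M" by (rule L2_set_mult_ineq)
  also have "\<dots> \<le> L2_set (norm \<circ> y) M * (sqrt B * L2_set (norm \<circ> x) U)"
    using L by (intro mult_left_mono) (auto simp: L2_set_nonneg)
  finally show ?thesis by (simp add: mult_ac)
qed

text \<open>The coefficients are arbitrary so that they can carry the Fourier coefficients of the
  arc as well as the phases e(-h beta) of the shift.\<close>

definition exp_poly :: "real \<Rightarrow> (nat \<Rightarrow> complex) \<Rightarrow> nat \<Rightarrow> nat \<Rightarrow> complex" where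
  "exp_poly \<alpha> c H n = (\<Sum>h=1..H. c h * expi (real h * real n * \<alpha>))"

lemma norm_sum_expi_shift_le:
  assumes "nearest_int_dist t > 0"
  shows "norm (\<Sum>m=1..M. expi (real m * t)) \<le> 1 / (2 * nearest_int_dist t)"
proof -
  have "(\<Sum>m=1..M. expi (real m * t)) = (\<Sum>m<M. expi (real (Suc m) * t))"
    by (rule sum.reindex_bij_witness[of _ Suc "\<lambda>m. m - 1"]) auto
  also have "\<dots> = (\<Sum>m<M. expi t * expi (real m * t))"
    by (intro sum.cong refl) (simp add: expi_add[symmetric] algebra_simps)
  also have "\<dots> = expi t * (\<Sum>m<M. expi (real m * t))" by (simp add: sum_distrib_left)
  finally show ?thesis using norm_sum_expi_le[OF assms, of M] by (simp add: norm_mult)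
qed

text \<open>Expanding both polynomials gives geometric sums over m with frequency h u - h'u'. For
  each of the H values of h, a product v = h'u' arises at most \<open>D\<close> times, and the
  differences h u - v are distinct integers of absolute value below H U. Only the difference 0 gives
  the trivial bound M.\<close>

lemma exp_poly_row_sum_le:
  fixes U M H :: nat
  assumes nid: "\<And>l :: nat. l > 0 \<Longrightarrow> nearest_int_dist (real l * \<alpha>) > 0"
    and c: "\<And>h. norm (c h) \<le> 1"
    and D: "\<And>v. v > 0 \<Longrightarrow> v \<le> H * U \<Longrightarrow> card {d. d dvd v} \<le> D"
    and u: "u \<in> {1..U}"
  shows "(\<Sum>u'\<in>{1..U}. norm (\<Sum>m\<in>{1..M}. exp_poly \<alpha> c H (u * m) * cnj (exp_poly \<alpha> c H (u' * m))))
    \<le> real H * real D * (real M + (\<Sum>l=1..H*U. 1 / nearest_int_dist (real l * \<alpha>)))"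
proof -
  \<comment> \<open>Majorant for the geometric sum over m with frequency l alpha.\<close>
  define \<Phi> :: "int \<Rightarrow> real" where
    "\<Phi> l = (if l = 0 then real M else 1 / (2 * nearest_int_dist (real_of_int l * \<alpha>)))" for l
  have nid': "nearest_int_dist (real_of_int l * \<alpha>) = nearest_int_dist (real (nat \<bar>l\<bar>) * \<alpha>)" for l
  proof (cases "l \<ge> 0")
    case False
    then have "real (nat \<bar>l\<bar>) * \<alpha> = - (real_of_int l * \<alpha>)" by simp
    then show ?thesis by (simp only: nearest_int_dist_minus)
  qed simp
  have \<Phi>0: "0 \<le> \<Phi> l" for l by (simp add: \<Phi>_def)
  have inner: "norm (\<Sum>m\<in>{1..M}. expi (real h * real (u * m) * \<alpha>) * cnj (expi (real h' * real (u' * m) * \<alpha>)))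
      \<le> \<Phi> (int (h * u) - int (h' * u'))" for h h' u'
  proof -
    let ?l = "int (h * u) - int (h' * u')"
    have "(\<Sum>m\<in>{1..M}. expi (real h * real (u * m) * \<alpha>) * cnj (expi (real h' * real (u' * m) * \<alpha>)))
      = (\<Sum>m=1..M. expi (real m * (real_of_int ?l * \<alpha>)))"
      by (intro sum.cong refl) (simp add: expi_minus[symmetric] expi_add[symmetric] algebra_simps)
    moreover have "norm \<dots> \<le> \<Phi> ?l"
    proof (cases "?l = 0")
      case True
      have "norm (\<Sum>m=1..M. expi (real m * (real_of_int ?l * \<alpha>))) \<le> (\<Sum>m=1..M. 1)"
        by (intro sum_norm_le) simp
      then show ?thesis using True by (simp add: \<Phi>_def)
    next
      case False
      then have "nearest_int_dist (real_of_int ?l * \<alpha>) > 0" unfolding nid' by (intro nid) simp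
      then show ?thesis using norm_sum_expi_shift_le[of "real_of_int ?l * \<alpha>" M] False by (simp add: \<Phi>_def)
    qed
    ultimately show ?thesis by simp
  qed
  have row: "norm (\<Sum>m\<in>{1..M}. exp_poly \<alpha> c H (u * m) * cnj (exp_poly \<alpha> c H (u' * m)))
      \<le> (\<Sum>h=1..H. \<Sum>h'=1..H. \<Phi> (int (h * u) - int (h' * u')))" for u'
  proof -
    let ?e = "\<lambda>h h' m. expi (real h * real (u * m) * \<alpha>) * cnj (expi (real h' * real (u' * m) * \<alpha>))"
    have "(\<Sum>m\<in>{1..M}. exp_poly \<alpha> c H (u * m) * cnj (exp_poly \<alpha> c H (u' * m)))
      = (\<Sum>m\<in>{1..M}. \<Sum>h=1..H. \<Sum>h'=1..H. c h * cnj (c h') * ?e h h' m)"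
      unfolding exp_poly_def by (simp add: sum_product algebra_simps)
    also have "\<dots> = (\<Sum>h=1..H. \<Sum>h'=1..H. \<Sum>m\<in>{1..M}. c h * cnj (c h') * ?e h h' m)"
      by (subst sum.swap, rule sum.cong[OF refl], rule sum.swap)
    also have "\<dots> = (\<Sum>h=1..H. \<Sum>h'=1..H. c h * cnj (c h') * (\<Sum>m\<in>{1..M}. ?e h h' m))"
      by (simp add: sum_distrib_left)
    also have "norm \<dots> \<le> (\<Sum>h=1..H. \<Sum>h'=1..H. \<Phi> (int (h * u) - int (h' * u')))"
    proof (intro sum_norm_le)
      fix h h'
      have "norm (c h * cnj (c h') * (\<Sum>m\<in>{1..M}. ?e h h' m)) \<le> 1 * norm (\<Sum>m\<in>{1..M}. ?e h h' m)"
        unfolding norm_mult complex_mod_cnj using c[of h] c[of h'] by (intro mult_right_mono mult_le_one) auto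
      also have "\<dots> \<le> \<Phi> (int (h * u) - int (h' * u'))" using inner[of h h' u'] by simp
      finally show "norm (c h * cnj (c h') * (\<Sum>m\<in>{1..M}. ?e h h' m)) \<le> \<Phi> (int (h * u) - int (h' * u'))" .
    qed
    finally show ?thesis .
  qed
  have perh: "(\<Sum>u'\<in>{1..U}. \<Sum>h'=1..H. \<Phi> (int (h * u) - int (h' * u')))
     \<le> real D * (real M + (\<Sum>l=1..H*U. 1 / nearest_int_dist (real l * \<alpha>)))" if h: "h \<in> {1..H}" for h
  proof -
    have "(\<Sum>u'\<in>{1..U}. \<Sum>h'=1..H. \<Phi> (int (h * u) - int (h' * u')))
       = (\<Sum>(u', h')\<in>{1..U} \<times> {1..H}. \<Phi> (int (h * u) - int (h' * u')))"
      by (simp add: sum.cartesian_product)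
    also have "\<dots> = (\<Sum>v\<in>{1..H*U}. \<Sum>z\<in>{z \<in> {1..U} \<times> {1..H}. snd z * fst z = v}. \<Phi> (int (h * u) - int (snd z * fst z)))"
      unfolding case_prod_unfold
    proof (rule sum.group[symmetric])
      show "(\<lambda>z. snd z * fst z) ` ({1..U} \<times> {1..H}) \<subseteq> {1..H * U}"
      proof (rule image_subsetI)
        fix z :: "nat \<times> nat" assume "z \<in> {1..U} \<times> {1..H}"
        then have "1 \<le> fst z" "fst z \<le> U" "1 \<le> snd z" "snd z \<le> H" by auto
        then show "snd z * fst z \<in> {1..H * U}" by (simp add: mult_le_mono)
      qed
    qed auto
    also have "\<dots> = (\<Sum>v\<in>{1..H*U}. real (card {z \<in> {1..U} \<times> {1..H}. snd z * fst z = v}) * \<Phi> (int (h * u) - int v))"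
      by (intro sum.cong refl) (simp add: )
    also have "\<dots> \<le> (\<Sum>v\<in>{1..H*U}. real D * \<Phi> (int (h * u) - int v))"
    proof (intro sum_mono mult_right_mono \<Phi>0)
      fix v assume v: "v \<in> {1..H*U}"
      have "card {z \<in> {1..U} \<times> {1..H}. snd z * fst z = v} \<le> card {d. d dvd v}"
      proof (rule card_inj_on_le[of fst])
        show "inj_on fst {z \<in> {1..U} \<times> {1..H}. snd z * fst z = v}"
          by (rule inj_onI) (auto simp: prod_eq_iff)
        show "fst ` {z \<in> {1..U} \<times> {1..H}. snd z * fst z = v} \<subseteq> {d. d dvd v}" by auto
        show "finite {d. d dvd v}" using v by simp
      qed
      also have "\<dots> \<le> D" using D v by simp
      finally show "real (card {z \<in> {1..U} \<times> {1..H}. snd z * fst z = v}) \<le> real D" by simp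
    qed
    also have "\<dots> = real D * (\<Sum>v\<in>{1..H*U}. \<Phi> (int (h * u) - int v))" by (simp add: sum_distrib_left)
    also have "\<dots> \<le> real D * (real M + (\<Sum>l=1..H*U. 1 / nearest_int_dist (real l * \<alpha>)))"
    proof (rule mult_left_mono)
      have hu: "1 \<le> h * u" "h * u \<le> H * U" using h u by (auto simp: mult_le_mono)
      have "(\<Sum>v\<in>{1..H*U}. \<Phi> (int (h * u) - int v)) = (\<Sum>l\<in>(\<lambda>v. int (h * u) - int v) ` {1..H*U}. \<Phi> l)"
        by (subst sum.reindex) (auto simp: inj_on_def)
      also have "\<dots> \<le> (\<Sum>l\<in>{0} \<union> int ` {1..H*U} \<union> (\<lambda>l. - int l) ` {1..H*U}. \<Phi> l)"
      proof (rule sum_mono2)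
        show "(\<lambda>v. int (h * u) - int v) ` {1..H*U} \<subseteq> {0} \<union> int ` {1..H*U} \<union> (\<lambda>l. - int l) ` {1..H*U}"
        proof (rule image_subsetI)
          fix v assume v: "v \<in> {1..H*U}"
          consider "v = h * u" | "v < h * u" | "v > h * u" by linarith
          then show "int (h * u) - int v \<in> {0} \<union> int ` {1..H*U} \<union> (\<lambda>l. - int l) ` {1..H*U}"
          proof cases
            case 2
            then have "int (h * u) - int v = int (h * u - v)" "h * u - v \<in> {1..H*U}" using hu by auto
            then show ?thesis by blast
          next
            case 3
            then have "int (h * u) - int v = - int (v - h * u)" "v - h * u \<in> {1..H*U}" using hu v by auto
            then show ?thesis by blast
          qed auto
        qed
      qed (auto simp: \<Phi>0)
      also have "\<dots> \<le> (\<Sum>l\<in>{0} \<union> int ` {1..H*U}. \<Phi> l) + (\<Sum>l\<in>(\<lambda>l. - int l) ` {1..H*U}. \<Phi> l)"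
        by (subst sum_Un) (auto simp: \<Phi>0 sum_nonneg)
      also have "\<dots> \<le> (\<Sum>l\<in>{0}. \<Phi> l) + (\<Sum>l\<in>int ` {1..H*U}. \<Phi> l) + (\<Sum>l\<in>(\<lambda>l. - int l) ` {1..H*U}. \<Phi> l)"
        by (intro add_right_mono, subst sum_Un) (auto simp: \<Phi>0 sum_nonneg)
      also have "\<dots> = real M + (\<Sum>l=1..H*U. \<Phi> (int l)) + (\<Sum>l=1..H*U. \<Phi> (- int l))"
        by (subst (1 2) sum.reindex) (auto simp: inj_on_def \<Phi>_def)
      \<comment> \<open>The contributions 1 / (2 ||l alpha||) of l and -l add up to the full
        reciprocal.\<close>
      also have "\<dots> = real M + (\<Sum>l=1..H*U. 1 / nearest_int_dist (real l * \<alpha>))"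
        unfolding add.assoc sum.distrib[symmetric] by (auto simp: \<Phi>_def intro!: sum.cong)
      finally show "(\<Sum>v\<in>{1..H*U}. \<Phi> (int (h * u) - int v)) \<le> real M + (\<Sum>l=1..H*U. 1 / nearest_int_dist (real l * \<alpha>))" .
    qed auto
    finally show ?thesis .
  qed
  have "(\<Sum>u'\<in>{1..U}. norm (\<Sum>m\<in>{1..M}. exp_poly \<alpha> c H (u * m) * cnj (exp_poly \<alpha> c H (u' * m))))
      \<le> (\<Sum>u'\<in>{1..U}. \<Sum>h=1..H. \<Sum>h'=1..H. \<Phi> (int (h * u) - int (h' * u')))"
    by (intro sum_mono row)
  also have "\<dots> = (\<Sum>h=1..H. \<Sum>u'\<in>{1..U}. \<Sum>h'=1..H. \<Phi> (int (h * u) - int (h' * u')))"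
    by (rule sum.swap)
  also have "\<dots> \<le> (\<Sum>h=1..H. real D * (real M + (\<Sum>l=1..H*U. 1 / nearest_int_dist (real l * \<alpha>))))"
    by (intro sum_mono perh)
  also have "\<dots> = real H * real D * (real M + (\<Sum>l=1..H*U. 1 / nearest_int_dist (real l * \<alpha>)))"
    by simp
  finally show ?thesis .
qed

section \<open>A combinatorial sieve identity\<close>

definition bad_prime :: "nat \<Rightarrow> bool" where
  "bad_prime p \<longleftrightarrow> prime p \<and> p mod 4 = 3"

definition bad_moebius :: "nat \<Rightarrow> int" where
  "bad_moebius d = (if squarefree d \<and> (\<forall>p. prime p \<longrightarrow> p dvd d \<longrightarrow> bad_prime p) then (- 1) ^ card (prime_factors d) else 0)"

text \<open>If \<open>m\<close> has no bad prime factor, the value \<open>N + 1\<close> plays the role of infinity.\<close>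

definition least_bad_prime :: "nat \<Rightarrow> nat \<Rightarrow> nat" where
  "least_bad_prime N m = (if \<exists>p. bad_prime p \<and> p dvd m then LEAST p. bad_prime p \<and> p dvd m else N + 1)"

text \<open>The support consists of the products u = p v, p the least prime factor, at which the
  factor p carries v < Y across the threshold Y. The default value of \<open>least_bad_prime\<close>
  does not interfere: for Y > 1 an integer u >= Y without bad prime factor has
  \<open>bad_moebius u = 0\<close>.\<close>

definition sieve_coeff :: "nat \<Rightarrow> nat \<Rightarrow> nat \<Rightarrow> int" where
  "sieve_coeff N Y u = (if Y \<le> u \<and> u div least_bad_prime N u < Y then bad_moebius u else 0)"

lemma least_bad_prime_props:
  assumes "bad_prime q" "q dvd m"
  shows "least_bad_prime N m \<le> q" "bad_prime (least_bad_prime N m)" "least_bad_prime N m dvd m"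
proof -
  have ex: "\<exists>p. bad_prime p \<and> p dvd m" using assms by blast
  then have eq: "least_bad_prime N m = (LEAST p. bad_prime p \<and> p dvd m)" by (simp add: least_bad_prime_def)
  show "least_bad_prime N m \<le> q" unfolding eq by (rule Least_le) (use assms in simp)
  show "bad_prime (least_bad_prime N m)" "least_bad_prime N m dvd m"
    unfolding eq using LeastI_ex[OF ex] by auto
qed

lemma least_bad_prime_le: "m > 0 \<Longrightarrow> least_bad_prime N m \<le> max m (N + 1)"
proof (cases "\<exists>p. bad_prime p \<and> p dvd m")
  case True
  assume "m > 0"
  from True obtain p where "bad_prime p" "p dvd m" by blast
  then have "least_bad_prime N m \<le> p" "p \<le> m" using least_bad_prime_props(1) \<open>m > 0\<close> by (auto intro: dvd_imp_le)
  then show ?thesis by simp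
qed (auto simp: least_bad_prime_def)

lemma bad_moebius_1 [simp]: "bad_moebius (Suc 0) = 1"
  using not_prime_unit by (auto simp: bad_moebius_def)

lemma abs_bad_moebius_le: "\<bar>bad_moebius d\<bar> \<le> 1"
  by (simp add: bad_moebius_def)

lemma bad_moebius_nonzeroD:
  assumes "bad_moebius d \<noteq> 0"
  shows "squarefree d" "\<And>p. prime p \<Longrightarrow> p dvd d \<Longrightarrow> bad_prime p" "d > 0" "odd d"
proof -
  show sq: "squarefree d" and pr: "\<And>p. prime p \<Longrightarrow> p dvd d \<Longrightarrow> bad_prime p"
    using assms by (auto simp: bad_moebius_def split: if_splits)
  show "d > 0" using sq by (cases d) auto
  show "odd d" using pr[of 2] by (auto simp: bad_prime_def)
qed

lemma bad_moebius_prime_mult: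
  assumes "bad_prime p" "\<not> p dvd v" "v > 0"
  shows "bad_moebius (p * v) = - bad_moebius v"
proof -
  have p: "prime p" using assms by (simp add: bad_prime_def)
  then have cop: "coprime p v" using assms by (simp add: prime_imp_coprime)
  have "squarefree p" using p by (simp add: squarefree_prime)
  then have "squarefree (p * v) \<longleftrightarrow> squarefree v"
    using cop squarefree_mult_coprime squarefree_multD(2) by blast
  moreover have "(\<forall>q. prime q \<longrightarrow> q dvd p * v \<longrightarrow> bad_prime q) \<longleftrightarrow> (\<forall>q. prime q \<longrightarrow> q dvd v \<longrightarrow> bad_prime q)"
  proof -
    have "q = p" if "prime q" "q dvd p" for q using primes_dvd_imp_eq[OF that(1) p that(2)] .
    then show ?thesis using assms(1) by (auto simp: prime_dvd_mult_iff)
  qed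
  moreover have "card (prime_factors (p * v)) = Suc (card (prime_factors v))"
  proof -
    have "prime_factors (p * v) = insert p (prime_factors v)"
      using p assms(3) by (auto simp: prime_factors_product prime_prime_factors)
    moreover have "p \<notin> prime_factors v" using assms(2) in_prime_factors_imp_dvd by blast
    ultimately show ?thesis by simp
  qed
  ultimately show ?thesis by (simp add: bad_moebius_def)
qed

text \<open>Removing a prime factor that is 1 modulo 4 does not change the residue, so the descent
  must meet a bad prime.\<close>

lemma three_mod_four_imp_bad_prime_factor:
  "n mod 4 = 3 \<Longrightarrow> \<exists>p. bad_prime p \<and> p dvd n"
proof (induction n rule: less_induct)
  case (less n)
  have "n \<noteq> 1" using less.prems by auto
  then obtain p where p: "prime p" "p dvd n" using prime_factor_nat by blast
  then obtain m where m: "n = p * m" by (auto elim: dvdE)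
  show ?case
  proof (cases "p mod 4 = 3")
    case True
    then show ?thesis using p by (auto simp: bad_prime_def)
  next
    case False
    have "odd n" using less.prems by presburger
    then have "odd p" using m by auto
    then have "p mod 4 = 1" using False by presburger
    then have "n mod 4 = m mod 4" unfolding m by (metis mod_mult_left_eq mult_1)
    then have "m mod 4 = 3" using less.prems by simp
    moreover have "m < n" using m p prime_gt_1_nat[of p] \<open>odd n\<close> by (cases "m = 0") auto
    ultimately obtain q where "bad_prime q" "q dvd m" using less.IH by blast
    then show ?thesis using m by auto
  qed
qed

text \<open>For \<open>n\<close> outside the set, pairing \<open>v\<close> with \<open>p * v\<close>, where \<open>p\<close> is the least bad prime
  factor of \<open>n\<close>, leaves in the first sum exactly the \<open>v\<close> with \<open>v < Y \<le> p * v\<close>,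
  and the second sum runs over these \<open>p * v\<close>.\<close>

lemma sieve_identity:
  assumes n: "n mod 4 = 1" "n \<le> N" and YZ: "1 < Y" "Y * Y \<le> Z" "N < (Z + 1) * (Z + 1)"
  shows "(if n \<in> coprime_square_sums then 1 else 0) =
    (\<Sum>d | d dvd n \<and> d < Y. bad_moebius d) +
    (\<Sum>u | u dvd n \<and> u \<le> Z \<and> least_bad_prime N u \<le> least_bad_prime N (n div u). sieve_coeff N Y u)"
proof -
  have "n > 0" "odd n" using n(1) by presburger+
  have fin: "finite {d. d dvd n \<and> P d}" for P using \<open>n > 0\<close> by simp
  have mem: "n \<in> coprime_square_sums \<longleftrightarrow> \<not> (\<exists>p. bad_prime p \<and> p dvd n)"
    using \<open>odd n\<close> by (auto simp: mem_coprime_square_sums_iff bad_prime_def)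
  have nu0: "\<exists>q. bad_prime q \<and> q dvd d" if "bad_moebius d \<noteq> 0" "d \<noteq> 1" for d
    using that bad_moebius_nonzeroD(2)[OF that(1)] prime_factor_nat by blast
  show ?thesis
  proof (cases "n \<in> coprime_square_sums")
    case True
    then have no: "\<not> (bad_prime p \<and> p dvd n)" for p using mem by blast
    have z: "bad_moebius d = 0" if "d dvd n" "d \<noteq> 1" for d
      using nu0[of d] that no dvd_trans by blast
    have "(\<Sum>d | d dvd n \<and> d < Y. bad_moebius d) = (\<Sum>d\<in>{1}. bad_moebius d)"
      using YZ z by (intro sum.mono_neutral_right fin) auto
    moreover have "(\<Sum>u | u dvd n \<and> u \<le> Z \<and> least_bad_prime N u \<le> least_bad_prime N (n div u). sieve_coeff N Y u) = 0"
      using YZ z by (intro sum.neutral) (auto simp: sieve_coeff_def)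
    ultimately show ?thesis using True by simp
  next
    case False
    define p where "p = least_bad_prime N n"
    obtain q0 where "bad_prime q0" "q0 dvd n" using False mem by blast
    note pp = least_bad_prime_props[OF this, of N, folded p_def]
    have pmin: "p \<le> q" if "bad_prime q" "q dvd n" for q
      unfolding p_def using least_bad_prime_props(1)[OF that] .
    have pr: "prime p" "p mod 4 = 3" using pp(2) by (auto simp: bad_prime_def)
    have p1: "p > 1" using pr(1) prime_gt_1_nat by blast
    \<comment> \<open>The divisors of n that carry a nonzero Moebius value are exactly the v in
      \<open>V\<close> and the products p * v, with opposite signs.\<close>
    define V where "V = {v. v dvd n \<and> bad_moebius v \<noteq> 0 \<and> \<not> p dvd v}"
    have finV: "finite {v \<in> V. P v}" for P
      by (rule finite_subset[of _ "{d. d dvd n}"]) (use \<open>n > 0\<close> in \<open>auto simp: V_def\<close>)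
    have Vpos: "v > 0" if "v \<in> V" for v using that bad_moebius_nonzeroD(3) by (auto simp: V_def)
    have nuV: "bad_moebius (p * v) = - bad_moebius v" if "v \<in> V" for v
      using that Vpos[OF that] pp(2) by (intro bad_moebius_prime_mult) (auto simp: V_def)
    have pV: "p * v dvd n" if "v \<in> V" for v
    proof -
      have "coprime p v" using that pr by (auto simp: V_def prime_imp_coprime)
      then show ?thesis using that pp(3) by (auto simp: V_def intro: divides_mult)
    qed
    have decomp: "\<exists>v\<in>V. u = p * v" if u: "u dvd n" "bad_moebius u \<noteq> 0" "p dvd u" for u
    proof -
      obtain v where v: "u = p * v" using u(3) by (auto elim: dvdE)
      have "\<not> p dvd v"
      proof
        assume "p dvd v"
        then have "p * p dvd u" using v by (simp add: mult_dvd_mono)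
        then have "p dvd 1" using bad_moebius_nonzeroD(1)[OF u(2)] by (auto simp: squarefree_def power2_eq_square)
        then show False using p1 by simp
      qed
      moreover have "v > 0" using bad_moebius_nonzeroD(3)[OF u(2)] v by auto
      ultimately have "bad_moebius u = - bad_moebius v" unfolding v using bad_moebius_prime_mult pp(2) by blast
      then have "v \<in> V" using u v \<open>\<not> p dvd v\<close> by (auto simp: V_def)
      then show ?thesis using v by blast
    qed
    have inj: "inj_on ((*) p) X" for X using p1 by (auto simp: inj_on_def)
    have I: "(\<Sum>d | d dvd n \<and> d < Y. bad_moebius d) = (\<Sum>v\<in>{v \<in> V. v < Y \<and> Y \<le> p * v}. bad_moebius v)"
    proof -
      have "(\<Sum>d | d dvd n \<and> d < Y. bad_moebius d) = (\<Sum>d\<in>{v \<in> V. v < Y} \<union> (*) p ` {v \<in> V. p * v < Y}. bad_moebius d)"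
      proof (rule sum.mono_neutral_right[OF fin])
        show "{v \<in> V. v < Y} \<union> (*) p ` {v \<in> V. p * v < Y} \<subseteq> {d. d dvd n \<and> d < Y}"
          using pV by (auto simp: V_def)
        show "\<forall>d\<in>{d. d dvd n \<and> d < Y} - ({v \<in> V. v < Y} \<union> (*) p ` {v \<in> V. p * v < Y}). bad_moebius d = 0"
        proof (rule ballI, rule ccontr)
          fix d assume d: "d \<in> {d. d dvd n \<and> d < Y} - ({v \<in> V. v < Y} \<union> (*) p ` {v \<in> V. p * v < Y})" "bad_moebius d \<noteq> 0"
          show False
          proof (cases "p dvd d")
            case True
            then obtain v where "v \<in> V" "d = p * v" using decomp[of d] d by auto
            then show False using d by auto
          qed (use d in \<open>auto simp: V_def\<close>)
        qed
      qed
      also have "\<dots> = (\<Sum>v\<in>{v \<in> V. v < Y}. bad_moebius v) + (\<Sum>d\<in>(*) p ` {v \<in> V. p * v < Y}. bad_moebius d)"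
        by (intro sum.union_disjoint finite_imageI finV) (auto simp: V_def)
      also have "(\<Sum>d\<in>(*) p ` {v \<in> V. p * v < Y}. bad_moebius d) = (\<Sum>v\<in>{v \<in> V. p * v < Y}. bad_moebius (p * v))"
        by (subst sum.reindex[OF inj]) simp
      also have "\<dots> = - (\<Sum>v\<in>{v \<in> V. p * v < Y}. bad_moebius v)"
        unfolding sum_negf[symmetric] by (intro sum.cong refl nuV) auto
      also have "(\<Sum>v\<in>{v \<in> V. v < Y}. bad_moebius v) = (\<Sum>v\<in>{v \<in> V. v < Y \<and> Y \<le> p * v}. bad_moebius v) + (\<Sum>v\<in>{v \<in> V. p * v < Y}. bad_moebius v)"
      proof -
        have "v < Y" if "p * v < Y" for v
        proof -
          have "1 * v \<le> p * v" using p1 by (intro mult_le_mono1) simp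
          then show ?thesis using that by linarith
        qed
        then have "{v \<in> V. v < Y} = {v \<in> V. v < Y \<and> Y \<le> p * v} \<union> {v \<in> V. p * v < Y}" by auto
        then have "(\<Sum>v\<in>{v \<in> V. v < Y}. bad_moebius v) = (\<Sum>v\<in>{v \<in> V. v < Y \<and> Y \<le> p * v} \<union> {v \<in> V. p * v < Y}. bad_moebius v)"
          by (rule arg_cong)
        also have "\<dots> = (\<Sum>v\<in>{v \<in> V. v < Y \<and> Y \<le> p * v}. bad_moebius v) + (\<Sum>v\<in>{v \<in> V. p * v < Y}. bad_moebius v)"
          by (intro sum.union_disjoint finV) auto
        finally show ?thesis .
      qed
      finally show ?thesis by simp
    qed
    \<comment> \<open>For v > 1, p is at most some prime factor of v, so p v <= Y^2 <= Z. For v = 1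
      the congruence n = 1 modulo 4 enters: n / p is 3 modulo 4, hence has a bad prime factor q >=
      p, and p^2 <= n.\<close>
    have small: "p * v \<le> Z" if v: "v \<in> V" "v < Y" for v
    proof (cases "v = 1")
      case True
      obtain k where k: "n = p * k" using pp(3) by (auto elim: dvdE)
      have "(3 * (k mod 4)) mod 4 = 1" 
        using n(1) pr(2) mod_mult_eq[of p 4 k] unfolding k by simp
      moreover have "k mod 4 = 0 \<or> k mod 4 = 1 \<or> k mod 4 = 2 \<or> k mod 4 = 3" by presburger
      ultimately have "k mod 4 = 3" by auto
      then obtain q where q: "bad_prime q" "q dvd k" using three_mod_four_imp_bad_prime_factor by blast
      then have "p \<le> q" using pmin k by auto
      moreover have "q \<le> k" using q(2) k \<open>n > 0\<close> by (intro dvd_imp_le) auto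
      ultimately have "p * p \<le> n" unfolding k by (intro mult_le_mono2) linarith
      then have "p * p < (Z + 1) * (Z + 1)" using n(2) YZ(3) by linarith
      then have "p < Z + 1" by (metis mult_le_mono not_le)
      then show ?thesis using True by simp
    next
      case False
      have "bad_moebius v \<noteq> 0" using v by (simp add: V_def)
      then obtain q where q: "bad_prime q" "q dvd v" using nu0 False by blast
      then have "p \<le> q" using pmin v by (auto simp: V_def intro: dvd_trans)
      moreover have "q \<le> v" using q(2) Vpos[OF v(1)] by (rule dvd_imp_le)
      ultimately have "p * v \<le> Y * Y" using v(2) by (intro mult_le_mono) auto
      then show ?thesis using YZ(2) by linarith
    qed
    \<comment> \<open>The comparison of least bad primes expresses that u contains the least bad
      prime of n. It involves u and the complementary factor only through one number each, which
      suits a bilinear form.\<close>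
    have II: "(\<Sum>u | u dvd n \<and> u \<le> Z \<and> least_bad_prime N u \<le> least_bad_prime N (n div u). sieve_coeff N Y u)
        = (\<Sum>u\<in>(*) p ` {v \<in> V. v < Y \<and> Y \<le> p * v}. sieve_coeff N Y u)"
    proof (rule sum.mono_neutral_right[OF fin])
      show "(*) p ` {v \<in> V. v < Y \<and> Y \<le> p * v} \<subseteq>
          {u. u dvd n \<and> u \<le> Z \<and> least_bad_prime N u \<le> least_bad_prime N (n div u)}"
      proof (rule image_subsetI)
        fix v assume v: "v \<in> {v \<in> V. v < Y \<and> Y \<le> p * v}"
        then have dv: "p * v dvd n" using pV by auto
        have "least_bad_prime N (p * v) \<le> p" using least_bad_prime_props(1)[of p "p * v"] pp(2) by simp
        also have "p \<le> least_bad_prime N (n div (p * v))"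
        proof (cases "\<exists>q. bad_prime q \<and> q dvd n div (p * v)")
          case True
          then obtain q where q: "bad_prime q" "q dvd n div (p * v)" by blast
          note qq = least_bad_prime_props[OF q, of N]
          have "n div (p * v) dvd n" using dv by (metis dvd_mult_div_cancel dvd_triv_right)
          then show ?thesis using pmin[OF qq(2)] qq(3) dvd_trans by blast
        next
          case False
          \<comment> \<open>Here the default value N + 1 takes effect: it exceeds p because p <= n
            <= N.\<close>
          have "p \<le> n" using pp(3) \<open>n > 0\<close> by (rule dvd_imp_le)
          then show ?thesis using False n(2) by (auto simp: least_bad_prime_def)
        qed
        finally show "p * v \<in> {u. u dvd n \<and> u \<le> Z \<and> least_bad_prime N u \<le> least_bad_prime N (n div u)}"
          using dv small v by auto
      qed
      \<comment> \<open>As p divides u or n div u, the comparison forces the least bad prime of a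
        contributing u to be p itself.\<close>
      show "\<forall>u\<in>{u. u dvd n \<and> u \<le> Z \<and> least_bad_prime N u \<le> least_bad_prime N (n div u)} -
          (*) p ` {v \<in> V. v < Y \<and> Y \<le> p * v}. sieve_coeff N Y u = 0"
      proof (rule ballI, rule ccontr)
        fix u assume u: "u \<in> {u. u dvd n \<and> u \<le> Z \<and> least_bad_prime N u \<le> least_bad_prime N (n div u)} -
          (*) p ` {v \<in> V. v < Y \<and> Y \<le> p * v}" "sieve_coeff N Y u \<noteq> 0"
        then have xu: "bad_moebius u \<noteq> 0" "Y \<le> u" "u div least_bad_prime N u < Y"
          by (auto simp: sieve_coeff_def split: if_splits)
        define q where "q = least_bad_prime N u"
        obtain q' where "bad_prime q'" "q' dvd u" using nu0[OF xu(1)] xu(2) YZ(1) by auto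
        note qq = least_bad_prime_props[OF this, of N, folded q_def]
        have "p \<le> q" using pmin[OF qq(2)] qq(3) u by (auto intro: dvd_trans)
        moreover have "q \<le> p"
        proof -
          have "n = u * (n div u)" using u by simp
          then have "p dvd u \<or> p dvd n div u" using pr(1) pp(3) by (metis prime_dvd_mult_iff)
          then show ?thesis
          proof
            assume "p dvd u"
            then show ?thesis unfolding q_def using least_bad_prime_props(1)[OF pp(2)] by blast
          next
            assume "p dvd n div u"
            then have "least_bad_prime N (n div u) \<le> p" using least_bad_prime_props(1)[OF pp(2)] by blast
            then show ?thesis using u unfolding q_def by auto
          qed
        qed
        ultimately have "q = p" by simp
        then obtain v where v: "v \<in> V" "u = p * v" using decomp[of u] u xu qq(3) by auto
        have "u div p < Y" using xu(3) \<open>q = p\<close> q_def by simp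
        then have "v < Y" using v p1 by simp
        then show False using u v xu(2) by auto
      qed
    qed
    also have "\<dots> = (\<Sum>v\<in>{v \<in> V. v < Y \<and> Y \<le> p * v}. sieve_coeff N Y (p * v))"
      by (subst sum.reindex[OF inj]) simp
    also have "\<dots> = (\<Sum>v\<in>{v \<in> V. v < Y \<and> Y \<le> p * v}. - bad_moebius v)"
    proof (intro sum.cong refl)
      fix v assume v: "v \<in> {v \<in> V. v < Y \<and> Y \<le> p * v}"
      have "least_bad_prime N (p * v) = p"
      proof (rule antisym)
        show "least_bad_prime N (p * v) \<le> p" using least_bad_prime_props(1)[of p "p * v"] pp(2) by simp
        show "p \<le> least_bad_prime N (p * v)"
          using least_bad_prime_props(2,3)[of p "p * v" N] pp(2) pV v by (intro pmin) (auto intro: dvd_trans)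
      qed
      then show "sieve_coeff N Y (p * v) = - bad_moebius v" using v p1 nuV by (simp add: sieve_coeff_def)
    qed
    finally show ?thesis using I False by (simp add: sum_negf)
  qed
qed

section \<open>Exponential sums over sums of two squares\<close>

lemma sum_over_divisors:
  fixes f :: "nat \<Rightarrow> nat \<Rightarrow> 'a :: comm_monoid_add"
  shows "(\<Sum>n=1..N. \<Sum>u | u dvd n. f u (n div u)) = (\<Sum>u=1..N. \<Sum>m=1..N div u. f u m)"
proof -
  have "(\<Sum>n=1..N. \<Sum>u | u dvd n. f u (n div u)) = (\<Sum>(n, u)\<in>(SIGMA n:{1..N}. {u. u dvd n}). f u (n div u))"
    by (rule sum.Sigma) auto
  also have "\<dots> = (\<Sum>(u, m)\<in>(SIGMA u:{1..N}. {1..N div u}). f u m)"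
  proof (rule sum.reindex_bij_witness[of _ "\<lambda>(u, m). (u * m, u)" "\<lambda>(n, u). (u, n div u)"])
    fix a :: "nat \<times> nat" assume "a \<in> (SIGMA n:{1..N}. {u. u dvd n})"
    then obtain u m where a: "a = (u * m, u)" "1 \<le> u * m" "u * m \<le> N" by (auto elim!: dvdE)
    then have pos: "u > 0" "m > 0" by (auto intro: gr0I)
    then show "(case case a of (n, u) \<Rightarrow> (u, n div u) of (u, m) \<Rightarrow> (u * m, u)) = a"
      "(case case a of (n, u) \<Rightarrow> (u, n div u) of (u, m) \<Rightarrow> f u m) = (case a of (n, u) \<Rightarrow> f u (n div u))"
      using a by simp_all
    have "u * 1 \<le> u * m" using pos by (intro mult_le_mono2) simp
    then have "u \<le> N" using a(3) by linarith
    then show "(case a of (n, u) \<Rightarrow> (u, n div u)) \<in> (SIGMA u:{1..N}. {1..N div u})"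
      using a pos by (simp add: less_eq_div_iff_mult_less_eq mult.commute)
  next
    fix b :: "nat \<times> nat" assume "b \<in> (SIGMA u:{1..N}. {1..N div u})"
    then obtain u m where b: "b = (u, m)" "1 \<le> u" "1 \<le> m" "m \<le> N div u" by auto
    then show "(case case b of (u, m) \<Rightarrow> (u * m, u) of (n, u) \<Rightarrow> (u, n div u)) = b" by simp
    have "u * m \<le> N" using b by (simp add: less_eq_div_iff_mult_less_eq mult.commute)
    then show "(case b of (u, m) \<Rightarrow> (u * m, u)) \<in> (SIGMA n:{1..N}. {u. u dvd n})" using b by simp
  qed
  also have "\<dots> = (\<Sum>u=1..N. \<Sum>m=1..N div u. f u m)"
    by (rule sum.Sigma[symmetric]) auto
  finally show ?thesis .
qed

text \<open>Along m = 4 i + r the sum is geometric with ratio e(4 t).\<close>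

lemma norm_sum_expi_residue_class_le:
  assumes "nearest_int_dist (4 * t) > 0" "1 \<le> r" "r < 4"
  shows "norm (\<Sum>m | m \<in> {1..M} \<and> m mod 4 = r. expi (real m * t)) \<le> 1 / (2 * nearest_int_dist (4 * t))"
proof -
  \<comment> \<open>The number of i with 4 i + r <= M; adding 4 before subtracting r avoids
    truncation at zero.\<close>
  define K where "K = (M + 4 - r) div 4"
  have "r = 1 \<or> r = 2 \<or> r = 3" using assms by auto
  then have K: "4 * i + r \<le> M \<longleftrightarrow> i < K" for i unfolding K_def by (elim disjE) (simp, presburger)+
  have "(\<Sum>m | m \<in> {1..M} \<and> m mod 4 = r. expi (real m * t)) = (\<Sum>i<K. expi (real (4 * i + r) * t))"
  proof (rule sum.reindex_bij_witness[of _ "\<lambda>i. 4 * i + r" "\<lambda>m. m div 4"])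
    fix m assume m: "m \<in> {m. m \<in> {1..M} \<and> m mod 4 = r}"
    then show eq: "4 * (m div 4) + r = m" using mult_div_mod_eq[of 4 m] by simp
    then show "m div 4 \<in> {..<K}" using m K[of "m div 4"] by simp
    show "expi (real (4 * (m div 4) + r) * t) = expi (real m * t)" unfolding eq ..
  next
    fix i assume "i \<in> {..<K}"
    then show "(4 * i + r) div 4 = i" "4 * i + r \<in> {m. m \<in> {1..M} \<and> m mod 4 = r}"
      using K[of i] assms by auto
  qed
  also have "\<dots> = (\<Sum>i<K. expi (real r * t) * expi (real i * (4 * t)))"
    by (intro sum.cong refl) (simp add: expi_add[symmetric] algebra_simps)
  also have "\<dots> = expi (real r * t) * (\<Sum>i<K. expi (real i * (4 * t)))" by (simp add: sum_distrib_left)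
  finally show ?thesis using norm_sum_expi_le[OF assms(1), of K] by (simp add: norm_mult)
qed

text \<open>An odd u is its own inverse modulo 4. This separates the congruence for u m into
  conditions on u and on m.\<close>

lemma mult_mod_4_eq_1_iff: "odd u \<Longrightarrow> (u * m) mod 4 = 1 \<longleftrightarrow> m mod 4 = u mod (4 :: nat)"
proof -
  assume "odd u"
  then have "u mod 4 = 1 \<or> u mod 4 = 3" by presburger
  moreover have "(u * m) mod 4 = ((u mod 4) * (m mod 4)) mod 4" by (simp add: mod_mult_eq)
  moreover have "m mod 4 = 0 \<or> m mod 4 = 1 \<or> m mod 4 = 2 \<or> m mod 4 = 3" by presburger
  ultimately show ?thesis by auto
qed

lemma sum_inverse_le_ln: "Q \<ge> 1 \<Longrightarrow> (\<Sum>j=1..Q. 1 / real j) \<le> 1 + ln (real Q)"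
proof (induction Q rule: nat_induct_at_least)
  case (Suc Q)
  have "ln (real Q / real (Suc Q)) \<le> real Q / real (Suc Q) - 1"
    using Suc.hyps by (intro ln_le_minus_one) auto
  also have "\<dots> = - (1 / real (Suc Q))" by (simp add: field_simps)
  finally have "1 / real (Suc Q) \<le> ln (real (Suc Q)) - ln (real Q)"
    using Suc.hyps by (simp add: ln_div)
  then show ?case using Suc.IH by simp
qed simp

section \<open>Estimates for a fixed badly approximable number\<close>

locale badly_approximable =
  fixes \<alpha> \<gamma> :: real
  assumes \<gamma>_pos: "\<gamma> > 0"
    and approx: "\<And>l :: nat. l > 0 \<Longrightarrow> \<gamma> / real l \<le> nearest_int_dist (real l * \<alpha>)"
begin

lemma nid_pos: "l > 0 \<Longrightarrow> nearest_int_dist (real l * \<alpha>) > 0"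
  using order_less_le_trans[OF divide_pos_pos[OF \<gamma>_pos] approx] by simp

text \<open>For odd d the variable m runs through one residue class modulo 4, and ||4 h d alpha|| >=
  gamma / (4 h d) bounds the geometric sum by 2 h d / gamma. There are at most H Y pairs (d,
  h).\<close>

lemma type_I_bound:
  assumes c: "\<And>h. norm (c h) \<le> 1"
  shows "norm (\<Sum>d\<in>{1..<Y}. of_int (bad_moebius d) * (\<Sum>m | m \<in> {1..N div d} \<and> (d * m) mod 4 = 1. exp_poly \<alpha> c H (d * m)))
    \<le> 2 / \<gamma> * (real H * real Y)\<^sup>2"
proof -
  have inner: "norm (\<Sum>m | m \<in> {1..N div d} \<and> (d * m) mod 4 = 1. expi (real h * real (d * m) * \<alpha>)) \<le> 2 * real H * real Y / \<gamma>"
    if d: "d \<in> {1..<Y}" and h: "h \<in> {1..H}" for d h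
  proof (cases "even d")
    case True
    then have "(d * m) mod 4 \<noteq> 1" for m
    proof -
      have "even (x :: nat) \<Longrightarrow> x mod 4 \<noteq> 1" for x by presburger
      then show ?thesis using True by simp
    qed
    then show ?thesis using \<gamma>_pos by simp
  next
    case False
    have r: "d mod 4 = 1 \<or> d mod 4 = 3" using False by presburger
    let ?l = "4 * h * d"
    have t: "4 * (real h * real d * \<alpha>) = real ?l * \<alpha>" by simp
    have l0: "?l > 0" using d h by simp
    have "(\<Sum>m | m \<in> {1..N div d} \<and> (d * m) mod 4 = 1. expi (real h * real (d * m) * \<alpha>))
      = (\<Sum>m | m \<in> {1..N div d} \<and> m mod 4 = d mod 4. expi (real m * (real h * real d * \<alpha>)))"
      unfolding mult_mod_4_eq_1_iff[OF False] by (intro sum.cong refl) (simp add: mult_ac)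
    also have "norm \<dots> \<le> 1 / (2 * nearest_int_dist (real ?l * \<alpha>))"
      unfolding t[symmetric]
    proof (rule norm_sum_expi_residue_class_le)
      show "0 < nearest_int_dist (4 * (real h * real d * \<alpha>))" unfolding t by (rule nid_pos[OF l0])
    qed (use r in auto)
    also have "\<dots> \<le> 1 / (2 * (\<gamma> / real ?l))"
    proof (rule divide_left_mono)
      show "2 * (\<gamma> / real ?l) \<le> 2 * nearest_int_dist (real ?l * \<alpha>)"
        using approx[OF l0] by (rule mult_left_mono) simp
      have "0 < real ?l" using l0 by (simp only: of_nat_0_less_iff)
      then show "0 < 2 * nearest_int_dist (real ?l * \<alpha>) * (2 * (\<gamma> / real ?l))"
        using nid_pos[OF l0] \<gamma>_pos by (intro mult_pos_pos divide_pos_pos) simp_all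
    qed simp
    also have "\<dots> = 2 * real h * real d / \<gamma>" using l0 \<gamma>_pos by (simp add: field_simps)
    also have "\<dots> \<le> 2 * real H * real Y / \<gamma>"
      using d h \<gamma>_pos by (intro divide_right_mono mult_mono) auto
    finally show ?thesis .
  qed
  have "norm (\<Sum>d\<in>{1..<Y}. of_int (bad_moebius d) * (\<Sum>m | m \<in> {1..N div d} \<and> (d * m) mod 4 = 1. exp_poly \<alpha> c H (d * m)))
    \<le> (\<Sum>d\<in>{1..<Y}. \<Sum>h=1..H. 2 * real H * real Y / \<gamma>)"
  proof (rule sum_norm_le)
    fix d assume d: "d \<in> {1..<Y}"
    have "(\<Sum>m | m \<in> {1..N div d} \<and> (d * m) mod 4 = 1. exp_poly \<alpha> c H (d * m))
      = (\<Sum>h=1..H. c h * (\<Sum>m | m \<in> {1..N div d} \<and> (d * m) mod 4 = 1. expi (real h * real (d * m) * \<alpha>)))"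
      unfolding exp_poly_def sum_distrib_left by (rule sum.swap)
    also have "norm \<dots> \<le> (\<Sum>h=1..H. 2 * real H * real Y / \<gamma>)"
    proof (rule sum_norm_le)
      fix h assume h: "h \<in> {1..H}"
      have "norm (c h) * norm (\<Sum>m | m \<in> {1..N div d} \<and> (d * m) mod 4 = 1. expi (real h * real (d * m) * \<alpha>))
         \<le> 1 * (2 * real H * real Y / \<gamma>)"
        using c inner[OF d h] by (intro mult_mono) auto
      then show "norm (c h * (\<Sum>m | m \<in> {1..N div d} \<and> (d * m) mod 4 = 1. expi (real h * real (d * m) * \<alpha>)))
         \<le> 2 * real H * real Y / \<gamma>" by (simp only: norm_mult mult_1)
    qed
    finally have i: "norm (\<Sum>m | m \<in> {1..N div d} \<and> (d * m) mod 4 = 1. exp_poly \<alpha> c H (d * m)) \<le> (\<Sum>h=1..H. 2 * real H * real Y / \<gamma>)" .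
    have "\<bar>real_of_int (bad_moebius d)\<bar> \<le> 1" using abs_bad_moebius_le[of d] by linarith
    then have "norm (complex_of_int (bad_moebius d)) \<le> 1" by simp
    then have "norm (complex_of_int (bad_moebius d)) * norm (\<Sum>m | m \<in> {1..N div d} \<and> (d * m) mod 4 = 1. exp_poly \<alpha> c H (d * m))
       \<le> 1 * (\<Sum>h=1..H. 2 * real H * real Y / \<gamma>)" using i by (intro mult_mono) auto
    then show "norm (of_int (bad_moebius d) * (\<Sum>m | m \<in> {1..N div d} \<and> (d * m) mod 4 = 1. exp_poly \<alpha> c H (d * m)))
       \<le> (\<Sum>h=1..H. 2 * real H * real Y / \<gamma>)" by (simp only: norm_mult mult_1)
  qed
  also have "\<dots> = real (Y - 1) * (real H * (2 * real H * real Y / \<gamma>))" by simp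
  also have "\<dots> \<le> real Y * (real H * (2 * real H * real Y / \<gamma>))"
    using \<gamma>_pos by (intro mult_right_mono) auto
  also have "\<dots> = 2 / \<gamma> * (real H * real Y)\<^sup>2" by (simp add: power2_eq_square)
  finally show ?thesis .
qed

text \<open>Row sum bound valid for all dyadic blocks that meet [Y, Z]: the range of m has length at
  most 2 N / Y, and the frequencies reach at most 2 H Z.\<close>

definition type_II_weight :: "nat \<Rightarrow> nat \<Rightarrow> nat \<Rightarrow> nat \<Rightarrow> nat \<Rightarrow> real" where
  "type_II_weight H D N Y Z = real H * real D * (2 * real N / real Y + (\<Sum>l=1..2*H*Z. 1 / nearest_int_dist (real l * \<alpha>)))"

text \<open>Each of the two truncations costs a factor \<open>J\<close>; the summands + 1 fit them
  to the strict comparison in \<open>triangular_truncation\<close>. With about 2^i values of u and N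
  / 2^i values of m, the product of the norms is at most sqrt(N) for every i.\<close>

lemma type_II_block_bound:
  fixes N Y Z H D J i r :: nat
  assumes c: "\<And>h. norm (c h) \<le> 1"
    and D: "\<And>v. v > 0 \<Longrightarrow> v \<le> 2 * H * Z \<Longrightarrow> card {d. d dvd v} \<le> D"
    and YZ: "1 < Y" "Z \<le> N" "N + 2 < 2 ^ J"
  defines "U \<equiv> {u \<in> {Y..Z}. u mod 4 = r \<and> floor_log u = i}"
  shows "norm (\<Sum>u\<in>U. \<Sum>m\<in>{1..N div 2 ^ i}. of_int (sieve_coeff N Y u) * (if m mod 4 = r then 1 else 0) *
      (if least_bad_prime N u < least_bad_prime N m + 1 then 
         if u < N div m + 1 then exp_poly \<alpha> c H (u * m) else 0 else 0))
    \<le> real J ^ 2 * sqrt (type_II_weight H D N Y Z) * sqrt (real N)"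
proof (cases "U = {}")
  case True
  have "0 \<le> type_II_weight H D N Y Z"
    unfolding type_II_weight_def by (intro mult_nonneg_nonneg add_nonneg_nonneg sum_nonneg) auto
  then show ?thesis unfolding True by simp
next
  case False
  define B where "B = type_II_weight H D N Y Z"
  have B0: "0 \<le> B"
    unfolding B_def type_II_weight_def by (intro mult_nonneg_nonneg add_nonneg_nonneg sum_nonneg) auto
  let ?M = "{1..N div 2 ^ i}"
  have Uu: "2 ^ i \<le> u" "u < 2 ^ (i + 1)" "Y \<le> u" "u \<le> Z" if "u \<in> U" for u
  proof -
    have u: "Y \<le> u" "u \<le> Z" "floor_log u = i" using that by (auto simp: U_def)
    then have "u > 0" using YZ by simp
    then show "2 ^ i \<le> u" "u < 2 ^ (i + 1)"
      using floor_log_exp2_le[of u] floor_log_exp2_gt[of u] u(3) by auto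
    show "Y \<le> u" "u \<le> Z" using u by auto
  qed
  obtain u0 where u0: "u0 \<in> U" using False by blast
  \<comment> \<open>Any element of the block locates 2^i between Y / 2 and Z.\<close>
  have i1: "2 ^ i \<le> Z" "Y \<le> 2 * 2 ^ i" using Uu[OF u0] by auto
  have finU: "finite U" by (simp add: U_def)
  have Usub: "U \<subseteq> {1..2 ^ (i + 1)}"
  proof
    fix u assume "u \<in> U"
    then show "u \<in> {1..2 ^ (i + 1)}" using Uu(2,3)[of u] YZ(1) by simp
  qed
  define K where "K u m = exp_poly \<alpha> c H (u * m)" for u m
  have HU: "H * 2 ^ (i + 1) \<le> 2 * H * Z" using i1(1) by simp
  have row: "(\<Sum>u'\<in>U. norm (\<Sum>m\<in>?M. K u m * cnj (K u' m))) \<le> B" if u: "u \<in> U" for u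
  proof -
    have "(\<Sum>u'\<in>U. norm (\<Sum>m\<in>?M. K u m * cnj (K u' m))) \<le> (\<Sum>u'\<in>{1..2 ^ (i + 1)}. norm (\<Sum>m\<in>?M. K u m * cnj (K u' m)))"
      using Usub by (intro sum_mono2) auto
    also have "\<dots> \<le> real H * real D * (real (N div 2 ^ i) + (\<Sum>l=1..H*2 ^ (i + 1). 1 / nearest_int_dist (real l * \<alpha>)))"
      unfolding K_def
    proof (rule exp_poly_row_sum_le)
      show "card {d. d dvd v} \<le> D" if "0 < v" "v \<le> H * 2 ^ (i + 1)" for v
        using D[OF that(1)] that(2) HU by linarith
    qed (use nid_pos c Usub u in auto)
    also have "\<dots> \<le> B" unfolding B_def type_II_weight_def
    proof (intro mult_left_mono add_mono)
      have "real (N div 2 ^ i) \<le> real N / real (2 ^ i)" by (rule of_nat_div_le_of_nat)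
      also have "\<dots> \<le> real N / (real Y / 2)"
      proof (rule divide_left_mono)
        have "real Y \<le> real (2 * 2 ^ i)" using i1(2) by (simp only: of_nat_le_iff)
        then show "real Y / 2 \<le> real (2 ^ i)" by simp
      qed (use YZ in auto)
      finally show "real (N div 2 ^ i) \<le> 2 * real N / real Y" by (simp add: mult.commute)
      show "(\<Sum>l=1..H*2 ^ (i + 1). 1 / nearest_int_dist (real l * \<alpha>)) \<le> (\<Sum>l=1..2*H*Z. 1 / nearest_int_dist (real l * \<alpha>))"
        using HU by (intro sum_mono2) auto
    qed auto
    finally show ?thesis .
  qed
  have b0: "norm (\<Sum>u\<in>U. \<Sum>m\<in>?M. x u * y m * K u m) \<le> sqrt B * L2_set (norm \<circ> x) U * L2_set (norm \<circ> y) ?M" for x y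
    using finU row B0 by (intro bilinear_form_bound) auto
  \<comment> \<open>First truncation, u <= N div m; its result is the hypothesis for the second
    one.\<close>
  have b1: "norm (\<Sum>u\<in>U. \<Sum>m\<in>?M. x u * y m * (if u < N div m + 1 then K u m else 0))
      \<le> real J * sqrt B * L2_set (norm \<circ> x) U * L2_set (norm \<circ> y) ?M" for x y
  proof (rule triangular_truncation[where a = "\<lambda>u. u" and b = "\<lambda>m. N div m + 1"])
    show "u < 2 ^ J" if "u \<in> U" for u using Uu(4)[OF that] YZ by linarith
    show "N div m + 1 < 2 ^ J" if "m \<in> ?M" for m using div_le_dividend[of N m] YZ by linarith
  qed (use b0 B0 in auto)
  define x where "x u = complex_of_int (sieve_coeff N Y u)" for u
  define y :: "nat \<Rightarrow> complex" where "y m = (if m mod 4 = r then 1 else 0)" for m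
  have "norm (\<Sum>u\<in>U. \<Sum>m\<in>?M. x u * y m * (if least_bad_prime N u < least_bad_prime N m + 1 then 
         (if u < N div m + 1 then K u m else 0) else 0))
    \<le> real J * (real J * sqrt B) * L2_set (norm \<circ> x) U * L2_set (norm \<circ> y) ?M"
  proof (rule triangular_truncation[where a = "least_bad_prime N" and b = "\<lambda>m. least_bad_prime N m + 1"])
    show "least_bad_prime N u < 2 ^ J" if "u \<in> U" for u
    proof -
      have "least_bad_prime N u \<le> max u (N + 1)" using Uu(3)[OF that] YZ by (intro least_bad_prime_le) auto
      then show ?thesis using Uu(4)[OF that] YZ by linarith
    qed
    show "least_bad_prime N m + 1 < 2 ^ J" if "m \<in> ?M" for m
    proof -
      have "least_bad_prime N m \<le> max m (N + 1)" using that by (intro least_bad_prime_le) auto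
      moreover have "m \<le> N" using that by (meson atLeastAtMost_iff div_le_dividend le_trans)
      ultimately show ?thesis using YZ by linarith
    qed
  qed (use b1 B0 in auto)
  also have "\<dots> = real J ^ 2 * sqrt B * (L2_set (norm \<circ> x) U * L2_set (norm \<circ> y) ?M)"
    by (simp add: power2_eq_square)
  also have "\<dots> \<le> real J ^ 2 * sqrt B * (sqrt (2 ^ i) * sqrt (real N / 2 ^ i))"
  proof (intro mult_left_mono mult_mono)
    have xle: "norm (x u) \<le> 1" for u
    proof -
      have "\<bar>sieve_coeff N Y u\<bar> \<le> 1" using abs_bad_moebius_le[of u] by (auto simp: sieve_coeff_def)
      then have "\<bar>real_of_int (sieve_coeff N Y u)\<bar> \<le> 1" by linarith
      then show ?thesis by (simp add: x_def)
    qed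
    have "(\<Sum>u\<in>U. ((norm \<circ> x) u)\<^sup>2) \<le> (\<Sum>u\<in>U. 1)"
      using xle by (intro sum_mono) (simp add: power_le_one)
    also have "\<dots> \<le> real (card {2 ^ i..<2 ^ (i + 1) :: nat})"
    proof -
      have "U \<subseteq> {2 ^ i..<2 ^ (i + 1)}" using Uu(1,2) by auto
      then have "card U \<le> card {2 ^ i..<2 ^ (i + 1) :: nat}" by (intro card_mono) auto
      then show ?thesis by simp
    qed
    also have "\<dots> = 2 ^ i" by simp
    finally show "L2_set (norm \<circ> x) U \<le> sqrt (2 ^ i)" unfolding L2_set_def by simp
    have "(\<Sum>m\<in>?M. ((norm \<circ> y) m)\<^sup>2) \<le> (\<Sum>m\<in>?M. 1)" by (intro sum_mono) (simp add: y_def)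
    also have "\<dots> = real (N div 2 ^ i)" by simp
    also have "\<dots> \<le> real N / real (2 ^ i)" by (rule of_nat_div_le_of_nat)
    finally show "L2_set (norm \<circ> y) ?M \<le> sqrt (real N / 2 ^ i)" unfolding L2_set_def by simp
  qed (use B0 in \<open>auto simp: L2_set_nonneg\<close>)
  also have "sqrt (2 ^ i) * sqrt (real N / 2 ^ i) = sqrt (real N)"
    by (simp add: real_sqrt_mult[symmetric])
  finally show ?thesis unfolding x_def y_def K_def B_def .
qed

text \<open>The sieve identity splits the sum into small divisors and a bilinear form. The latter
  falls into 4 J blocks, each bounded with a factor J^2 from its truncations, whence 4 J^3.\<close>

lemma exponential_sum_explicit:
  fixes N Y Z H D J :: nat
  assumes c: "\<And>h. norm (c h) \<le> 1"
    and D: "\<And>v. v > 0 \<Longrightarrow> v \<le> 2 * H * Z \<Longrightarrow> card {d. d dvd v} \<le> D"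
    and YZ: "1 < Y" "Y * Y \<le> Z" "Z \<le> N" "N < (Z + 1) * (Z + 1)" "N + 2 < 2 ^ J"
  shows "norm (\<Sum>b | b \<in> coprime_square_sums \<and> b \<le> N. exp_poly \<alpha> c H b)
    \<le> 2 / \<gamma> * (real H * real Y)\<^sup>2 + 4 * real J ^ 3 * sqrt (type_II_weight H D N Y Z) * sqrt (real N)"
proof -
  define E where "E = exp_poly \<alpha> c H"
  define f1 where "f1 d m = (if (d * m) mod 4 = 1 \<and> d < Y then of_int (bad_moebius d) * E (d * m) else 0)" for d m
  define f2 where "f2 u m = (if (u * m) mod 4 = 1 \<and> u \<le> Z \<and> least_bad_prime N u \<le> least_bad_prime N m
      then of_int (sieve_coeff N Y u) * E (u * m) else 0)" for u m
  have YN: "Y \<le> N" using YZ by (metis le_square le_trans)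
  have "(\<Sum>b | b \<in> coprime_square_sums \<and> b \<le> N. E b) =
      (\<Sum>n=1..N. if n \<in> coprime_square_sums then E n else 0)"
  proof -
    have "0 \<notin> coprime_square_sums" by (simp add: coprime_square_sums_def)
    then have "{b. b \<in> coprime_square_sums \<and> b \<le> N} = {n \<in> {1..N}. n \<in> coprime_square_sums}"
      by (auto simp: Suc_le_eq intro: gr0I)
    then show ?thesis by (simp only: sum.inter_filter finite_atLeastAtMost)
  qed
  also have "\<dots> = (\<Sum>n=1..N. (\<Sum>u | u dvd n. f1 u (n div u)) + (\<Sum>u | u dvd n. f2 u (n div u)))"
  proof (intro sum.cong refl)
    fix n assume n: "n \<in> {1..N}"
    have fin: "finite {u. u dvd n}" using n by simp
    show "(if n \<in> coprime_square_sums then E n else 0) =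
        (\<Sum>u | u dvd n. f1 u (n div u)) + (\<Sum>u | u dvd n. f2 u (n div u))"
    proof (cases "n mod 4 = 1")
      case False
      then have "n \<notin> coprime_square_sums" using coprime_square_sums_mod_4 by blast
      moreover have "(\<Sum>u | u dvd n. f1 u (n div u)) = 0" "(\<Sum>u | u dvd n. f2 u (n div u)) = 0"
        using False by (auto simp: f1_def f2_def intro!: sum.neutral)
      ultimately show ?thesis by simp
    next
      case True
      have "(\<Sum>u | u dvd n. f1 u (n div u)) = (\<Sum>u\<in>{u. u dvd n}. if u < Y then of_int (bad_moebius u) * E n else 0)"
        using True by (intro sum.cong refl) (auto simp: f1_def)
      also have "\<dots> = (\<Sum>u | u dvd n \<and> u < Y. of_int (bad_moebius u) * E n)"
        unfolding sum.inter_filter[OF fin, symmetric] by simp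
      also have "\<dots> = of_int (\<Sum>u | u dvd n \<and> u < Y. bad_moebius u) * E n" by (simp add: sum_distrib_right)
      finally have 1: "(\<Sum>u | u dvd n. f1 u (n div u)) = \<dots>" .
      have "(\<Sum>u | u dvd n. f2 u (n div u)) =
          (\<Sum>u\<in>{u. u dvd n}. if u \<le> Z \<and> least_bad_prime N u \<le> least_bad_prime N (n div u) then of_int (sieve_coeff N Y u) * E n else 0)"
        using True by (intro sum.cong refl) (auto simp: f2_def)
      also have "\<dots> = (\<Sum>u | u dvd n \<and> u \<le> Z \<and> least_bad_prime N u \<le> least_bad_prime N (n div u). of_int (sieve_coeff N Y u) * E n)"
        unfolding sum.inter_filter[OF fin, symmetric] by simp
      also have "\<dots> = of_int (\<Sum>u | u dvd n \<and> u \<le> Z \<and> least_bad_prime N u \<le> least_bad_prime N (n div u). sieve_coeff N Y u) * E n"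
        by (simp add: sum_distrib_right)
      finally have 2: "(\<Sum>u | u dvd n. f2 u (n div u)) = \<dots>" .
      have "(if n \<in> coprime_square_sums then E n else 0) = of_int (if n \<in> coprime_square_sums then 1 else 0) * E n" by simp
      also have "\<dots> = (\<Sum>u | u dvd n. f1 u (n div u)) + (\<Sum>u | u dvd n. f2 u (n div u))"
        unfolding 1 2 distrib_right[symmetric] of_int_add[symmetric]
        by (subst sieve_identity[OF True _ YZ(1,2,4)]) (use n in auto)
      finally show ?thesis .
    qed
  qed
  also have "\<dots> = (\<Sum>u=1..N. \<Sum>m=1..N div u. f1 u m) + (\<Sum>u=1..N. \<Sum>m=1..N div u. f2 u m)"
    unfolding sum.distrib sum_over_divisors ..
  finally have split: "(\<Sum>b | b \<in> coprime_square_sums \<and> b \<le> N. E b) =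
      (\<Sum>u=1..N. \<Sum>m=1..N div u. f1 u m) + (\<Sum>u=1..N. \<Sum>m=1..N div u. f2 u m)" .
  have "(\<Sum>u=1..N. \<Sum>m=1..N div u. f1 u m) = (\<Sum>u\<in>{1..<Y}. \<Sum>m=1..N div u. f1 u m)"
    using YN by (intro sum.mono_neutral_right) (auto simp: f1_def)
  also have "\<dots> = (\<Sum>d\<in>{1..<Y}. of_int (bad_moebius d) * (\<Sum>m | m \<in> {1..N div d} \<and> (d * m) mod 4 = 1. E (d * m)))"
  proof (intro sum.cong refl)
    fix d assume d: "d \<in> {1..<Y}"
    have "(\<Sum>m=1..N div d. f1 d m) = (\<Sum>m\<in>{1..N div d}. if (d * m) mod 4 = 1 then of_int (bad_moebius d) * E (d * m) else 0)"
      using d by (intro sum.cong refl) (auto simp: f1_def)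
    also have "\<dots> = (\<Sum>m | m \<in> {1..N div d} \<and> (d * m) mod 4 = 1. of_int (bad_moebius d) * E (d * m))"
      by (rule sum.inter_filter[symmetric]) simp
    finally show "(\<Sum>m=1..N div d. f1 d m) = of_int (bad_moebius d) * (\<Sum>m | m \<in> {1..N div d} \<and> (d * m) mod 4 = 1. E (d * m))"
      by (simp add: sum_distrib_left)
  qed
  finally have I: "norm (\<Sum>u=1..N. \<Sum>m=1..N div u. f1 u m) \<le> 2 / \<gamma> * (real H * real Y)\<^sup>2"
    unfolding E_def using type_I_bound[OF c] by simp
  define W where "W u = (\<Sum>m=1..N div u. f2 u m)" for u
  \<comment> \<open>Fixing the residue r of u turns u m = 1 modulo 4 into m = r modulo 4, a weight
    in m alone.\<close>
  define block where "block k = {u \<in> {Y..Z}. (u mod 4, floor_log u) = k}" for k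
  define bd where "bd = real J ^ 2 * sqrt (type_II_weight H D N Y Z) * sqrt (real N)"
  have "(\<Sum>u=1..N. W u) = (\<Sum>u\<in>{Y..Z}. W u)"
    using YZ by (intro sum.mono_neutral_right) (auto simp: W_def f2_def sieve_coeff_def intro!: sum.neutral)
  also have "\<dots> = (\<Sum>k\<in>{..<4} \<times> {..<J}. \<Sum>u\<in>block k. W u)"
    unfolding block_def
  proof (rule sum.group[symmetric])
    have "floor_log u < J" if "u \<in> {Y..Z}" for u
    proof (rule ccontr)
      assume "\<not> floor_log u < J"
      then have "(2::nat) ^ J \<le> 2 ^ floor_log u" by (intro power_increasing) auto
      also have "\<dots> \<le> u" using that YZ by (intro floor_log_exp2_le) auto
      finally show False using that YZ by auto
    qed
    then show "(\<lambda>u. (u mod 4, floor_log u)) ` {Y..Z} \<subseteq> {..<4} \<times> {..<J}" by auto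
  qed auto
  also have "norm \<dots> \<le> (\<Sum>k\<in>{..<4::nat} \<times> {..<J}. bd)"
  proof (rule sum_norm_le)
    fix k :: "nat \<times> nat" assume "k \<in> {..<4} \<times> {..<J}"
    obtain r i where k: "k = (r, i)" by (cases k)
    have bl: "block k = {u \<in> {Y..Z}. u mod 4 = r \<and> floor_log u = i}" by (auto simp: block_def k)
    have "W u = (\<Sum>m\<in>{1..N div 2 ^ i}. of_int (sieve_coeff N Y u) * (if m mod 4 = r then 1 else 0) *
      (if least_bad_prime N u < least_bad_prime N m + 1 then 
         if u < N div m + 1 then E (u * m) else 0 else 0))" if u: "u \<in> block k" for u
    proof (cases "sieve_coeff N Y u = 0")
      case True
      then have "f2 u m = 0" for m by (simp add: f2_def)
      then show ?thesis using True by (simp add: W_def)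
    next
      case False
      then have "bad_moebius u \<noteq> 0" by (auto simp: sieve_coeff_def split: if_splits)
      then have odd: "odd u" by (rule bad_moebius_nonzeroD(4))
      have u': "Y \<le> u" "u \<le> Z" "u mod 4 = r" "floor_log u = i" using u by (auto simp: bl)
      then have "u > 0" using YZ by simp
      \<comment> \<open>The range of m is enlarged to one that does not depend on u; the factor with
        u < N div m + 1 removes the added terms.\<close>
      have "2 ^ i \<le> u" using floor_log_exp2_le[OF \<open>u > 0\<close>] u'(4) by simp
      then have sub: "N div u \<le> N div 2 ^ i" by (intro div_le_mono2) auto
      show ?thesis unfolding W_def
      proof (rule sum.mono_neutral_cong_left)
        show "{1..N div u} \<subseteq> {1..N div 2 ^ i}" using sub by auto
        have iff: "u < N div m + 1 \<longleftrightarrow> m \<le> N div u" if "m \<ge> 1" for m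
          using that \<open>u > 0\<close> by (simp add: less_Suc_eq_le less_eq_div_iff_mult_less_eq mult.commute)
        show "\<forall>m\<in>{1..N div 2 ^ i} - {1..N div u}. of_int (sieve_coeff N Y u) * (if m mod 4 = r then 1 else 0) *
           (if least_bad_prime N u < least_bad_prime N m + 1 then if u < N div m + 1 then E (u * m) else 0 else 0) = 0"
          using iff by auto
        show "f2 u m = of_int (sieve_coeff N Y u) * (if m mod 4 = r then 1 else 0) *
           (if least_bad_prime N u < least_bad_prime N m + 1 then if u < N div m + 1 then E (u * m) else 0 else 0)"
          if "m \<in> {1..N div u}" for m
          using that iff[of m] u' mult_mod_4_eq_1_iff[OF odd, of m] by (auto simp: f2_def)
      qed simp
    qed
    then have "(\<Sum>u\<in>block k. W u) = (\<Sum>u\<in>block k. \<Sum>m\<in>{1..N div 2 ^ i}. of_int (sieve_coeff N Y u) * (if m mod 4 = r then 1 else 0) *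
      (if least_bad_prime N u < least_bad_prime N m + 1 then 
         if u < N div m + 1 then E (u * m) else 0 else 0))" by (intro sum.cong refl)
    also have "norm \<dots> \<le> bd"
      unfolding bl bd_def E_def by (rule type_II_block_bound) (use c D YZ in auto)
    finally show "norm (\<Sum>u\<in>block k. W u) \<le> bd" .
  qed
  also have "\<dots> = 4 * real J ^ 3 * sqrt (type_II_weight H D N Y Z) * sqrt (real N)"
    by (simp add: bd_def power2_eq_square power3_eq_cube card_cartesian_product)
  finally have II: "norm (\<Sum>u=1..N. \<Sum>m=1..N div u. f2 u m)
      \<le> 4 * real J ^ 3 * sqrt (type_II_weight H D N Y Z) * sqrt (real N)"
    unfolding W_def .
  show ?thesis using norm_triangle_mono[OF I II] unfolding split[symmetric] E_def .
qed

text \<open>With Y about N^(1/4), both terms of the row sum bound are at most about N^(theta + 3/4)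
  = N^(1 - kappa), so the bilinear part is about N^(1 - kappa/2). Half of this saving pays for
  divisor and logarithmic factors.\<close>

lemma exponential_sum_bound:
  fixes \<theta> :: real
  assumes \<theta>: "0 < \<theta>" "\<theta> < 1 / 4"
  obtains C where "C > 0"
    "\<And>(N :: nat) (H :: nat) c. N \<ge> 16 \<Longrightarrow> real H \<le> real N powr \<theta> \<Longrightarrow> (\<And>h. norm (c h) \<le> 1) \<Longrightarrow>
      norm (\<Sum>b | b \<in> coprime_square_sums \<and> b \<le> N. exp_poly \<alpha> c H b) \<le> C * real N powr (1 - (1 / 4 - \<theta>) / 4)"
proof -
  define \<kappa> where "\<kappa> = 1 / 4 - \<theta>"
  \<comment> \<open>The exponents sum to 3 eps + (1 - kappa + eps) / 2 + 1/2 = 1 - kappa/2 + 7 eps /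
    2, which for eps = kappa / 14 is 1 - kappa/4.\<close>
  define \<epsilon> where "\<epsilon> = \<kappa> / 14"
  have \<kappa>: "0 < \<kappa>" "\<kappa> < 1 / 4" and \<epsilon>: "\<epsilon> > 0" using \<theta> by (auto simp: \<kappa>_def \<epsilon>_def)
  \<comment> \<open>Exponent eps / 2, because the arguments v are bounded only by N^2.\<close>
  obtain CD where CD: "CD > 0" "\<And>n :: nat. n > 0 \<Longrightarrow> real (card {d. d dvd n}) \<le> CD * real n powr (\<epsilon> / 2)"
    using divisor_bound[of "\<epsilon> / 2"] \<epsilon> by auto
  define CJ where "CJ = 1 + 3 powr \<epsilon> / (\<epsilon> * ln 2)"
  define q where "q = 2 / \<gamma> + 1"
  define CS where "CS = 2 * q * ((1 + 1 / \<epsilon>) * q powr \<epsilon>)"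
  define CW where "CW = CD * (4 + CS)"
  define C where "C = 2 / \<gamma> + 4 * CJ ^ 3 * sqrt CW"
  have pos: "CJ > 0" "q > 1" "CS > 0" "CW > 0" "C > 0"
  proof -
    show 1: "CJ > 0" using \<epsilon> by (simp add: CJ_def add_pos_nonneg)
    show 2: "q > 1" using \<gamma>_pos by (simp add: q_def)
    then show 3: "CS > 0" using \<epsilon> by (simp add: CS_def add_pos_pos)
    then show 4: "CW > 0" using CD by (simp add: CW_def)
    show "C > 0" using 1 4 \<gamma>_pos by (simp add: C_def add_pos_pos)
  qed
  show ?thesis
  proof (rule that[OF pos(5)])
    fix N H :: nat and c :: "nat \<Rightarrow> complex"
    assume N: "N \<ge> 16" and H: "real H \<le> real N powr \<theta>" and c: "\<And>h. norm (c h) \<le> 1"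
    define Z where "Z = floor_sqrt N"
    define Y where "Y = floor_sqrt Z"
    define J where "J = floor_log (N + 2) + 1"
    define D where "D = nat \<lfloor>CD * real N powr \<epsilon>\<rfloor>"
    define n where "n = real N"
    have n: "n \<ge> 16" using N by (simp add: n_def)
    then have n0: "n > 0" "n \<ge> 1" by auto
    have Z1: "Z * Z \<le> N" using floor_sqrt_power2_le[of N] by (simp add: Z_def power2_eq_square)
    have Z2: "N < (Z + 1) * (Z + 1)" using Suc_floor_sqrt_power2_gt[of N] by (simp add: Z_def power2_eq_square)
    have Y1: "Y * Y \<le> Z" using floor_sqrt_power2_le[of Z] by (simp add: Y_def power2_eq_square)
    have Y2: "Z < (Y + 1) * (Y + 1)" using Suc_floor_sqrt_power2_gt[of Z] by (simp add: Y_def power2_eq_square)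
    \<comment> \<open>N >= 16 gives Z >= 4 and then Y >= 2.\<close>
    have "4 * 4 < (Z + 1) * (Z + 1)" using Z2 N by linarith
    then have "4 < Z + 1" by (metis mult_le_mono not_le)
    then have "2 * 2 < (Y + 1) * (Y + 1)" using Y2 by linarith
    then have "2 < Y + 1" by (metis mult_le_mono not_le)
    then have Y3: "1 < Y" by simp
    have ZN: "Z \<le> N" using Z1 by (metis le_square le_trans)
    have J1: "N + 2 < 2 ^ J" using floor_log_exp2_gt[of "N + 2"] by (simp add: J_def)
    have Zle: "real Z \<le> n powr (1 / 2)"
    proof -
      have "(real Z)\<^sup>2 \<le> n" using Z1 unfolding n_def power2_eq_square by (simp only: of_nat_mult[symmetric] of_nat_le_iff)
      then have "real Z \<le> sqrt n" by (rule real_le_rsqrt)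
      then show ?thesis using n0 by (simp add: powr_half_sqrt)
    qed
    have Yle: "real Y \<le> n powr (1 / 4)"
    proof -
      have "(real Y)\<^sup>2 \<le> real Z" using Y1 unfolding power2_eq_square by (simp only: of_nat_mult[symmetric] of_nat_le_iff)
      also have "\<dots> \<le> n powr (1 / 2)" by (rule Zle)
      also have "\<dots> = (n powr (1 / 4))\<^sup>2" by (simp add: power2_eq_square powr_add[symmetric])
      finally show ?thesis by (rule power2_le_imp_le) simp
    qed
    have Yge: "n powr (1 / 4) \<le> 2 * real Y"
    proof -
      have "Z + 1 \<le> (Y + 1) * (Y + 1)" using Y2 by simp
      then have "(Z + 1) * (Z + 1) \<le> (Y + 1) * (Y + 1) * ((Y + 1) * (Y + 1))" by (rule mult_le_mono) (use Y2 in simp)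
      moreover have "(Y + 1) ^ 4 = (Y + 1) * (Y + 1) * ((Y + 1) * (Y + 1))"
        by (simp only: power4_eq_xxxx mult.assoc)
      ultimately have "N \<le> (Y + 1) ^ 4" using Z2 by linarith
      then have "n \<le> real (Y + 1) ^ 4" unfolding n_def by (simp only: of_nat_power[symmetric] of_nat_le_iff)
      then have "n powr (1 / 4) \<le> (real (Y + 1) ^ 4) powr (1 / 4)" using n0 by (intro powr_mono2) auto
      also have "\<dots> = real (Y + 1)" by (simp add: powr_realpow[symmetric] powr_powr del: powr_numeral)
      also have "\<dots> \<le> 2 * real Y" using Y3 by simp
      finally show ?thesis .
    qed
    have HZ: "real (2 * H * Z) \<le> 2 * n powr (\<theta> + 1 / 2)"
    proof -
      have "real H * real Z \<le> n powr \<theta> * n powr (1 / 2)" using H Zle unfolding n_def by (intro mult_mono) auto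
      then show ?thesis by (simp add: powr_add)
    qed
    have J2: "real J \<le> CJ * n powr \<epsilon>"
    proof -
      have "(2::nat) ^ (J - 1) \<le> N + 2" unfolding J_def using floor_log_exp2_le[of "N + 2"] by simp
      then have "real (2 ^ (J - 1)) \<le> real (N + 2)" by (simp only: of_nat_le_iff)
      also have "\<dots> \<le> 3 * n" using N by (simp add: n_def)
      finally have "ln (2 ^ (J - 1)) \<le> ln (3 * n)" using n0 by (intro ln_mono) auto
      then have "real (J - 1) * ln 2 \<le> ln (3 * n)" by (simp add: ln_realpow)
      also have "\<dots> \<le> (3 * n) powr \<epsilon> / \<epsilon>" using n0 \<epsilon> by (intro ln_powr_bound) auto
      also have "\<dots> = 3 powr \<epsilon> * n powr \<epsilon> / \<epsilon>" using n0 by (simp add: powr_mult)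
      finally have "real (J - 1) \<le> 3 powr \<epsilon> / (\<epsilon> * ln 2) * n powr \<epsilon>" using \<epsilon> by (simp add: field_simps)
      moreover have "real J = 1 + real (J - 1)" by (simp add: J_def)
      moreover have "1 \<le> n powr \<epsilon>" using n0 \<epsilon> by (intro ge_one_powr_ge_zero) auto
      ultimately show ?thesis unfolding CJ_def distrib_right by linarith
    qed
    have D1: "card {d. d dvd v} \<le> D" if v: "v > 0" "v \<le> 2 * H * Z" for v
    proof -
      have "real v \<le> real (2 * H * Z)" using v(2) by (simp only: of_nat_le_iff)
      also have "\<dots> \<le> 2 * n powr (\<theta> + 1 / 2)" by (rule HZ)
      also have "\<dots> \<le> n * n powr 1" using n \<theta> by (intro mult_mono powr_mono) auto
      also have "\<dots> = n powr 2" using n0 by (simp add: powr_numeral power2_eq_square)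
      finally have "real v powr (\<epsilon> / 2) \<le> (n powr 2) powr (\<epsilon> / 2)" using \<epsilon> by (intro powr_mono2) auto
      also have "\<dots> = n powr \<epsilon>" by (simp add: powr_powr)
      finally have "CD * real v powr (\<epsilon> / 2) \<le> CD * n powr \<epsilon>" using CD by (intro mult_left_mono) auto
      then show ?thesis using CD(2)[OF v(1)] unfolding D_def n_def by (simp add: le_nat_iff le_floor_iff)
    qed
    have D2: "real D \<le> CD * n powr \<epsilon>" using CD by (simp add: D_def n_def)
    have S: "(\<Sum>l=1..2*H*Z. 1 / nearest_int_dist (real l * \<alpha>)) \<le> CS * n powr (\<theta> + 1 / 2 + \<epsilon>)"
    proof -
      \<comment> \<open>The least \<open>Q\<close> that satisfies 2 H Z <= gamma Q when H Z is
        replaced by its bound n^(theta + 1/2).\<close>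
      define Q where "Q = nat \<lceil>2 * n powr (\<theta> + 1 / 2) / \<gamma>\<rceil>"
      have arg: "0 < 2 * n powr (\<theta> + 1 / 2) / \<gamma>" using n0 \<gamma>_pos by simp
      have p1: "1 \<le> n powr (\<theta> + 1 / 2)" using n0 \<theta> by (intro ge_one_powr_ge_zero) auto
      have Q1: "2 * n powr (\<theta> + 1 / 2) / \<gamma> \<le> real Q" unfolding Q_def using arg by linarith
      then have Q2: "Q \<ge> 1" using arg by (cases Q) auto
      have "real Q \<le> 2 * n powr (\<theta> + 1 / 2) / \<gamma> + 1" unfolding Q_def using arg by linarith
      also have "\<dots> \<le> q * n powr (\<theta> + 1 / 2)" using p1 by (simp add: q_def distrib_right)
      finally have Q3: "real Q \<le> q * n powr (\<theta> + 1 / 2)" .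
      have "(\<Sum>l=1..2*H*Z. 1 / nearest_int_dist (real l * \<alpha>)) \<le> 2 * real Q * (\<Sum>j=1..Q. 1 / real j)"
      proof (rule sum_inverse_nearest_int_dist_le[OF \<gamma>_pos approx])
        have "2 * n powr (\<theta> + 1 / 2) \<le> \<gamma> * real Q" using Q1 \<gamma>_pos by (simp add: field_simps)
        then show "real (2 * H * Z) \<le> \<gamma> * real Q" using HZ by linarith
      qed
      also have "\<dots> \<le> 2 * (q * n powr (\<theta> + 1 / 2)) * ((1 + 1 / \<epsilon>) * (q powr \<epsilon> * n powr \<epsilon>))"
      proof (intro mult_mono)
        have "(\<Sum>j=1..Q. 1 / real j) \<le> 1 + ln (real Q)" by (rule sum_inverse_le_ln[OF Q2])
        also have "\<dots> \<le> 1 + real Q powr \<epsilon> / \<epsilon>" using Q2 \<epsilon> by (intro add_left_mono ln_powr_bound) auto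
        also have "\<dots> \<le> real Q powr \<epsilon> + real Q powr \<epsilon> / \<epsilon>"
          using Q2 \<epsilon> by (intro add_right_mono ge_one_powr_ge_zero) auto
        also have "\<dots> = (1 + 1 / \<epsilon>) * real Q powr \<epsilon>" by (simp add: distrib_right)
        also have "\<dots> \<le> (1 + 1 / \<epsilon>) * (q powr \<epsilon> * n powr \<epsilon>)"
        proof (rule mult_left_mono)
          have "n powr (\<theta> + 1 / 2) \<le> n powr 1" using n0 \<theta> by (intro powr_mono) auto
          then have "real Q \<le> q * n" using Q3 pos(2) n0 by (smt (verit) mult_left_mono powr_one)
          then have "real Q powr \<epsilon> \<le> (q * n) powr \<epsilon>" using \<epsilon> by (intro powr_mono2) auto
          then show "real Q powr \<epsilon> \<le> q powr \<epsilon> * n powr \<epsilon>" using pos(2) n0 by (simp add: powr_mult)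
        qed (use \<epsilon> in auto)
        finally show "(\<Sum>j=1..Q. 1 / real j) \<le> (1 + 1 / \<epsilon>) * (q powr \<epsilon> * n powr \<epsilon>)" .
      qed (use Q3 pos(2) in \<open>auto intro: sum_nonneg\<close>)
      also have "\<dots> = CS * n powr (\<theta> + 1 / 2 + \<epsilon>)" by (simp add: CS_def powr_add)
      finally show ?thesis .
    qed
    have W: "type_II_weight H D N Y Z \<le> CW * n powr (1 - \<kappa> + \<epsilon>)"
    proof -
      have "type_II_weight H D N Y Z \<le> n powr \<theta> * (CD * n powr \<epsilon>) * (4 * n powr (3 / 4) + CS * n powr (3 / 4))"
        unfolding type_II_weight_def
      proof (intro mult_mono add_mono)
        show "real H \<le> n powr \<theta>" using H by (simp add: n_def)
        show "real D \<le> CD * n powr \<epsilon>" by (rule D2)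
        have "2 * real N / real Y \<le> 2 * n / (n powr (1 / 4) / 2)"
          using Yge Y3 n0 unfolding n_def by (intro divide_left_mono) auto
        also have "\<dots> = 4 * (n powr 1 / n powr (1 / 4))" using n0 by simp
        also have "\<dots> = 4 * n powr (3 / 4)" unfolding powr_diff[symmetric] by simp
        finally show "2 * real N / real Y \<le> 4 * n powr (3 / 4)" .
        have "n powr (\<theta> + 1 / 2 + \<epsilon>) \<le> n powr (3 / 4)" 
        proof (rule powr_mono)
          have "\<epsilon> \<le> \<kappa>" using \<kappa> by (simp add: \<epsilon>_def)
          then show "\<theta> + 1 / 2 + \<epsilon> \<le> 3 / 4" unfolding \<kappa>_def by linarith
        qed (rule n0(2))
        then have "CS * n powr (\<theta> + 1 / 2 + \<epsilon>) \<le> CS * n powr (3 / 4)" using pos(3) by (intro mult_left_mono) auto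
        then show "(\<Sum>l=1..2*H*Z. 1 / nearest_int_dist (real l * \<alpha>)) \<le> CS * n powr (3 / 4)" using S by linarith
      qed (use CD in \<open>auto intro!: add_nonneg_nonneg sum_nonneg\<close>)
      also have "\<dots> = CW * (n powr \<theta> * n powr \<epsilon> * n powr (3 / 4))" by (simp add: CW_def algebra_simps)
      also have "n powr \<theta> * n powr \<epsilon> * n powr (3 / 4) = n powr (1 - \<kappa> + \<epsilon>)"
        unfolding powr_add[symmetric] by (simp add: \<kappa>_def algebra_simps)
      finally show ?thesis .
    qed
    have "norm (\<Sum>b | b \<in> coprime_square_sums \<and> b \<le> N. exp_poly \<alpha> c H b)
      \<le> 2 / \<gamma> * (real H * real Y)\<^sup>2 + 4 * real J ^ 3 * sqrt (type_II_weight H D N Y Z) * sqrt (real N)"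
      by (rule exponential_sum_explicit[OF c D1 Y3 Y1 ZN Z2 J1])
    also have "\<dots> \<le> 2 / \<gamma> * n powr (1 - \<kappa> / 4) + 4 * CJ ^ 3 * sqrt CW * n powr (1 - \<kappa> / 4)"
    proof (rule add_mono)
      have "real H * real Y \<le> n powr \<theta> * n powr (1 / 4)" using H Yle unfolding n_def by (intro mult_mono) auto
      then have "(real H * real Y)\<^sup>2 \<le> (n powr \<theta> * n powr (1 / 4))\<^sup>2" by (intro power_mono) auto
      also have "\<dots> = n powr (2 * \<theta> + 1 / 2)" by (simp add: power2_eq_square powr_add[symmetric])
      also have "\<dots> \<le> n powr (1 - \<kappa> / 4)"
      proof (rule powr_mono)
        have "\<theta> = 1 / 4 - \<kappa>" by (simp add: \<kappa>_def)
        then show "2 * \<theta> + 1 / 2 \<le> 1 - \<kappa> / 4" using \<kappa> by linarith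
      qed (rule n0(2))
      finally show "2 / \<gamma> * (real H * real Y)\<^sup>2 \<le> 2 / \<gamma> * n powr (1 - \<kappa> / 4)"
        using \<gamma>_pos by (intro mult_left_mono) auto
      have "sqrt (type_II_weight H D N Y Z) \<le> sqrt (CW * n powr (1 - \<kappa> + \<epsilon>))" using W by simp
      also have "\<dots> = sqrt CW * n powr ((1 - \<kappa> + \<epsilon>) / 2)"
        by (simp add: real_sqrt_mult powr_half_sqrt[symmetric] powr_powr)
      finally have s: "sqrt (type_II_weight H D N Y Z) \<le> sqrt CW * n powr ((1 - \<kappa> + \<epsilon>) / 2)" .
      have "4 * real J ^ 3 * sqrt (type_II_weight H D N Y Z) * sqrt (real N)
         \<le> 4 * (CJ * n powr \<epsilon>) ^ 3 * (sqrt CW * n powr ((1 - \<kappa> + \<epsilon>) / 2)) * n powr (1 / 2)"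
        using J2 s pos n0 by (intro mult_mono power_mono) (auto simp: powr_half_sqrt n_def type_II_weight_def
           intro!: mult_nonneg_nonneg add_nonneg_nonneg sum_nonneg)
      also have "\<dots> = 4 * CJ ^ 3 * sqrt CW * (n powr \<epsilon> * n powr \<epsilon> * n powr \<epsilon> * n powr ((1 - \<kappa> + \<epsilon>) / 2) * n powr (1 / 2))"
        by (simp add: power3_eq_cube)
      also have "n powr \<epsilon> * n powr \<epsilon> * n powr \<epsilon> * n powr ((1 - \<kappa> + \<epsilon>) / 2) * n powr (1 / 2) = n powr (1 - \<kappa> / 4)"
        unfolding powr_add[symmetric] by (rule arg_cong[where f = "(powr) n"]) (simp add: \<epsilon>_def field_simps)
      finally show "4 * real J ^ 3 * sqrt (type_II_weight H D N Y Z) * sqrt (real N) \<le> 4 * CJ ^ 3 * sqrt CW * n powr (1 - \<kappa> / 4)" .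
    qed
    also have "\<dots> = C * real N powr (1 - (1 / 4 - \<theta>) / 4)"
      by (simp add: C_def n_def \<kappa>_def distrib_right)
    finally show "norm (\<Sum>b | b \<in> coprime_square_sums \<and> b \<le> N. exp_poly \<alpha> c H b) \<le> C * real N powr (1 - (1 / 4 - \<theta>) / 4)" .
  qed
qed

end

section \<open>Choice of parameters and the asymptotic formula\<close>

theorem theorem1p9:
  fixes \<alpha> \<beta> lam :: real
  assumes "quadratic_irrational \<alpha>"
    and "0 < lam" and "lam < 1 / 4"
  shows "(\<lambda>N :: real. real (card {b \<in> coprime_square_sums.
             real b \<le> N \<and> nearest_int_dist (real b * \<alpha> - \<beta>) \<le> N powr (- lam)}))
         \<sim>[at_top]
         (\<lambda>N. 2 * real (coprime_square_sums_count N) / N powr lam)"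
proof -
  obtain \<gamma> where "badly_approximable \<alpha> \<gamma>"
    using quadratic_irrational_badly_approximable[OF assms(1)] by (auto simp: badly_approximable_def)
  then interpret badly_approximable \<alpha> \<gamma> .
  \<comment> \<open>The midpoint of lam and 1/4, so that kappa is both the room for smoothing above
    lam and the room for saving below 1/4.\<close>
  define \<theta> where "\<theta> = (lam + 1 / 4) / 2"
  define \<kappa> where "\<kappa> = 1 / 4 - \<theta>"
  have \<theta>: "0 < \<theta>" "\<theta> < 1 / 4" "\<theta> = lam + \<kappa>" "0 < \<kappa>" "\<kappa> < 1 / 4"
    using assms by (auto simp: \<theta>_def \<kappa>_def field_simps)
  obtain C where C: "C > 0" "\<And>(n :: nat) (H :: nat) c. n \<ge> 16 \<Longrightarrow> real H \<le> real n powr \<theta> \<Longrightarrow> (\<And>h. norm (c h) \<le> 1) \<Longrightarrow>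
      norm (\<Sum>b | b \<in> coprime_square_sums \<and> b \<le> n. exp_poly \<alpha> c H b) \<le> C * real n powr (1 - \<kappa> / 4)"
    using exponential_sum_bound[OF \<theta>(1,2)] unfolding \<kappa>_def by blast
  \<comment> \<open>A loss of kappa/8 is half of the saving kappa/4 in the exponential sums.\<close>
  obtain c0 where c0: "c0 > 0" "\<And>n :: nat. n \<ge> 8 \<Longrightarrow> c0 * real n powr (1 - \<kappa> / 8) \<le> real (card {b \<in> coprime_square_sums. b \<le> n})"
    using coprime_square_sums_count_ge[of "\<kappa> / 8"] \<theta>(4) by auto
  \<comment> \<open>Below, eta R >= N^(kappa/3), so k >= 3/kappa makes the denominator (2 eta R)^(2
    k) of the kernel tail at least N^2.\<close>
  define k where "k = nat \<lceil>3 / \<kappa>\<rceil>"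
  have k: "3 / \<kappa> \<le> real k" unfolding k_def using \<theta>(4) by (simp add: of_nat_ceiling)
  \<comment> \<open>The gap kappa is divided in thirds: eta is smaller than the arc by N^(-kappa/3),
    1/R is smaller than eta by as much again, and the last third absorbs the factor k in k R <=
    N^theta.\<close>
  define R where "R N = nat \<lceil>N powr (lam + 2 * \<kappa> / 3)\<rceil>" for N :: real
  define \<eta> where "\<eta> N = N powr (- lam - \<kappa> / 3)" for N :: real
  define f where "f N = real (card {b \<in> coprime_square_sums.
             real b \<le> N \<and> nearest_int_dist (real b * \<alpha> - \<beta>) \<le> N powr (- lam)})" for N :: real
  define g where "g N = 2 * real (coprime_square_sums_count N) / N powr lam" for N :: real
  \<comment> \<open>The terms stem from the smoothing width eta, from the kernel tail 2/N, and from
    the exponential sums relative to \<open>card F\<close>.\<close>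
  define err where "err N = 3 / 2 * N powr (- (\<kappa> / 3)) + N powr (lam - 1) + 5 * (C / c0) * (N / 2) powr (- (\<kappa> / 8))" for N :: real
  have E1: "eventually (\<lambda>N :: real. real k * (N powr (lam + 2 * \<kappa> / 3) + 1) \<le> (N / 2) powr (lam + \<kappa>)) at_top"
    using \<theta>(4) assms(2) by real_asymp
  have E2: "eventually (\<lambda>N :: real. N powr (- lam) + N powr (- lam - \<kappa> / 3) < 1 / 2) at_top"
    using \<theta>(4) assms(2) by real_asymp
  have E4: "eventually (\<lambda>N :: real. N \<ge> 34) at_top" by (rule eventually_ge_at_top)
  have main: "eventually (\<lambda>N. norm (f N / g N - 1) \<le> err N) at_top"
    using E1 E2 E4
  proof eventually_elim
    case (elim N)
    define n where "n = nat \<lfloor>N\<rfloor>"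
    have n1: "real n \<le> N" "N < real n + 1" using elim(3) by (auto simp: n_def)
    then have n2: "N / 2 \<le> real n" "n \<ge> 16" using elim(3) by linarith+
    have le_iff: "real b \<le> N \<longleftrightarrow> b \<le> n" for b :: nat
      using n1 by (metis n_def le_nat_floor of_nat_le_iff order_trans)
    define F where "F = {b. b \<in> coprime_square_sums \<and> b \<le> n}"
    have finF: "finite F" by (simp add: F_def)
    have fF: "f N = real (card {b \<in> F. nearest_int_dist (real b * \<alpha> - \<beta>) \<le> N powr (- lam)})"
      unfolding f_def F_def le_iff by (rule arg_cong[where f = "\<lambda>X. real (card X)"]) auto
    have gF: "coprime_square_sums_count N = card F"
      unfolding coprime_square_sums_count_def F_def le_iff by (rule arg_cong[where f = card]) auto
    have cardF: "c0 * real n powr (1 - \<kappa> / 8) \<le> real (card F)"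
      using c0(2)[of n] n2 by (simp add: F_def)
    have npos: "real n > 0" using n2 by simp
    have cF0: "real (card F) > 0" using cardF c0(1) npos by (smt (verit) mult_pos_pos powr_gt_zero)
    define \<Delta> where "\<Delta> = N powr (- lam)"
    define G where "G = C * real n powr (1 - \<kappa> / 4)"
    define \<tau> where "\<tau> = (real (k * R N) + 1) / (2 * \<eta> N * real (R N)) ^ (2 * k)"
    have R1: "real (R N) \<ge> N powr (lam + 2 * \<kappa> / 3)" "real (R N) \<le> N powr (lam + 2 * \<kappa> / 3) + 1"
      unfolding R_def using powr_ge_zero[of N "lam + 2 * \<kappa> / 3"] by linarith+
    have N1: "N \<ge> 1" using elim(3) by simp
    have "1 \<le> N powr (lam + 2 * \<kappa> / 3)" using N1 assms(2) \<theta>(4) by (intro ge_one_powr_ge_zero) auto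
    then have R2: "R N \<ge> 1" using R1 by linarith
    have kR: "real (k * R N) \<le> real n powr \<theta>"
    proof -
      have "real (k * R N) \<le> real k * (N powr (lam + 2 * \<kappa> / 3) + 1)" using R1 by (simp add: mult_left_mono)
      also have "\<dots> \<le> (N / 2) powr \<theta>" using elim(1) \<theta>(3) by simp
      also have "\<dots> \<le> real n powr \<theta>" using n2 elim(3) \<theta>(1) by (intro powr_mono2) auto
      finally show ?thesis .
    qed
    have \<eta>0: "0 < \<eta> N" using N1 by (simp add: \<eta>_def)
    have \<eta>\<Delta>: "\<eta> N = N powr (- (\<kappa> / 3)) * \<Delta>" by (simp add: \<eta>_def \<Delta>_def powr_add[symmetric] algebra_simps)
    have "\<eta> N \<le> \<Delta>" unfolding \<eta>_def \<Delta>_def using N1 \<theta>(4) by (intro powr_mono) auto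
    have \<tau>le: "\<tau> \<le> 2 / N"
    proof -
      have "2 * N powr (\<kappa> / 3) = 2 * (N powr (- lam - \<kappa> / 3) * N powr (lam + 2 * \<kappa> / 3))"
        unfolding powr_add[symmetric] by simp
      also have "\<dots> \<le> 2 * (\<eta> N * real (R N))" unfolding \<eta>_def using R1 by (intro mult_left_mono) auto
      finally have *: "N powr (\<kappa> / 3) \<le> 2 * \<eta> N * real (R N)" 
        using powr_ge_zero[of N "\<kappa> / 3"] unfolding mult.assoc by linarith
      have "N powr 2 \<le> N powr (\<kappa> / 3 * real (2 * k))"
        using N1 k \<theta>(4) by (intro powr_mono) (auto simp: field_simps)
      also have "\<dots> = (N powr (\<kappa> / 3)) ^ (2 * k)" 
        unfolding powr_powr[symmetric] using N1 by (subst powr_realpow) auto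
      also have "\<dots> \<le> (2 * \<eta> N * real (R N)) ^ (2 * k)" using * by (intro power_mono) auto
      finally have den: "N powr 2 \<le> (2 * \<eta> N * real (R N)) ^ (2 * k)" .
      have "real (k * R N) + 1 \<le> real k * (N powr (lam + 2 * \<kappa> / 3) + 1) + 1" using R1 by (simp add: mult_left_mono)
      also have "\<dots> \<le> (N / 2) powr \<theta> + 1" using elim(1) \<theta>(3) by simp
      also have "\<dots> \<le> (N / 2) powr 1 + 1" using elim(3) \<theta>(2) by (intro add_right_mono powr_mono) auto
      also have "\<dots> \<le> 2 * N" using elim(3) by simp
      finally have "\<tau> \<le> 2 * N / N powr 2" unfolding \<tau>_def using den N1 by (intro frac_le) auto
      also have "\<dots> = 2 / N" using N1 by (simp add: powr_numeral power2_eq_square)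
      finally show ?thesis .
    qed
    have "\<bar>real (card {b \<in> F. nearest_int_dist (real b * \<alpha> - \<beta>) \<le> \<Delta>}) - 2 * \<Delta> * real (card F)\<bar>
        \<le> (3 * \<eta> N + \<tau>) * real (card F) + 2 * (2 * \<Delta> + 3 * \<eta> N) * G"
      unfolding \<tau>_def
    proof (rule equidistribution_from_exponential_sums[OF R2 \<eta>0 \<open>\<eta> N \<le> \<Delta>\<close> _ finF])
      show "\<Delta> + \<eta> N < 1 / 2" using elim(2) by (simp add: \<Delta>_def \<eta>_def)
      fix c :: "nat \<Rightarrow> complex" assume c: "\<And>h. norm (c h) \<le> 1"
      \<comment> \<open>The shift by beta disappears into the coefficients.\<close>
      define c' where "c' h = c h * expi (- (real h * \<beta>))" for h
      have "(\<Sum>h=1..k * R N. c h * (\<Sum>b\<in>F. expi (real h * (real b * \<alpha> - \<beta>)))) = (\<Sum>b\<in>F. exp_poly \<alpha> c' (k * R N) b)"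
        unfolding exp_poly_def c'_def sum_distrib_left
      proof (subst sum.swap, intro sum.cong refl)
        fix b h
        have "expi (real h * (real b * \<alpha> - \<beta>)) = expi (- (real h * \<beta>)) * expi (real h * real b * \<alpha>)"
          unfolding expi_add[symmetric] by (simp add: algebra_simps)
        then show "c h * expi (real h * (real b * \<alpha> - \<beta>)) = c h * expi (- (real h * \<beta>)) * expi (real h * real b * \<alpha>)"
          by simp
      qed
      also have "norm \<dots> \<le> G"
        unfolding F_def G_def using n2(2) kR by (rule C(2)) (simp add: c'_def norm_mult c)
      finally show "norm (\<Sum>h=1..k * R N. c h * (\<Sum>b\<in>F. expi (real h * (real b * \<alpha> - \<beta>)))) \<le> G" .
    qed
    then have diff: "\<bar>f N - 2 * \<Delta> * real (card F)\<bar> \<le> (3 * \<eta> N + 2 / N) * real (card F) + 10 * \<Delta> * G"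
    proof -
      have "(3 * \<eta> N + \<tau>) * real (card F) \<le> (3 * \<eta> N + 2 / N) * real (card F)"
        using \<tau>le by (intro mult_right_mono) auto
      moreover have "2 * (2 * \<Delta> + 3 * \<eta> N) * G \<le> 10 * \<Delta> * G"
        using \<open>\<eta> N \<le> \<Delta>\<close> C(1) by (intro mult_right_mono) (auto simp: G_def)
      ultimately show ?thesis using \<open>\<bar>_\<bar> \<le> _\<close> unfolding fF \<Delta>_def[symmetric] by linarith
    qed
    have \<Delta>0: "\<Delta> > 0" using N1 by (simp add: \<Delta>_def)
    have g: "g N = 2 * \<Delta> * real (card F)"
      unfolding g_def gF \<Delta>_def by (simp add: powr_minus divide_inverse)
    have g0: "g N > 0" unfolding g using \<Delta>0 cF0 by simp
    have "norm (f N / g N - 1) = \<bar>f N - g N\<bar> / g N" using g0 by (simp add: diff_divide_distrib[symmetric] field_simps)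
    also have "\<dots> \<le> ((3 * \<eta> N + 2 / N) * real (card F) + 10 * \<Delta> * G) / g N"
      using diff g0 unfolding g[symmetric] by (intro divide_right_mono) auto
    also have "\<dots> = 3 / 2 * (\<eta> N / \<Delta>) + 1 / (N * \<Delta>) + 5 * (G / real (card F))"
      unfolding g using \<Delta>0 cF0 N1 by (simp add: field_simps)
    also have "\<eta> N / \<Delta> = N powr (- (\<kappa> / 3))" unfolding \<eta>\<Delta> using \<Delta>0 by simp
    also have "1 / (N * \<Delta>) = N powr (lam - 1)"
      using N1 by (simp add: \<Delta>_def powr_diff powr_minus field_simps)
    also have "G / real (card F) \<le> (C / c0) * (N / 2) powr (- (\<kappa> / 8))"
    proof -
      have "G / real (card F) \<le> G / (c0 * real n powr (1 - \<kappa> / 8))"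
        using cardF C(1) c0(1) npos cF0 by (intro divide_left_mono) (auto simp: G_def)
      also have "\<dots> = (C / c0) * (real n powr (1 - \<kappa> / 4) / real n powr (1 - \<kappa> / 8))" by (simp add: G_def)
      also have "real n powr (1 - \<kappa> / 4) / real n powr (1 - \<kappa> / 8) = real n powr (- (\<kappa> / 8))"
        unfolding powr_diff[symmetric] by (rule arg_cong[where f = "(powr) (real n)"]) simp
      also have "(C / c0) * real n powr (- (\<kappa> / 8)) \<le> (C / c0) * (N / 2) powr (- (\<kappa> / 8))"
        using n2 C(1) c0(1) \<theta>(4) elim(3) by (intro mult_left_mono powr_mono2') auto
      finally show ?thesis .
    qed
    finally show ?case by (simp add: err_def mult.assoc)
  qed
  have "((\<lambda>N :: real. N powr (- (\<kappa> / 3))) \<longlongrightarrow> 0) at_top" using \<theta>(4) by real_asymp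
  moreover have "lam - 1 < 0" using assms(3) by simp
  then have "((\<lambda>N :: real. N powr (lam - 1)) \<longlongrightarrow> 0) at_top"
    by (intro tendsto_neg_powr filterlim_ident)
  moreover have "((\<lambda>N :: real. (N / 2) powr (- (\<kappa> / 8))) \<longlongrightarrow> 0) at_top" using \<theta>(4) by real_asymp
  ultimately have "(err \<longlongrightarrow> 3 / 2 * 0 + 0 + 5 * (C / c0) * 0) at_top"
    unfolding err_def by (intro tendsto_add tendsto_mult tendsto_const)
  then have "(err \<longlongrightarrow> 0) at_top" by simp
  then have "((\<lambda>N. f N / g N - 1) \<longlongrightarrow> 0) at_top"
    using main by (rule Lim_null_comparison[rotated])
  then have "((\<lambda>N. f N / g N) \<longlongrightarrow> 1) at_top"
    by (simp add: LIM_zero_iff)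
  then have "f \<sim>[at_top] g" by (rule asymp_equivI')
  then show ?thesis unfolding f_def g_def .
qed

end
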